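(* Let $Y$ be a finite graph on which a finite abelian group $G$ acts without inversion, let $X=Y_G$, and let $V$ be an Artin representation of $G$. Then $\chi_V(Y)=\psi_V(\chi_{\mathbb{C}[G]}(Y))$. Moreover, if $V$ is irreducible with character $\psi$, then $$\chi_\psi(Y)=\chi(X)-r_0(\psi)+r_1(\psi);$$ in particular, if $G$ acts freely on $\mathbf{E}_Y$, then $\chi_\psi(Y)=\chi(X)-r_0(\psi)$.
   Context: Graphs in Serre's sense (vertices $V_Y$, directed edges $\mathbf{E}_Y$, maps $o,t$, fixed-point-free involution $\varepsilon\mapsto\bar\varepsilon$ with $o(\bar\varepsilon)=t(\varepsilon)$); $E_X$ undirected edges; $\chi(X)=|V_X|-|E_X|$. Without inversion: $\sigma\varepsilon\ne\bar\varepsilon$. $G_v$ ($v\in V_X$), $G_s$ ($s\in\mathbf{E}_X$) denote stabilizers of any vertex/edge of $Y$ above $v$/$s$ (well defined as $G$ is abelian). $O_X$ is an orientation of $X$ (contains exactly one of $s,\bar s$ for each $s$). For $\psi\in\widehat G$ (homomorphisms $G\to\mathbb{C}^\times$), $r_0(\psi)=|\{v\in V_X:G_v\not\subseteq\ker\psi\}|$, $r_1(\psi)=|\{s\in O_X:G_s\not\subseteq\ker\psi\}|$. An Artin representation is a finitely generated $\mathbb{C}[G]$-module $V$; its character $\psi_V:\mathbb{C}[G]\to\mathbb{C}$ sends $\lambda$ to the trace of $\lambda$ acting on $V$. $C_0(Y)=\mathbb{C}V_Y$, $C_1(Y)=\mathbb{C}\mathbf{E}_Y/W$ with $W$ spanned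 by the $\varepsilon+\bar\varepsilon$; $\chi_V(Y)=\dim_\mathbb{C}(V\otimes_{\mathbb{C}[G]}C_0(Y))-\dim_\mathbb{C}(V\otimes_{\mathbb{C}[G]}C_1(Y))$, written $\chi_\psi(Y)$ if $\psi=\psi_V$. $\chi_{\mathbb{C}[G]}(Y)=\mathrm{rank}_{\mathbb{C}[G]}C_0(Y)-\mathrm{rank}_{\mathbb{C}[G]}C_1(Y)\in\mathbb{C}[G]$, with $\mathrm{rank}_R M=\mathrm{tr}_R(\mathrm{id}_M)$ the Hattori–Stallings rank of a finitely generated projective module (trace of $f$ defined as the trace of $f\oplus 0_N$ on a free module $M\oplus N$). *)

theory Defs
  imports
    "HOL-Algebra.Group_Action"
    "HOL-Algebra.AbelCoset"
    "Jordan_Normal_Form.VS_Connect"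
begin

section \<open>Graphs in the sense of Serre and group actions on them\<close>

record ('v, 'e) serre_graph =
  verts :: "'v set"
  dedges :: "'e set"
  org :: "'e \<Rightarrow> 'v"
  ter :: "'e \<Rightarrow> 'v"
  opp :: "'e \<Rightarrow> 'e"

locale serre_graph =
  fixes Y :: "('v, 'e) serre_graph"
  assumes org_closed: "e \<in> dedges Y \<Longrightarrow> org Y e \<in> verts Y"
    and ter_closed: "e \<in> dedges Y \<Longrightarrow> ter Y e \<in> verts Y"
    and opp_closed: "e \<in> dedges Y \<Longrightarrow> opp Y e \<in> dedges Y"
    and opp_opp: "e \<in> dedges Y \<Longrightarrow> opp Y (opp Y e) = e"
    and opp_neq: "e \<in> dedges Y \<Longrightarrow> opp Y e \<noteq> e"
    and org_opp: "e \<in> dedges Y \<Longrightarrow> org Y (opp Y e) = ter Y e"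

locale finite_serre_graph = serre_graph +
  assumes finite_verts: "finite (verts Y)"
    and finite_dedges: "finite (dedges Y)"

definition undirected_edges :: "('v, 'e) serre_graph \<Rightarrow> 'e set set" where
  "undirected_edges Y = (\<lambda>e. {e, opp Y e}) ` dedges Y"

definition euler_char :: "('v, 'e) serre_graph \<Rightarrow> int" where
  "euler_char Y = int (card (verts Y)) - int (card (undirected_edges Y))"

definition is_orientation :: "('v, 'e) serre_graph \<Rightarrow> 'e set \<Rightarrow> bool" where
  "is_orientation Y Or \<longleftrightarrow>
     Or \<subseteq> dedges Y \<and> (\<forall>e\<in>dedges Y. (e \<in> Or) \<noteq> (opp Y e \<in> Or))"

locale graph_action =
  serre_graph Y +
  verts_action: group_action G "verts Y" av +
  dedges_action: group_action G "dedges Y" ae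
  for G :: "('g, 'm) monoid_scheme" (structure)
    and Y :: "('v, 'e) serre_graph"
    and av :: "'g \<Rightarrow> 'v \<Rightarrow> 'v"
    and ae :: "'g \<Rightarrow> 'e \<Rightarrow> 'e" +
  assumes org_equivariant: "\<lbrakk>g \<in> carrier G; e \<in> dedges Y\<rbrakk> \<Longrightarrow> org Y (ae g e) = av g (org Y e)"
    and ter_equivariant: "\<lbrakk>g \<in> carrier G; e \<in> dedges Y\<rbrakk> \<Longrightarrow> ter Y (ae g e) = av g (ter Y e)"
    and opp_equivariant: "\<lbrakk>g \<in> carrier G; e \<in> dedges Y\<rbrakk> \<Longrightarrow> opp Y (ae g e) = ae g (opp Y e)"

locale graph_action_without_inversion = graph_action +
  assumes no_inversion: "\<lbrakk>g \<in> carrier G; e \<in> dedges Y\<rbrakk> \<Longrightarrow> ae g e \<noteq> opp Y e"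

definition acts_freely :: "('g, 'm) monoid_scheme \<Rightarrow> 'x set \<Rightarrow> ('g \<Rightarrow> 'x \<Rightarrow> 'x) \<Rightarrow> bool" where
  "acts_freely G S \<phi> \<longleftrightarrow> (\<forall>x\<in>S. stabilizer G \<phi> x = {\<one>\<^bsub>G\<^esub>})"

text \<open>The vertices and edges of the quotient are orbits; by equivariance the pointwise image of an
  orbit of edges under \<^term>\<open>org Y\<close>, \<^term>\<open>ter Y\<close>, \<^term>\<open>opp Y\<close> is again an orbit, namely that of the
  origin, terminus, opposite of any representative.\<close>

definition quotient_graph ::
  "('g, 'm) monoid_scheme \<Rightarrow> ('v, 'e) serre_graph \<Rightarrow> ('g \<Rightarrow> 'v \<Rightarrow> 'v) \<Rightarrow> ('g \<Rightarrow> 'e \<Rightarrow> 'e)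
     \<Rightarrow> ('v set, 'e set) serre_graph" where
  "quotient_graph G Y av ae =
     \<lparr>verts = orbits G (verts Y) av,
      dedges = orbits G (dedges Y) ae,
      org = image (org Y), ter = image (ter Y), opp = image (opp Y)\<rparr>"

text \<open>For abelian \<open>G\<close> all points of an orbit \<open>s\<close> have the same stabilizer.\<close>

definition orbit_stabilizer ::
  "('g, 'm) monoid_scheme \<Rightarrow> ('g \<Rightarrow> 'x \<Rightarrow> 'x) \<Rightarrow> 'x set \<Rightarrow> 'g set" where
  "orbit_stabilizer G \<phi> s = the_elem (stabilizer G \<phi> ` s)"

definition r0 ::
  "('g, 'm) monoid_scheme \<Rightarrow> ('v, 'e) serre_graph \<Rightarrow> ('g \<Rightarrow> 'v \<Rightarrow> 'v) \<Rightarrow> ('g \<Rightarrow> 'e \<Rightarrow> 'e)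
     \<Rightarrow> ('g \<Rightarrow> complex) \<Rightarrow> nat" where
  "r0 G Y av ae \<psi> =
     card {v \<in> verts (quotient_graph G Y av ae).
             \<not> orbit_stabilizer G av v \<subseteq> kernel G (units_of class_ring) \<psi>}"

definition r1 ::
  "('g, 'm) monoid_scheme \<Rightarrow> ('g \<Rightarrow> 'e \<Rightarrow> 'e) \<Rightarrow> 'e set set \<Rightarrow> ('g \<Rightarrow> complex) \<Rightarrow> nat" where
  "r1 G ae Or \<psi> =
     card {s \<in> Or. \<not> orbit_stabilizer G ae s \<subseteq> kernel G (units_of class_ring) \<psi>}"


section \<open>Constructions with modules over a commutative ring\<close>

text \<open>The free module on a set \<open>S\<close>: finitely supported functions, vanishing outside \<open>S\<close>. As in
  \<^const>\<open>direct_sum\<close>, the multiplicative fields of a module record carry no meaning.\<close>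

definition single :: "('r, 'x) ring_scheme \<Rightarrow> 's \<Rightarrow> 's \<Rightarrow> 'r" where
  "single R s = (\<lambda>x. if x = s then \<one>\<^bsub>R\<^esub> else \<zero>\<^bsub>R\<^esub>)"

definition free_module :: "('r, 'x) ring_scheme \<Rightarrow> 's set \<Rightarrow> ('r, 's \<Rightarrow> 'r) module" where
  "free_module R S =
     \<lparr>carrier = {f. range f \<subseteq> carrier R \<and> (\<forall>x. x \<notin> S \<longrightarrow> f x = \<zero>\<^bsub>R\<^esub>) \<and> finite {x. f x \<noteq> \<zero>\<^bsub>R\<^esub>}},
      mult = (\<lambda>f g x. \<zero>\<^bsub>R\<^esub>),
      one = (\<lambda>x. \<zero>\<^bsub>R\<^esub>),
      zero = (\<lambda>x. \<zero>\<^bsub>R\<^esub>),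
      add = (\<lambda>f g x. f x \<oplus>\<^bsub>R\<^esub> g x),
      smult = (\<lambda>a f x. a \<otimes>\<^bsub>R\<^esub> f x)\<rparr>"

definition quot_module :: "('r, 'w, 'y) module_scheme \<Rightarrow> 'w set \<Rightarrow> ('r, 'w set) module" where
  "quot_module M W =
     \<lparr>carrier = a_rcosets\<^bsub>M\<^esub> W,
      mult = (\<lambda>A B. W),
      one = W,
      zero = W,
      add = (\<lambda>A B. A <+>\<^bsub>M\<^esub> B),
      smult = (\<lambda>a A. \<Union>x\<in>A. W +>\<^bsub>M\<^esub> (a \<odot>\<^bsub>M\<^esub> x))\<rparr>"

definition tensor_relations ::
  "('r, 'x) ring_scheme \<Rightarrow> ('r, 'p, 'y) module_scheme \<Rightarrow> ('r, 'q, 'z) module_scheme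
     \<Rightarrow> ('p \<times> 'q \<Rightarrow> 'r) set" where
  "tensor_relations R M N =
     (let F = free_module R (carrier M \<times> carrier N); d = (\<lambda>m n. single R (m, n)) in
        {d (m \<oplus>\<^bsub>M\<^esub> m') n \<ominus>\<^bsub>F\<^esub> (d m n \<oplus>\<^bsub>F\<^esub> d m' n) | m m' n.
            m \<in> carrier M \<and> m' \<in> carrier M \<and> n \<in> carrier N}
      \<union> {d m (n \<oplus>\<^bsub>N\<^esub> n') \<ominus>\<^bsub>F\<^esub> (d m n \<oplus>\<^bsub>F\<^esub> d m n') | m n n'.
            m \<in> carrier M \<and> n \<in> carrier N \<and> n' \<in> carrier N}
      \<union> {d (a \<odot>\<^bsub>M\<^esub> m) n \<ominus>\<^bsub>F\<^esub> a \<odot>\<^bsub>F\<^esub> d m n | a m n.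
            a \<in> carrier R \<and> m \<in> carrier M \<and> n \<in> carrier N}
      \<union> {d m (a \<odot>\<^bsub>N\<^esub> n) \<ominus>\<^bsub>F\<^esub> a \<odot>\<^bsub>F\<^esub> d m n | a m n.
            a \<in> carrier R \<and> m \<in> carrier M \<and> n \<in> carrier N})"

definition tensor_product ::
  "('r, 'x) ring_scheme \<Rightarrow> ('r, 'p, 'y) module_scheme \<Rightarrow> ('r, 'q, 'z) module_scheme
     \<Rightarrow> ('r, ('p \<times> 'q \<Rightarrow> 'r) set) module" where
  "tensor_product R M N =
     (let F = free_module R (carrier M \<times> carrier N)
      in quot_module F (LinearCombinations.module.span R F (tensor_relations R M N)))"

definition finitely_generated :: "('r, 'x) ring_scheme \<Rightarrow> ('r, 'w, 'y) module_scheme \<Rightarrow> bool" where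
  "finitely_generated R M \<longleftrightarrow>
     (\<exists>S. finite S \<and> S \<subseteq> carrier M \<and> LinearCombinations.module.span R M S = carrier M)"

definition irreducible_module :: "('r, 'x) ring_scheme \<Rightarrow> ('r, 'w, 'y) module_scheme \<Rightarrow> bool" where
  "irreducible_module R M \<longleftrightarrow>
     module R M \<and> carrier M \<noteq> {\<zero>\<^bsub>M\<^esub>} \<and>
     (\<forall>N. submodule R N M \<longrightarrow> N = {\<zero>\<^bsub>M\<^esub>} \<or> N = carrier M)"


section \<open>Traces of endomorphisms\<close>

definition finite_basis ::
  "('r, 'x) ring_scheme \<Rightarrow> ('r, 'w, 'y) module_scheme \<Rightarrow> 'w set \<Rightarrow> bool" where
  "finite_basis R M B \<longleftrightarrow>
     finite B \<and> B \<subseteq> carrier M \<and> \<not> LinearCombinations.module.lin_dep R M B \<and> LinearCombinations.module.span R M B = carrier M"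

definition coords ::
  "('r, 'x) ring_scheme \<Rightarrow> ('r, 'w, 'y) module_scheme \<Rightarrow> 'w set \<Rightarrow> 'w \<Rightarrow> 'w \<Rightarrow> 'r" where
  "coords R M B m = (THE c. c \<in> B \<rightarrow>\<^sub>E carrier R \<and> LinearCombinations.module.lincomb M c B = m)"

text \<open>The trace of an endomorphism of a finitely generated free module is the sum of the diagonal
  entries of its matrix in any basis.\<close>

definition free_trace ::
  "('r, 'x) ring_scheme \<Rightarrow> ('r, 'w, 'y) module_scheme \<Rightarrow> ('w \<Rightarrow> 'w) \<Rightarrow> 'r" where
  "free_trace R M f =
     (THE t. \<exists>B. finite_basis R M B \<and> t = (\<Oplus>\<^bsub>R\<^esub>b\<in>B. coords R M B (f b) b))"

text \<open>The Hattori--Stallings trace over a commutative ring: the trace of \<open>f \<oplus> 0\<close> on a finitely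
  generated free module \<open>M \<oplus> N\<close>. Every finitely generated projective \<open>M\<close> has a complement \<open>N\<close> that
  is a submodule of some \<open>R\<^sup>n\<close>, so it is no restriction to let the elements of \<open>N\<close> be
  functions on the natural numbers.\<close>

definition hs_trace ::
  "('r, 'x) ring_scheme \<Rightarrow> ('r, 'w, 'y) module_scheme \<Rightarrow> ('w \<Rightarrow> 'w) \<Rightarrow> 'r" where
  "hs_trace R M f =
     (THE t. \<exists>N :: ('r, nat \<Rightarrow> 'r) module.
        module R N \<and> (\<exists>B. finite_basis R (direct_sum M N) B) \<and>
        t = free_trace R (direct_sum M N) (\<lambda>(m, n). (f m, \<zero>\<^bsub>N\<^esub>)))"

definition hs_rank :: "('r, 'x) ring_scheme \<Rightarrow> ('r, 'w, 'y) module_scheme \<Rightarrow> 'r" where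
  "hs_rank R M = hs_trace R M (\<lambda>m. m)"


section \<open>The complex group ring and its modules\<close>

definition group_ring :: "('g, 'm) monoid_scheme \<Rightarrow> ('g \<Rightarrow> complex) ring" where
  "group_ring G =
     \<lparr>carrier = carrier (free_module class_ring (carrier G)),
      mult = (\<lambda>a b x. if x \<in> carrier G
                       then \<Sum>y\<in>carrier G. a y * b (inv\<^bsub>G\<^esub> y \<otimes>\<^bsub>G\<^esub> x) else 0),
      one = single class_ring \<one>\<^bsub>G\<^esub>,
      zero = (\<lambda>x. 0),
      add = (\<lambda>a b x. a x + b x)\<rparr>"

text \<open>Restriction of scalars along \<open>z \<mapsto> z \<cdot> 1\<close> from the group ring to the complex numbers.\<close>

definition complex_space ::
  "('g, 'm) monoid_scheme \<Rightarrow> ('g \<Rightarrow> complex, 'w, 'y) module_scheme \<Rightarrow> (complex, 'w) module" where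
  "complex_space G M =
     \<lparr>carrier = carrier M, mult = mult M, one = one M, zero = zero M, add = add M,
      smult = (\<lambda>z m. (\<lambda>g. z * single class_ring \<one>\<^bsub>G\<^esub> g) \<odot>\<^bsub>M\<^esub> m)\<rparr>"

definition complex_dim ::
  "('g, 'm) monoid_scheme \<Rightarrow> ('g \<Rightarrow> complex, 'w, 'y) module_scheme \<Rightarrow> nat" where
  "complex_dim G M = vectorspace.dim class_ring (complex_space G M)"

definition artin_representation ::
  "('g, 'm) monoid_scheme \<Rightarrow> ('g \<Rightarrow> complex, 'w, 'y) module_scheme \<Rightarrow> bool" where
  "artin_representation G V \<longleftrightarrow> module (group_ring G) V \<and> finitely_generated (group_ring G) V"

definition artin_character ::
  "('g, 'm) monoid_scheme \<Rightarrow> ('g \<Rightarrow> complex, 'w, 'y) module_scheme \<Rightarrow> ('g \<Rightarrow> complex) \<Rightarrow> complex"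
  where
  "artin_character G V a = free_trace class_ring (complex_space G V) (\<lambda>v. a \<odot>\<^bsub>V\<^esub> v)"

text \<open>The complex vector space on a \<open>G\<close>-set \<open>S\<close>, with \<open>g\<close> mapping the basis vector of \<open>x\<close> to that of
  \<open>\<phi> g x\<close>.\<close>

definition perm_module ::
  "('g, 'm) monoid_scheme \<Rightarrow> 's set \<Rightarrow> ('g \<Rightarrow> 's \<Rightarrow> 's) \<Rightarrow> ('g \<Rightarrow> complex, 's \<Rightarrow> complex) module" where
  "perm_module G S \<phi> =
     \<lparr>carrier = carrier (free_module class_ring S),
      mult = (\<lambda>f h x. 0),
      one = (\<lambda>x. 0),
      zero = (\<lambda>x. 0),
      add = (\<lambda>f h x. f x + h x),
      smult = (\<lambda>a f x. if x \<in> S then \<Sum>g\<in>carrier G. a g * f (\<phi> (inv\<^bsub>G\<^esub> g) x) else 0)\<rparr>"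

definition chains0 ::
  "('g, 'm) monoid_scheme \<Rightarrow> ('v, 'e) serre_graph \<Rightarrow> ('g \<Rightarrow> 'v \<Rightarrow> 'v)
     \<Rightarrow> ('g \<Rightarrow> complex, 'v \<Rightarrow> complex) module" where
  "chains0 G Y av = perm_module G (verts Y) av"

definition chains1 ::
  "('g, 'm) monoid_scheme \<Rightarrow> ('v, 'e) serre_graph \<Rightarrow> ('g \<Rightarrow> 'e \<Rightarrow> 'e)
     \<Rightarrow> ('g \<Rightarrow> complex, ('e \<Rightarrow> complex) set) module" where
  "chains1 G Y ae =
     quot_module (perm_module G (dedges Y) ae)
       (LinearCombinations.module.span class_ring (free_module class_ring (dedges Y))
          {(\<lambda>x. single class_ring e x + single class_ring (opp Y e) x) | e. e \<in> dedges Y})"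

definition chi_rep ::
  "('g, 'm) monoid_scheme \<Rightarrow> ('v, 'e) serre_graph \<Rightarrow> ('g \<Rightarrow> 'v \<Rightarrow> 'v) \<Rightarrow> ('g \<Rightarrow> 'e \<Rightarrow> 'e)
     \<Rightarrow> ('g \<Rightarrow> complex, 'w, 'y) module_scheme \<Rightarrow> int" where
  "chi_rep G Y av ae V =
     int (complex_dim G (tensor_product (group_ring G) V (chains0 G Y av)))
     - int (complex_dim G (tensor_product (group_ring G) V (chains1 G Y ae)))"

definition chi_group_ring ::
  "('g, 'm) monoid_scheme \<Rightarrow> ('v, 'e) serre_graph \<Rightarrow> ('g \<Rightarrow> 'v \<Rightarrow> 'v) \<Rightarrow> ('g \<Rightarrow> 'e \<Rightarrow> 'e)
     \<Rightarrow> 'g \<Rightarrow> complex" where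
  "chi_group_ring G Y av ae =
     hs_rank (group_ring G) (chains0 G Y av) \<ominus>\<^bsub>group_ring G\<^esub> hs_rank (group_ring G) (chains1 G Y ae)"

end

theory Submission
  imports Defs
begin

text \<open>
  A finitely generated projective module \<open>M\<close> over a commutative ring has a finite dual basis
  \<open>(x\<^sub>i, \<phi>\<^sub>i)\<close>, that is \<open>m = \<Sum>\<^sub>i \<phi>\<^sub>i(m) x\<^sub>i\<close> for all \<open>m\<close>, and \<open>\<Sum>\<^sub>i \<phi>\<^sub>i(f x\<^sub>i)\<close> does not depend on it; this number
  is the trace of \<open>f\<close> in all the senses occurring here. If \<open>(v\<^sub>k, \<xi>\<^sub>k)\<close> is a complex dual basis of \<open>V\<close>, then the
  \<open>v\<^sub>k \<otimes> x\<^sub>i\<close> with the forms \<open>v \<otimes> m \<mapsto> \<xi>\<^sub>k(\<phi>\<^sub>i(m) v)\<close> are one of \<open>V \<otimes> M\<close>, so the dimension of \<open>V \<otimes> M\<close>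
  is \<open>\<Sum>\<^sub>i \<psi>\<^sub>V(\<phi>\<^sub>i(x\<^sub>i)) = \<psi>\<^sub>V(rank M)\<close>.

  For a permutation module the points \<open>x\<close> with \<open>\<phi>\<^sub>x(f) = |G|\<^sup>-\<^sup>1 \<Sum>\<^sub>g f(g x) g\<close> form a dual basis, hence the
  coefficient of its rank at \<open>g\<close> is the number of fixed points of \<open>g\<close> divided by \<open>|G|\<close>; for the edges
  modulo \<open>e + opp e\<close> antisymmetrizing gives half of this. An irreducible \<open>V\<close> is a line on which \<open>G\<close> acts
  through \<open>\<psi>\<close>, and summing \<open>\<psi>\<close> over a stabilizer leaves exactly the orbits whose stabilizer lies in
  the kernel of \<open>\<psi>\<close>.
\<close>

section \<open>Traces through dual bases\<close>

text \<open>Ranks and characters are defined here by definite descriptions, so each needs a witness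
  and a proof that all witnesses agree. Invariance of the dual basis trace settles the second point
  uniformly, and only the first asks for genuine bases. Bases would be the wrong tool for the
  computations: because of stabilizers the chain modules are in general not free over the group
  ring, and the vectors that span a tensor product may be dependent. A dual basis is checked by one
  identity, without any independence.

  Such families exist for the chain modules because |G| and 2 are invertible in the complex numbers.
  The factor 1/|G| appears since a point y is reached as g x by exactly |G| pairs (g, x), the factor
  1/2 since an undirected edge carries two directed ones.

  The absence of inversions enters twice. An element with g e = opp e would contribute -1/2 at e to
  the edge trace, and the orbit of e would coincide with that of opp e, so that the quotient would
  not be a graph.\<close>

definition linear_forms ::
  "('r, 'x) ring_scheme \<Rightarrow> ('r, 'w, 'y) module_scheme \<Rightarrow> ('w \<Rightarrow> 'r) set" where
  "linear_forms R M =
     {\<phi> \<in> carrier M \<rightarrow> carrier R.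
        (\<forall>m\<in>carrier M. \<forall>m'\<in>carrier M. \<phi> (m \<oplus>\<^bsub>M\<^esub> m') = \<phi> m \<oplus>\<^bsub>R\<^esub> \<phi> m') \<and>
        (\<forall>a\<in>carrier R. \<forall>m\<in>carrier M. \<phi> (a \<odot>\<^bsub>M\<^esub> m) = a \<otimes>\<^bsub>R\<^esub> \<phi> m)}"

text \<open>A family instead of a set, because members may repeat or vanish, for instance after a
  basis of a direct sum is projected to one summand. Independence is not asked for, so there may be
  more indices than any rank.\<close>

definition dual_basis ::
  "('r, 'x) ring_scheme \<Rightarrow> ('r, 'w, 'y) module_scheme \<Rightarrow> 'i set \<Rightarrow> ('i \<Rightarrow> 'w) \<Rightarrow> ('i \<Rightarrow> 'w \<Rightarrow> 'r) \<Rightarrow> bool"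
  where
  "dual_basis R M I x \<phi> \<longleftrightarrow>
     finite I \<and> x \<in> I \<rightarrow> carrier M \<and> \<phi> \<in> I \<rightarrow> linear_forms R M \<and>
     (\<forall>m\<in>carrier M. (\<Oplus>\<^bsub>M\<^esub>i\<in>I. \<phi> i m \<odot>\<^bsub>M\<^esub> x i) = m)"

lemma linear_formsD:
  assumes "\<phi> \<in> linear_forms R M"
  shows "m \<in> carrier M \<Longrightarrow> \<phi> m \<in> carrier R"
    and "\<lbrakk>m \<in> carrier M; m' \<in> carrier M\<rbrakk> \<Longrightarrow> \<phi> (m \<oplus>\<^bsub>M\<^esub> m') = \<phi> m \<oplus>\<^bsub>R\<^esub> \<phi> m'"
    and "\<lbrakk>a \<in> carrier R; m \<in> carrier M\<rbrakk> \<Longrightarrow> \<phi> (a \<odot>\<^bsub>M\<^esub> m) = a \<otimes>\<^bsub>R\<^esub> \<phi> m"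
  using assms by (auto simp: linear_forms_def)

lemma dual_basisD:
  assumes "dual_basis R M I x \<phi>"
  shows "finite I"
    and "i \<in> I \<Longrightarrow> x i \<in> carrier M"
    and "i \<in> I \<Longrightarrow> \<phi> i \<in> linear_forms R M"
    and "\<lbrakk>i \<in> I; m \<in> carrier M\<rbrakk> \<Longrightarrow> \<phi> i m \<in> carrier R"
    and "m \<in> carrier M \<Longrightarrow> (\<Oplus>\<^bsub>M\<^esub>i\<in>I. \<phi> i m \<odot>\<^bsub>M\<^esub> x i) = m"
  using assms by (auto simp: dual_basis_def linear_forms_def Pi_iff)

lemma (in Module.module) linear_form_finsum:
  assumes \<phi>: "\<phi> \<in> linear_forms R M" and f: "f \<in> I \<rightarrow> carrier M"
  shows "\<phi> (\<Oplus>\<^bsub>M\<^esub>i\<in>I. f i) = (\<Oplus>\<^bsub>R\<^esub>i\<in>I. \<phi> (f i))"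
proof -
  have 0: "\<phi> \<zero>\<^bsub>M\<^esub> = \<zero>\<^bsub>R\<^esub>"
    using linear_formsD(3)[OF \<phi>, of "\<zero>\<^bsub>R\<^esub>" "\<zero>\<^bsub>M\<^esub>"] linear_formsD(1)[OF \<phi>, of "\<zero>\<^bsub>M\<^esub>"] by simp
  show ?thesis using f
  \<comment> \<open>Over an infinite index set both sums are zero by convention, so \<phi> 0 = 0
    settles that case and \<open>I\<close> may be arbitrary.\<close>
  proof (induction I rule: infinite_finite_induct)
    case (insert i I)
    then have "f i \<in> carrier M" "f \<in> I \<rightarrow> carrier M" "(\<Oplus>\<^bsub>M\<^esub>i\<in>I. f i) \<in> carrier M"
      by auto
    then show ?case using insert
      by (simp add: linear_formsD[OF \<phi>] Pi_iff)
  qed (auto simp: 0)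
qed

lemma module_hom_finsum:
  assumes "module R M" "module R N" and T: "T \<in> LinearCombinations.module_hom R M N" and f: "f \<in> I \<rightarrow> carrier M"
  shows "T (\<Oplus>\<^bsub>M\<^esub>i\<in>I. f i) = (\<Oplus>\<^bsub>N\<^esub>i\<in>I. T (f i))"
proof -
  interpret mod_hom R M N T using assms by (simp add: mod_hom_def mod_hom_axioms_def)
  show ?thesis using f
  proof (induction I rule: infinite_finite_induct)
    case (insert i I)
    then have "f i \<in> carrier M" "f \<in> I \<rightarrow> carrier M" "(\<Oplus>\<^bsub>M\<^esub>i\<in>I. f i) \<in> carrier M"
      by auto
    then show ?case using insert
      by (simp add: Pi_iff)
  qed auto
qed

text \<open>Expanding \<open>f (x i)\<close> in the y_j and \<open>f (y j)\<close> in the x_i turns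
  both traces into the double sum of \<phi>_i(y_j) \<psi>_j(f(x_i)). Commutativity of
  \<open>R\<close> is what matches the order of the factors.\<close>

lemma (in Module.module) dual_basis_trace_unique:
  assumes x: "dual_basis R M I x \<phi>" and y: "dual_basis R M J y \<psi>" and f: "f \<in> LinearCombinations.module_hom R M M"
  shows "(\<Oplus>\<^bsub>R\<^esub>i\<in>I. \<phi> i (f (x i))) = (\<Oplus>\<^bsub>R\<^esub>j\<in>J. \<psi> j (f (y j)))"
proof -
  note xD = dual_basisD[OF x] and yD = dual_basisD[OF y]
  have fc: "f m \<in> carrier M" if "m \<in> carrier M" for m
    using f that by (auto simp: LinearCombinations.module_hom_def)
  have "\<phi> i (f (x i)) = (\<Oplus>\<^bsub>R\<^esub>j\<in>J. \<phi> i (y j) \<otimes>\<^bsub>R\<^esub> \<psi> j (f (x i)))" if i: "i \<in> I" for i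
  proof -
    have "\<phi> i (f (x i)) = \<phi> i (\<Oplus>\<^bsub>M\<^esub>j\<in>J. \<psi> j (f (x i)) \<odot>\<^bsub>M\<^esub> y j)"
      using yD(5) fc xD(2) i by simp
    also have "\<dots> = (\<Oplus>\<^bsub>R\<^esub>j\<in>J. \<phi> i (\<psi> j (f (x i)) \<odot>\<^bsub>M\<^esub> y j))"
      using i xD yD fc by (intro linear_form_finsum) auto
    also have "\<dots> = (\<Oplus>\<^bsub>R\<^esub>j\<in>J. \<phi> i (y j) \<otimes>\<^bsub>R\<^esub> \<psi> j (f (x i)))"
      using i xD(2,4) yD(2,4) fc
      by (intro R.finsum_cong') (auto simp: linear_formsD(3)[OF xD(3)] m_comm)
    finally show ?thesis .
  qed
  moreover have "\<psi> j (f (y j)) = (\<Oplus>\<^bsub>R\<^esub>i\<in>I. \<phi> i (y j) \<otimes>\<^bsub>R\<^esub> \<psi> j (f (x i)))" if j: "j \<in> J" for j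
  proof -
    have "f (y j) = f (\<Oplus>\<^bsub>M\<^esub>i\<in>I. \<phi> i (y j) \<odot>\<^bsub>M\<^esub> x i)"
      using xD(5) yD(2) j by simp
    also have "\<dots> = (\<Oplus>\<^bsub>M\<^esub>i\<in>I. f (\<phi> i (y j) \<odot>\<^bsub>M\<^esub> x i))"
      using j xD yD by (intro module_hom_finsum[OF module_axioms module_axioms f]) auto
    also have "\<dots> = (\<Oplus>\<^bsub>M\<^esub>i\<in>I. \<phi> i (y j) \<odot>\<^bsub>M\<^esub> f (x i))"
      using j xD yD fc by (intro M.finsum_cong') (auto simp: LinearCombinations.module_hom_smult[OF f])
    finally have "\<psi> j (f (y j)) = \<psi> j (\<Oplus>\<^bsub>M\<^esub>i\<in>I. \<phi> i (y j) \<odot>\<^bsub>M\<^esub> f (x i))" by simp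
    also have "\<dots> = (\<Oplus>\<^bsub>R\<^esub>i\<in>I. \<psi> j (\<phi> i (y j) \<odot>\<^bsub>M\<^esub> f (x i)))"
      using j xD yD fc by (intro linear_form_finsum) auto
    also have "\<dots> = (\<Oplus>\<^bsub>R\<^esub>i\<in>I. \<phi> i (y j) \<otimes>\<^bsub>R\<^esub> \<psi> j (f (x i)))"
      using j xD(2,4) yD(2,4) fc
      by (intro R.finsum_cong') (auto simp: linear_formsD(3)[OF yD(3)])
    finally show ?thesis .
  qed
  moreover have "(\<Oplus>\<^bsub>R\<^esub>i\<in>I. \<Oplus>\<^bsub>R\<^esub>j\<in>J. \<phi> i (y j) \<otimes>\<^bsub>R\<^esub> \<psi> j (f (x i)))
      = (\<Oplus>\<^bsub>R\<^esub>j\<in>J. \<Oplus>\<^bsub>R\<^esub>i\<in>I. \<phi> i (y j) \<otimes>\<^bsub>R\<^esub> \<psi> j (f (x i)))"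
    using xD yD fc by (intro R.finsum_finsum_swap) auto
  ultimately show ?thesis
    using xD yD fc by (simp cong: R.finsum_cong)
qed

section \<open>Traces on modules with a finite basis\<close>

lemma (in Module.module) coords_works:
  assumes B: "finite_basis R M B" and m: "m \<in> carrier M"
  shows "coords R M B m \<in> B \<rightarrow>\<^sub>E carrier R" "lincomb (coords R M B m) B = m"
    and "\<And>c. \<lbrakk>c \<in> B \<rightarrow>\<^sub>E carrier R; lincomb c B = m\<rbrakk> \<Longrightarrow> coords R M B m = c"
proof -
  have fin: "finite B" and BM: "B \<subseteq> carrier M" and li: "lin_indpt B" and sp: "span B = carrier M"
    using B by (auto simp: finite_basis_def)
  obtain c where c: "c \<in> B \<rightarrow> carrier R" "lincomb c B = m"
    using m finite_span[OF fin BM] sp by auto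
  \<comment> \<open>\<open>coords\<close> ranges over functions that are \<open>undefined\<close>
    off the basis. Restricting \<open>c\<close> brings it into this range, where coefficients are
    unique as functions on the whole type.\<close>
  have ex: "restrict c B \<in> B \<rightarrow>\<^sub>E carrier R \<and> lincomb (restrict c B) B = m"
    using c BM lincomb_cong[of B B "restrict c B" c] by auto
  have un: "c' = c''" if "c' \<in> B \<rightarrow>\<^sub>E carrier R \<and> lincomb c' B = m"
    "c'' \<in> B \<rightarrow>\<^sub>E carrier R \<and> lincomb c'' B = m" for c' c''
  proof
    fix b
    show "c' b = c'' b"
    proof (cases "b \<in> B")
      case True
      have "lincomb (\<lambda>v. c' v \<ominus>\<^bsub>R\<^esub> c'' v) B = lincomb c' B \<ominus>\<^bsub>M\<^esub> lincomb c'' B"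
        using that by (intro lincomb_diff fin BM) auto
      then have 0: "lincomb (\<lambda>v. c' v \<ominus>\<^bsub>R\<^esub> c'' v) B = \<zero>\<^bsub>M\<^esub>"
        using that m by (simp add: M.r_neg a_minus_def)
      have "c' b \<ominus>\<^bsub>R\<^esub> c'' b = \<zero>\<^bsub>R\<^esub>"
      proof (rule ccontr)
        assume "c' b \<ominus>\<^bsub>R\<^esub> c'' b \<noteq> \<zero>\<^bsub>R\<^esub>"
        then have "lin_dep B"
          using that by (intro lin_dep_crit[OF fin subset_refl _ True _ 0]) (auto simp: PiE_iff)
        with li show False by simp
      qed
      then show ?thesis using that True by (auto simp: PiE_iff)
    qed (use that in \<open>auto simp: PiE_iff extensional_def\<close>)
  qed
  have "coords R M B m \<in> B \<rightarrow>\<^sub>E carrier R \<and> lincomb (coords R M B m) B = m"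
    unfolding coords_def by (rule theI[of "\<lambda>c. c \<in> B \<rightarrow>\<^sub>E carrier R \<and> lincomb c B = m", OF ex]) (use un ex in blast)
  then show "coords R M B m \<in> B \<rightarrow>\<^sub>E carrier R" "lincomb (coords R M B m) B = m"
    and "\<And>c. \<lbrakk>c \<in> B \<rightarrow>\<^sub>E carrier R; lincomb c B = m\<rbrakk> \<Longrightarrow> coords R M B m = c"
    using un by auto
qed

text \<open>Linearity of the coordinates comes from their uniqueness: the pointwise sum or multiple
  of coordinate functions, restricted to \<open>B\<close>, represents the sum or multiple of the
  vectors.\<close>

lemma (in Module.module) finite_basis_dual_basis:
  assumes B: "finite_basis R M B"
  shows "dual_basis R M B (\<lambda>b. b) (\<lambda>b m. coords R M B m b)"
proof -
  have fin: "finite B" and BM: "B \<subseteq> carrier M"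
    using B by (auto simp: finite_basis_def)
  have mem: "coords R M B m b \<in> carrier R" if "m \<in> carrier M" "b \<in> B" for m b
    using coords_works(1)[OF B that(1)] that(2) by auto
  have add: "coords R M B (m \<oplus>\<^bsub>M\<^esub> m') b = coords R M B m b \<oplus>\<^bsub>R\<^esub> coords R M B m' b"
    if "m \<in> carrier M" "m' \<in> carrier M" "b \<in> B" for m m' b
  proof -
    let ?c = "\<lambda>v. coords R M B m v \<oplus>\<^bsub>R\<^esub> coords R M B m' v"
    have "lincomb (restrict ?c B) B = lincomb ?c B"
      using BM mem that by (intro lincomb_cong) auto
    also have "\<dots> = m \<oplus>\<^bsub>M\<^esub> m'"
      using that mem by (subst lincomb_sum) (auto simp: fin BM coords_works[OF B])
    finally have "coords R M B (m \<oplus>\<^bsub>M\<^esub> m') = restrict ?c B"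
      using that mem by (intro coords_works(3)[OF B]) auto
    then show ?thesis using that by simp
  qed
  have smult: "coords R M B (a \<odot>\<^bsub>M\<^esub> m) b = a \<otimes>\<^bsub>R\<^esub> coords R M B m b"
    if "a \<in> carrier R" "m \<in> carrier M" "b \<in> B" for a m b
  proof -
    let ?c = "\<lambda>v. a \<otimes>\<^bsub>R\<^esub> coords R M B m v"
    have "lincomb (restrict ?c B) B = lincomb ?c B"
      using BM mem that by (intro lincomb_cong) auto
    also have "\<dots> = a \<odot>\<^bsub>M\<^esub> m"
      using that mem by (subst lincomb_smult) (auto simp: fin BM coords_works[OF B])
    finally have "coords R M B (a \<odot>\<^bsub>M\<^esub> m) = restrict ?c B"
      using that mem by (intro coords_works(3)[OF B]) auto
    then show ?thesis using that by simp
  qed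
  show ?thesis
    using fin BM mem add smult coords_works(2)[OF B]
    by (auto simp: dual_basis_def linear_forms_def lincomb_def)
qed

text \<open>The basis \<open>B\<close> is the witness that the definite description needs. The value
  may then be read off any dual basis, even one with more members than the rank.\<close>

lemma (in Module.module) free_trace_eq:
  assumes "finite_basis R M B" and x: "dual_basis R M I x \<phi>" and f: "f \<in> LinearCombinations.module_hom R M M"
  shows "free_trace R M f = (\<Oplus>\<^bsub>R\<^esub>i\<in>I. \<phi> i (f (x i)))"
  unfolding free_trace_def
proof (rule the_equality)
  show "\<exists>B. finite_basis R M B \<and>
          (\<Oplus>\<^bsub>R\<^esub>i\<in>I. \<phi> i (f (x i))) = (\<Oplus>\<^bsub>R\<^esub>b\<in>B. coords R M B (f b) b)"
    using assms(1) dual_basis_trace_unique[OF x finite_basis_dual_basis f] by blast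
next
  fix t assume "\<exists>B. finite_basis R M B \<and> t = (\<Oplus>\<^bsub>R\<^esub>b\<in>B. coords R M B (f b) b)"
  then show "t = (\<Oplus>\<^bsub>R\<^esub>i\<in>I. \<phi> i (f (x i)))"
    using dual_basis_trace_unique[OF x finite_basis_dual_basis f] by auto
qed

lemma direct_sum_sel [simp]:
  "carrier (direct_sum M N) = carrier M \<times> carrier N"
  "\<zero>\<^bsub>direct_sum M N\<^esub> = (\<zero>\<^bsub>M\<^esub>, \<zero>\<^bsub>N\<^esub>)"
  "p \<oplus>\<^bsub>direct_sum M N\<^esub> q = (fst p \<oplus>\<^bsub>M\<^esub> fst q, snd p \<oplus>\<^bsub>N\<^esub> snd q)"
  "a \<odot>\<^bsub>direct_sum M N\<^esub> p = (a \<odot>\<^bsub>M\<^esub> fst p, a \<odot>\<^bsub>N\<^esub> snd p)"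
  by (simp_all add: direct_sum_def)

lemma direct_sum_finsum:
  assumes "module R M" "module R N" and p: "p \<in> I \<rightarrow> carrier M \<times> carrier N"
  shows "(\<Oplus>\<^bsub>direct_sum M N\<^esub>i\<in>I. p i) = (\<Oplus>\<^bsub>M\<^esub>i\<in>I. fst (p i), \<Oplus>\<^bsub>N\<^esub>i\<in>I. snd (p i))"
proof -
  interpret M: Module.module R M by fact
  interpret N: Module.module R N by fact
  interpret D: Module.module R "direct_sum M N" by (rule direct_sum_is_module[OF assms(1,2)])
  show ?thesis using p
  proof (induction I rule: infinite_finite_induct)
    case (insert i I)
    then have "fst (p i) \<in> carrier M" "snd (p i) \<in> carrier N"
      "(\<lambda>i. fst (p i)) \<in> I \<rightarrow> carrier M" "(\<lambda>i. snd (p i)) \<in> I \<rightarrow> carrier N"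
      "p i \<in> carrier (direct_sum M N)" "p \<in> I \<rightarrow> carrier (direct_sum M N)"
      by (auto simp: Pi_iff mem_Times_iff)
    then show ?case using insert by simp
  qed simp_all
qed

text \<open>A direct summand inherits the projected vectors and the forms restricted along m
  \<mapsto> (m, 0). With these the diagonal terms of f are those of f \<oplus> 0 in the large
  module, so the two traces agree term by term.\<close>

lemma dual_basis_fst_direct_sum:
  assumes M: "module R M" and N: "module R N" and x: "dual_basis R (direct_sum M N) I x \<phi>"
  shows "dual_basis R M I (\<lambda>i. fst (x i)) (\<lambda>i m. \<phi> i (m, \<zero>\<^bsub>N\<^esub>))"
proof -
  interpret M: Module.module R M by fact
  interpret N: Module.module R N by fact
  note xD = dual_basisD[OF x]
  have lf: "(\<lambda>m. \<phi> i (m, \<zero>\<^bsub>N\<^esub>)) \<in> linear_forms R M" if "i \<in> I" for i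
    using linear_formsD(1)[OF xD(3)[OF that]]
      linear_formsD(2)[OF xD(3)[OF that], of "(m, \<zero>\<^bsub>N\<^esub>)" "(m', \<zero>\<^bsub>N\<^esub>)" for m m']
      linear_formsD(3)[OF xD(3)[OF that], of _ "(m, \<zero>\<^bsub>N\<^esub>)" for m]
    by (auto simp: linear_forms_def)
  have "(\<Oplus>\<^bsub>M\<^esub>i\<in>I. \<phi> i (m, \<zero>\<^bsub>N\<^esub>) \<odot>\<^bsub>M\<^esub> fst (x i)) = m" if m: "m \<in> carrier M" for m
  proof -
    have "(\<Oplus>\<^bsub>direct_sum M N\<^esub>i\<in>I. \<phi> i (m, \<zero>\<^bsub>N\<^esub>) \<odot>\<^bsub>direct_sum M N\<^esub> x i) = (m, \<zero>\<^bsub>N\<^esub>)"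
      using m by (intro xD(5)) simp
    moreover have "fst (\<Oplus>\<^bsub>direct_sum M N\<^esub>i\<in>I. \<phi> i (m, \<zero>\<^bsub>N\<^esub>) \<odot>\<^bsub>direct_sum M N\<^esub> x i)
      = (\<Oplus>\<^bsub>M\<^esub>i\<in>I. \<phi> i (m, \<zero>\<^bsub>N\<^esub>) \<odot>\<^bsub>M\<^esub> fst (x i))"
      using m xD(2,4) by (subst direct_sum_finsum[OF M N]) (auto simp: mem_Times_iff)
    ultimately show ?thesis by simp
  qed
  then show ?thesis using xD(1,2) lf by (auto simp: dual_basis_def mem_Times_iff)
qed

text \<open>Applying \<open>\<phi> i\<close> to a vanishing combination isolates its i-th
  coefficient, which gives independence; the expansion formula gives spanning. Since 1 and 0 differ,
  \<open>x\<close> is injective and the image has one vector for each index.\<close>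

lemma (in Module.module) finite_basis_of_dual_basis:
  assumes nt: "\<one>\<^bsub>R\<^esub> \<noteq> \<zero>\<^bsub>R\<^esub>" and x: "dual_basis R M I x \<phi>"
    and \<delta>: "\<And>i j. \<lbrakk>i \<in> I; j \<in> I\<rbrakk> \<Longrightarrow> \<phi> i (x j) = (if i = j then \<one>\<^bsub>R\<^esub> else \<zero>\<^bsub>R\<^esub>)"
  shows "finite_basis R M (x ` I)"
proof -
  note xD = dual_basisD[OF x]
  have inj: "inj_on x I"
    using \<delta> nt by (intro inj_onI) metis
  have sum: "lincomb a (x ` I) = (\<Oplus>\<^bsub>M\<^esub>i\<in>I. a (x i) \<odot>\<^bsub>M\<^esub> x i)" if "a \<in> x ` I \<rightarrow> carrier R" for a
    unfolding lincomb_def using that xD(2) by (intro M.finsum_reindex inj) auto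
  have XM: "x ` I \<subseteq> carrier M" using xD(2) by auto
  have "lin_indpt (x ` I)"
  proof (rule finite_lin_indpt2)
    fix a assume a: "a \<in> x ` I \<rightarrow> carrier R" and 0: "lincomb a (x ` I) = \<zero>\<^bsub>M\<^esub>"
    have aR: "a (x i) \<in> carrier R" if "i \<in> I" for i using a that by auto
    have "a (x i) = \<zero>\<^bsub>R\<^esub>" if i: "i \<in> I" for i
    proof -
      have "\<phi> i (lincomb a (x ` I)) = (\<Oplus>\<^bsub>R\<^esub>j\<in>I. \<phi> i (a (x j) \<odot>\<^bsub>M\<^esub> x j))"
        unfolding sum[OF a] using a xD i by (intro linear_form_finsum) auto
      also have "\<dots> = (\<Oplus>\<^bsub>R\<^esub>j\<in>I. if i = j then a (x j) else \<zero>\<^bsub>R\<^esub>)"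
        using aR xD(2) i by (intro R.finsum_cong') (auto simp: linear_formsD(3)[OF xD(3)[OF i]] \<delta>)
      also have "\<dots> = a (x i)"
        using a xD(1) i by (intro R.finsum_singleton) auto
      finally have "a (x i) = \<phi> i \<zero>\<^bsub>M\<^esub>" unfolding 0 by simp
      also have "\<phi> i \<zero>\<^bsub>M\<^esub> = \<zero>\<^bsub>R\<^esub>"
        using linear_form_finsum[OF xD(3)[OF i], of "\<lambda>_. \<zero>\<^bsub>M\<^esub>" "{}"] by simp
      finally show ?thesis .
    qed
    then show "\<forall>v\<in>x ` I. a v = \<zero>\<^bsub>R\<^esub>" by auto
  qed (use xD(1) XM in auto)
  moreover have "m \<in> span (x ` I)" if m: "m \<in> carrier M" for m
  proof -
    \<comment> \<open>\<open>lincomb\<close> takes coefficients indexed by vectors, so the index is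
      recovered from the vector by inverting \<open>x\<close>.\<close>
    let ?a = "\<lambda>v. \<phi> (the_inv_into I x v) m"
    have a: "?a \<in> x ` I \<rightarrow> carrier R"
      using m xD(4) by (auto simp: the_inv_into_f_f[OF inj])
    have "lincomb ?a (x ` I) = (\<Oplus>\<^bsub>M\<^esub>i\<in>I. \<phi> i m \<odot>\<^bsub>M\<^esub> x i)"
      unfolding sum[OF a] using m xD(2,4)
      by (intro M.finsum_cong') (auto simp: the_inv_into_f_f[OF inj])
    then have "m = lincomb ?a (x ` I)" using xD(5)[OF m] by simp
    with a show ?thesis using xD(1) XM by (auto simp: finite_span)
  qed
  moreover have "span (x ` I) \<subseteq> carrier M"
    using XM by (rule span_is_subset2)
  ultimately show ?thesis using xD(1) XM by (auto simp: finite_basis_def)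
qed

text \<open>Used to trade the index set for an initial segment of the natural numbers, since the
  complements allowed in \<open>hs_trace\<close> consist of functions on \<open>nat\<close>.\<close>

lemma (in Module.module) dual_basis_reindex:
  assumes x: "dual_basis R M I x \<phi>" and h: "bij_betw h J I"
  shows "dual_basis R M J (\<lambda>j. x (h j)) (\<lambda>j. \<phi> (h j))"
proof -
  note xD = dual_basisD[OF x]
  have inj: "inj_on h J" and img: "h ` J = I" using h by (auto simp: bij_betw_def)
  have "(\<Oplus>\<^bsub>M\<^esub>j\<in>J. \<phi> (h j) m \<odot>\<^bsub>M\<^esub> x (h j)) = m" if m: "m \<in> carrier M" for m
    using M.finsum_reindex[OF _ inj, of "\<lambda>i. \<phi> i m \<odot>\<^bsub>M\<^esub> x i"] xD m img by auto
  then show ?thesis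
    using bij_betw_finite[OF h] xD(1,2,3) img by (auto simp: dual_basis_def)
qed

section \<open>Free modules and complements of projective modules\<close>

lemma free_module_sel [simp]:
  "\<zero>\<^bsub>free_module R S\<^esub> = (\<lambda>x. \<zero>\<^bsub>R\<^esub>)"
  "f \<oplus>\<^bsub>free_module R S\<^esub> g = (\<lambda>x. f x \<oplus>\<^bsub>R\<^esub> g x)"
  "a \<odot>\<^bsub>free_module R S\<^esub> f = (\<lambda>x. a \<otimes>\<^bsub>R\<^esub> f x)"
  by (simp_all add: free_module_def)

lemma free_module_carrier_iff:
  "f \<in> carrier (free_module R S) \<longleftrightarrow>
     (\<forall>x. f x \<in> carrier R) \<and> (\<forall>x. x \<notin> S \<longrightarrow> f x = \<zero>\<^bsub>R\<^esub>) \<and> finite {x. f x \<noteq> \<zero>\<^bsub>R\<^esub>}"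
  by (auto simp: free_module_def)

lemma (in cring) module_free_module: "module R (free_module R S)"
proof (rule module_criteria)
  let ?F = "free_module R S"
  show "\<forall>v w. v \<in> carrier ?F \<and> w \<in> carrier ?F \<longrightarrow> v \<oplus>\<^bsub>?F\<^esub> w \<in> carrier ?F"
  proof (intro allI impI)
    fix v w assume vw: "v \<in> carrier ?F \<and> w \<in> carrier ?F"
    then have "{x. v x \<oplus> w x \<noteq> \<zero>} \<subseteq> {x. v x \<noteq> \<zero>} \<union> {x. w x \<noteq> \<zero>}"
      by (auto simp: free_module_carrier_iff)
    with vw show "v \<oplus>\<^bsub>?F\<^esub> w \<in> carrier ?F"
      by (auto simp: free_module_carrier_iff intro: finite_subset)
  qed
  show "\<forall>v\<in>carrier ?F. \<exists>w\<in>carrier ?F. v \<oplus>\<^bsub>?F\<^esub> w = \<zero>\<^bsub>?F\<^esub>"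
  proof
    fix v assume v: "v \<in> carrier ?F"
    have "{x. \<ominus> v x \<noteq> \<zero>} \<subseteq> {x. v x \<noteq> \<zero>}" using v by auto
    with v have "(\<lambda>x. \<ominus> v x) \<in> carrier ?F"
      by (auto simp: free_module_carrier_iff intro: finite_subset)
    moreover have "v \<oplus>\<^bsub>?F\<^esub> (\<lambda>x. \<ominus> v x) = \<zero>\<^bsub>?F\<^esub>"
      using v by (auto simp: free_module_carrier_iff r_neg)
    ultimately show "\<exists>w\<in>carrier ?F. v \<oplus>\<^bsub>?F\<^esub> w = \<zero>\<^bsub>?F\<^esub>" by blast
  qed
  show "\<forall>c v. c \<in> carrier R \<and> v \<in> carrier ?F \<longrightarrow> c \<odot>\<^bsub>?F\<^esub> v \<in> carrier ?F"
  proof (intro allI impI)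
    fix c v assume cv: "c \<in> carrier R \<and> v \<in> carrier ?F"
    then have "{x. c \<otimes> v x \<noteq> \<zero>} \<subseteq> {x. v x \<noteq> \<zero>}" by auto
    with cv show "c \<odot>\<^bsub>?F\<^esub> v \<in> carrier ?F"
      by (auto simp: free_module_carrier_iff intro: finite_subset)
  qed
  show "\<forall>a b v. a \<in> carrier R \<and> b \<in> carrier R \<and> v \<in> carrier ?F \<longrightarrow>
      (a \<otimes> b) \<odot>\<^bsub>?F\<^esub> v = a \<odot>\<^bsub>?F\<^esub> (b \<odot>\<^bsub>?F\<^esub> v)"
    by (simp add: free_module_carrier_iff m_assoc)
  show "\<forall>a b v. a \<in> carrier R \<and> b \<in> carrier R \<and> v \<in> carrier ?F \<longrightarrow>
      (a \<oplus> b) \<odot>\<^bsub>?F\<^esub> v = a \<odot>\<^bsub>?F\<^esub> v \<oplus>\<^bsub>?F\<^esub> b \<odot>\<^bsub>?F\<^esub> v"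
    by (simp add: free_module_carrier_iff l_distr)
  show "\<forall>a v w. a \<in> carrier R \<and> v \<in> carrier ?F \<and> w \<in> carrier ?F \<longrightarrow>
      a \<odot>\<^bsub>?F\<^esub> (v \<oplus>\<^bsub>?F\<^esub> w) = a \<odot>\<^bsub>?F\<^esub> v \<oplus>\<^bsub>?F\<^esub> a \<odot>\<^bsub>?F\<^esub> w"
    by (simp add: free_module_carrier_iff r_distr)
  show "\<forall>u v w. u \<in> carrier ?F \<and> v \<in> carrier ?F \<and> w \<in> carrier ?F \<longrightarrow>
      u \<oplus>\<^bsub>?F\<^esub> v \<oplus>\<^bsub>?F\<^esub> w = u \<oplus>\<^bsub>?F\<^esub> (v \<oplus>\<^bsub>?F\<^esub> w)"
    by (simp add: free_module_carrier_iff a_assoc)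
  show "\<forall>v w. v \<in> carrier ?F \<and> w \<in> carrier ?F \<longrightarrow> v \<oplus>\<^bsub>?F\<^esub> w = w \<oplus>\<^bsub>?F\<^esub> v"
    by (auto simp: free_module_carrier_iff intro!: ext a_comm)
qed (simp_all add: free_module_carrier_iff cring_axioms)

lemma (in cring) free_module_finsum_apply:
  assumes "f \<in> I \<rightarrow> carrier (free_module R S)"
  shows "(\<Oplus>\<^bsub>free_module R S\<^esub>i\<in>I. f i) j = (\<Oplus>\<^bsub>R\<^esub>i\<in>I. f i j)"
proof -
  interpret F: Module.module R "free_module R S" by (rule module_free_module)
  have "(\<lambda>f. f j) \<in> linear_forms R (free_module R S)"
    by (auto simp: linear_forms_def free_module_carrier_iff)
  then show ?thesis using assms by (rule F.linear_form_finsum)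
qed

text \<open>The map \<open>T\<close> from R^n to M that sends unit vectors to the y_i is split by m
  \<mapsto> (\<psi>_i(m)), so R^n is the direct sum of M and the kernel of \<open>T\<close>. The
  kernel consists of functions on \<open>nat\<close>, as \<open>hs_trace\<close> demands of a
  complement; this provides the witness for that definite description.\<close>

lemma (in Module.module) exists_free_complement:
  assumes nt: "\<one>\<^bsub>R\<^esub> \<noteq> \<zero>\<^bsub>R\<^esub>" and "dual_basis R M I x \<phi>"
  shows "\<exists>N :: ('a, nat \<Rightarrow> 'a) module. module R N \<and> (\<exists>B. finite_basis R (direct_sum M N) B)"
proof -
  obtain h where h: "bij_betw h {..<card I} I"
    using ex_bij_betw_nat_finite[OF dual_basisD(1)[OF assms(2)]] by (auto simp: atLeast0LessThan)
  define n where "n = card I"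
  define y where "y = (\<lambda>j. x (h j))"
  define \<psi> where "\<psi> = (\<lambda>j. \<phi> (h j))"
  have y: "dual_basis R M {..<n} y \<psi>"
    unfolding y_def \<psi>_def n_def by (rule dual_basis_reindex[OF assms(2) h])
  note yD = dual_basisD[OF y]
  define F where "F = free_module R {..<n}"
  interpret F: Module.module R F unfolding F_def by (rule module_free_module)
  have Fc: "f \<in> carrier F \<longleftrightarrow> (\<forall>i. f i \<in> carrier R) \<and> (\<forall>i. i \<ge> n \<longrightarrow> f i = \<zero>\<^bsub>R\<^esub>)" for f
  proof -
    have "{i. f i \<noteq> \<zero>\<^bsub>R\<^esub>} \<subseteq> {..<n}" if "\<forall>i. i \<ge> n \<longrightarrow> f i = \<zero>\<^bsub>R\<^esub>"
      using that by (force simp: not_le[symmetric])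
    then show ?thesis
      by (auto simp: F_def free_module_carrier_iff not_less intro: finite_subset)
  qed
  define T where "T = (\<lambda>f. \<Oplus>\<^bsub>M\<^esub>i\<in>{..<n}. f i \<odot>\<^bsub>M\<^esub> y i)"
  have T: "mod_hom R F M T"
  proof -
    have "T \<in> LinearCombinations.module_hom R F M"
      unfolding LinearCombinations.module_hom_def
    proof (intro CollectI conjI allI impI)
      show "T \<in> carrier F \<rightarrow> carrier M"
        using yD(2) by (auto simp: T_def Fc intro!: M.finsum_closed)
      fix f g assume "f \<in> carrier F \<and> g \<in> carrier F"
      then have fg: "\<forall>i. f i \<in> carrier R" "\<forall>i. g i \<in> carrier R" by (auto simp: Fc)
      have "T (f \<oplus>\<^bsub>F\<^esub> g) = (\<Oplus>\<^bsub>M\<^esub>i\<in>{..<n}. f i \<odot>\<^bsub>M\<^esub> y i \<oplus>\<^bsub>M\<^esub> g i \<odot>\<^bsub>M\<^esub> y i)"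
        unfolding T_def F_def using fg yD(2)
        by (intro M.finsum_cong') (auto simp: smult_l_distr)
      also have "\<dots> = T f \<oplus>\<^bsub>M\<^esub> T g"
        unfolding T_def using fg yD(2) by (intro M.finsum_addf) auto
      finally show "T (f \<oplus>\<^bsub>F\<^esub> g) = T f \<oplus>\<^bsub>M\<^esub> T g" .
    next
      fix a f assume "a \<in> carrier R \<and> f \<in> carrier F"
      then have af: "a \<in> carrier R" "\<forall>i. f i \<in> carrier R" by (auto simp: Fc)
      have "T (a \<odot>\<^bsub>F\<^esub> f) = (\<Oplus>\<^bsub>M\<^esub>i\<in>{..<n}. a \<odot>\<^bsub>M\<^esub> (f i \<odot>\<^bsub>M\<^esub> y i))"
        unfolding T_def F_def using af yD(2)
        by (intro M.finsum_cong') (auto simp: smult_assoc1)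
      also have "\<dots> = a \<odot>\<^bsub>M\<^esub> T f"
        unfolding T_def using af yD(2) by (intro finsum_smult[symmetric]) auto
      finally show "T (a \<odot>\<^bsub>F\<^esub> f) = a \<odot>\<^bsub>M\<^esub> T f" .
    qed
    then show ?thesis
      using F.module_axioms module_axioms by (simp add: mod_hom_def mod_hom_axioms_def)
  qed
  define N where "N = F\<lparr>carrier := mod_hom.ker F M T\<rparr>"
  have N: "module R N"
    unfolding N_def by (rule F.submodule_is_module[OF mod_hom.ker_is_submodule[OF T]])
  interpret N: Module.module R N by (rule N)
  interpret D: Module.module R "direct_sum M N" by (rule direct_sum_is_module[OF module_axioms N])
  have Nc: "k \<in> carrier N \<longleftrightarrow> k \<in> carrier F \<and> T k = \<zero>\<^bsub>M\<^esub>" for k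
    by (simp add: N_def mod_hom.ker_def[OF T])
  have Nops: "\<zero>\<^bsub>N\<^esub> = (\<lambda>i. \<zero>\<^bsub>R\<^esub>)" "f \<oplus>\<^bsub>N\<^esub> g = (\<lambda>i. f i \<oplus>\<^bsub>R\<^esub> g i)" "a \<odot>\<^bsub>N\<^esub> f = (\<lambda>i. a \<otimes>\<^bsub>R\<^esub> f i)"
    for f g a by (simp_all add: N_def F_def)
  have Nsum: "(\<Oplus>\<^bsub>N\<^esub>i\<in>A. f i) j = (\<Oplus>\<^bsub>R\<^esub>i\<in>A. f i j)" if "f \<in> A \<rightarrow> carrier N" for f :: "nat \<Rightarrow> _" and A j
  proof (rule N.linear_form_finsum[OF _ that])
    show "(\<lambda>k. k j) \<in> linear_forms R N"
      by (auto simp: linear_forms_def Nc Fc Nops)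
  qed
  \<comment> \<open>The isomorphism \<open>(m, k) \<mapsto> (\<psi>\<^sub>i m)\<^sub>i + k\<close> from \<open>M \<oplus> N\<close> onto \<open>R\<^sup>n\<close> sends \<open>(y\<^sub>i, k\<^sub>i)\<close> to the
    \<open>i\<close>-th unit vector.\<close>
  define k where "k = (\<lambda>i j. if j < n then single R i j \<ominus>\<^bsub>R\<^esub> \<psi> j (y i) else \<zero>\<^bsub>R\<^esub>)"
  have k: "k i \<in> carrier N" if "i < n" for i
  proof -
    \<comment> \<open>The i-th unit vector and the vector of all \<open>\<psi> j (y i)\<close> are
      both mapped to \<open>y i\<close> by \<open>T\<close>, so their difference \<open>k i\<close>
      lies in the kernel.\<close>
    have "T (k i) = (\<Oplus>\<^bsub>M\<^esub>j\<in>{..<n}. (if i = j then y j else \<zero>\<^bsub>M\<^esub>) \<oplus>\<^bsub>M\<^esub> \<ominus>\<^bsub>M\<^esub> (\<psi> j (y i) \<odot>\<^bsub>M\<^esub> y j))"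
      unfolding T_def using that yD(2,4)
      by (intro M.finsum_cong')
        (auto simp: k_def single_def smult_l_distr a_minus_def smult_l_minus)
    also have "\<dots> = (\<Oplus>\<^bsub>M\<^esub>j\<in>{..<n}. (if i = j then y j else \<zero>\<^bsub>M\<^esub>))
        \<oplus>\<^bsub>M\<^esub> (\<Oplus>\<^bsub>M\<^esub>j\<in>{..<n}. \<ominus>\<^bsub>M\<^esub> (\<psi> j (y i) \<odot>\<^bsub>M\<^esub> y j))"
      using that yD(2,4) by (intro M.finsum_addf) auto
    also have "(\<Oplus>\<^bsub>M\<^esub>j\<in>{..<n}. (if i = j then y j else \<zero>\<^bsub>M\<^esub>)) = y i"
      using that yD(2) by (intro M.finsum_singleton) auto
    also have "(\<Oplus>\<^bsub>M\<^esub>j\<in>{..<n}. \<ominus>\<^bsub>M\<^esub> (\<psi> j (y i) \<odot>\<^bsub>M\<^esub> y j))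
        = (\<Oplus>\<^bsub>M\<^esub>j\<in>{..<n}. (\<ominus>\<^bsub>R\<^esub> \<one>\<^bsub>R\<^esub>) \<odot>\<^bsub>M\<^esub> (\<psi> j (y i) \<odot>\<^bsub>M\<^esub> y j))"
      using that yD(2,4) by (intro M.finsum_cong') (auto simp: smult_minus_1)
    also have "\<dots> = \<ominus>\<^bsub>M\<^esub> y i"
      using that yD(2,4) yD(5)[of "y i"]
      by (subst finsum_smult[symmetric]) (auto simp: smult_minus_1)
    finally show ?thesis
      using that yD(2,4) by (auto simp: Nc Fc k_def single_def M.r_neg)
  qed
  define \<theta> where "\<theta> = (\<lambda>i p. \<psi> i (fst p) \<oplus>\<^bsub>R\<^esub> snd p i)"
  have NR: "k' i \<in> carrier R" if "k' \<in> carrier N" for k' i using that by (auto simp: Nc Fc)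
  have "dual_basis R (direct_sum M N) {..<n} (\<lambda>i. (y i, k i)) \<theta>"
    unfolding dual_basis_def
  proof (intro conjI ballI funcsetI)
    fix i assume "i \<in> {..<n}"
    then have i: "i < n" by simp
    then show "(y i, k i) \<in> carrier (direct_sum M N)" using yD(2) k by simp
    have \<psi>i: "\<psi> i \<in> linear_forms R M" using yD(3) i by simp
    have "\<theta> i p \<in> carrier R" if "p \<in> carrier (direct_sum M N)" for p
      using that linear_formsD(1)[OF \<psi>i] NR by (auto simp: \<theta>_def)
    moreover have "\<theta> i (p \<oplus>\<^bsub>direct_sum M N\<^esub> q) = \<theta> i p \<oplus>\<^bsub>R\<^esub> \<theta> i q"
      if "p \<in> carrier (direct_sum M N)" "q \<in> carrier (direct_sum M N)" for p q
      using that linear_formsD(1,2)[OF \<psi>i] NR by (auto simp: \<theta>_def Nops R.a_ac)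
    moreover have "\<theta> i (a \<odot>\<^bsub>direct_sum M N\<^esub> p) = a \<otimes>\<^bsub>R\<^esub> \<theta> i p"
      if "a \<in> carrier R" "p \<in> carrier (direct_sum M N)" for a p
      using that linear_formsD(1,3)[OF \<psi>i] NR by (auto simp: \<theta>_def Nops r_distr)
    ultimately show "\<theta> i \<in> linear_forms R (direct_sum M N)" by (auto simp: linear_forms_def)
  next
    fix p assume p: "p \<in> carrier (direct_sum M N)"
    obtain m l where ml: "p = (m, l)" by force
    have m: "m \<in> carrier M" and l: "l \<in> carrier N" using p ml by auto
    let ?c = "\<lambda>i. \<psi> i m \<oplus>\<^bsub>R\<^esub> l i"
    have c: "?c i \<in> carrier R" if "i < n" for i using that m NR[OF l] yD(4) by simp
    have 1: "(\<Oplus>\<^bsub>M\<^esub>i\<in>{..<n}. ?c i \<odot>\<^bsub>M\<^esub> y i) = m"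
    proof -
      have "(\<Oplus>\<^bsub>M\<^esub>i\<in>{..<n}. ?c i \<odot>\<^bsub>M\<^esub> y i) = (\<Oplus>\<^bsub>M\<^esub>i\<in>{..<n}. \<psi> i m \<odot>\<^bsub>M\<^esub> y i \<oplus>\<^bsub>M\<^esub> l i \<odot>\<^bsub>M\<^esub> y i)"
        using m NR[OF l] yD(2,4) by (intro M.finsum_cong') (auto simp: smult_l_distr)
      also have "\<dots> = (\<Oplus>\<^bsub>M\<^esub>i\<in>{..<n}. \<psi> i m \<odot>\<^bsub>M\<^esub> y i) \<oplus>\<^bsub>M\<^esub> T l"
        unfolding T_def using m NR[OF l] yD(2,4) by (intro M.finsum_addf) auto
      also have "\<dots> = m" using l m yD(5) by (simp add: Nc)
      finally show ?thesis .
    qed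
    \<comment> \<open>For j < n the sum is c_j - \<psi>_j(\<Sum> c_i y_i) = (\<psi>_j(m) + l_j) -
      \<psi>_j(m), by the first component just computed. From n on both sides are zero.\<close>
    have 2: "(\<Oplus>\<^bsub>R\<^esub>i\<in>{..<n}. ?c i \<otimes>\<^bsub>R\<^esub> k i j) = l j" for j
    proof (cases "j < n")
      case True
      have \<psi>j: "\<psi> j \<in> linear_forms R M" using yD(3) True by simp
      have "(\<Oplus>\<^bsub>R\<^esub>i\<in>{..<n}. ?c i \<otimes>\<^bsub>R\<^esub> k i j)
          = (\<Oplus>\<^bsub>R\<^esub>i\<in>{..<n}. (if j = i then ?c i else \<zero>\<^bsub>R\<^esub>) \<oplus>\<^bsub>R\<^esub> (\<ominus>\<^bsub>R\<^esub> \<one>\<^bsub>R\<^esub>) \<otimes>\<^bsub>R\<^esub> \<psi> j (?c i \<odot>\<^bsub>M\<^esub> y i))"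
        using True c linear_formsD(1,3)[OF \<psi>j] yD(2)
        by (intro R.finsum_cong')
          (auto simp: k_def single_def a_minus_def r_distr l_minus r_minus)
      also have "\<dots> = (\<Oplus>\<^bsub>R\<^esub>i\<in>{..<n}. (if j = i then ?c i else \<zero>\<^bsub>R\<^esub>))
          \<oplus>\<^bsub>R\<^esub> (\<Oplus>\<^bsub>R\<^esub>i\<in>{..<n}. (\<ominus>\<^bsub>R\<^esub> \<one>\<^bsub>R\<^esub>) \<otimes>\<^bsub>R\<^esub> \<psi> j (?c i \<odot>\<^bsub>M\<^esub> y i))"
        using True c linear_formsD(1)[OF \<psi>j] yD(2) by (intro R.finsum_addf) auto
      also have "(\<Oplus>\<^bsub>R\<^esub>i\<in>{..<n}. (if j = i then ?c i else \<zero>\<^bsub>R\<^esub>)) = ?c j"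
        using True c by (intro R.finsum_singleton) auto
      also have "(\<Oplus>\<^bsub>R\<^esub>i\<in>{..<n}. (\<ominus>\<^bsub>R\<^esub> \<one>\<^bsub>R\<^esub>) \<otimes>\<^bsub>R\<^esub> \<psi> j (?c i \<odot>\<^bsub>M\<^esub> y i))
          = (\<ominus>\<^bsub>R\<^esub> \<one>\<^bsub>R\<^esub>) \<otimes>\<^bsub>R\<^esub> (\<Oplus>\<^bsub>R\<^esub>i\<in>{..<n}. \<psi> j (?c i \<odot>\<^bsub>M\<^esub> y i))"
        using c linear_formsD(1)[OF \<psi>j] yD(2) by (intro R.finsum_rdistr[symmetric]) auto
      also have "(\<Oplus>\<^bsub>R\<^esub>i\<in>{..<n}. \<psi> j (?c i \<odot>\<^bsub>M\<^esub> y i)) = \<psi> j m"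
        using c yD(2) by (subst linear_form_finsum[OF \<psi>j, symmetric]) (auto simp: 1)
      also have "?c j \<oplus>\<^bsub>R\<^esub> (\<ominus>\<^bsub>R\<^esub> \<one>\<^bsub>R\<^esub>) \<otimes>\<^bsub>R\<^esub> \<psi> j m = l j"
        using linear_formsD(1)[OF \<psi>j m] NR[OF l] by (simp add: l_minus R.a_ac R.r_neg R.r_neg1 R.r_neg2)
      finally show ?thesis .
    next
      case False
      have "(\<Oplus>\<^bsub>R\<^esub>i\<in>{..<n}. ?c i \<otimes>\<^bsub>R\<^esub> k i j) = (\<Oplus>\<^bsub>R\<^esub>i\<in>{..<n}. \<zero>\<^bsub>R\<^esub>)"
        using False c by (intro R.finsum_cong') (auto simp: k_def)
      then show ?thesis using False l by (simp add: Nc Fc)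
    qed
    have "(\<Oplus>\<^bsub>direct_sum M N\<^esub>i\<in>{..<n}. \<theta> i p \<odot>\<^bsub>direct_sum M N\<^esub> (y i, k i))
        = (\<Oplus>\<^bsub>M\<^esub>i\<in>{..<n}. ?c i \<odot>\<^bsub>M\<^esub> y i, \<Oplus>\<^bsub>N\<^esub>i\<in>{..<n}. ?c i \<odot>\<^bsub>N\<^esub> k i)"
      using yD(2) k c by (subst direct_sum_finsum[OF module_axioms N]) (auto simp: \<theta>_def ml)
    also have "(\<Oplus>\<^bsub>N\<^esub>i\<in>{..<n}. ?c i \<odot>\<^bsub>N\<^esub> k i) = l"
    proof
      fix j
      have "(\<Oplus>\<^bsub>N\<^esub>i\<in>{..<n}. ?c i \<odot>\<^bsub>N\<^esub> k i) j = (\<Oplus>\<^bsub>R\<^esub>i\<in>{..<n}. (?c i \<odot>\<^bsub>N\<^esub> k i) j)"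
        using k c by (intro Nsum) auto
      then show "(\<Oplus>\<^bsub>N\<^esub>i\<in>{..<n}. ?c i \<odot>\<^bsub>N\<^esub> k i) j = l j" by (simp add: Nops 2)
    qed
    finally show "(\<Oplus>\<^bsub>direct_sum M N\<^esub>i\<in>{..<n}. \<theta> i p \<odot>\<^bsub>direct_sum M N\<^esub> (y i, k i)) = p"
      by (simp add: 1 ml)
  qed simp
  \<comment> \<open>The value \<open>\<psi> i (y j)\<close> of the first component cancels against
    the correction inside \<open>k j\<close>. This orthogonality turns the dual basis into an actual
    basis.\<close>
  moreover have "\<theta> i (y j, k j) = (if i = j then \<one>\<^bsub>R\<^esub> else \<zero>\<^bsub>R\<^esub>)" if "i < n" "j < n" for i j
    using that yD(2,4) by (auto simp: \<theta>_def k_def single_def a_minus_def R.a_ac R.r_neg R.r_neg2)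
  ultimately have "finite_basis R (direct_sum M N) ((\<lambda>i. (y i, k i)) ` {..<n})"
    by (intro D.finite_basis_of_dual_basis[OF nt]) auto
  then show ?thesis using N by blast
qed

text \<open>A basis of M \<oplus> N projects to a dual basis of M, so every admissible complement
  yields the trace computed from the given one. That some complement exists is
  \<open>exists_free_complement\<close>.\<close>

lemma (in Module.module) hs_trace_eq:
  assumes nt: "\<one>\<^bsub>R\<^esub> \<noteq> \<zero>\<^bsub>R\<^esub>" and x: "dual_basis R M I x \<phi>" and f: "f \<in> LinearCombinations.module_hom R M M"
  shows "hs_trace R M f = (\<Oplus>\<^bsub>R\<^esub>i\<in>I. \<phi> i (f (x i)))"
proof -
  have *: "free_trace R (direct_sum M N) (\<lambda>(m, n). (f m, \<zero>\<^bsub>N\<^esub>)) = (\<Oplus>\<^bsub>R\<^esub>i\<in>I. \<phi> i (f (x i)))"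
    if N: "module R N" and B: "finite_basis R (direct_sum M N) B" for N :: "('a, nat \<Rightarrow> 'a) module" and B
  proof -
    interpret N: Module.module R N by (rule N)
    interpret D: Module.module R "direct_sum M N" by (rule direct_sum_is_module[OF module_axioms N])
    note b = D.finite_basis_dual_basis[OF B]
    have "(\<lambda>(m, n). (f m, \<zero>\<^bsub>N\<^esub>)) \<in> LinearCombinations.module_hom R (direct_sum M N) (direct_sum M N)"
      using f by (auto simp: LinearCombinations.module_hom_def)
    then have "free_trace R (direct_sum M N) (\<lambda>(m, n). (f m, \<zero>\<^bsub>N\<^esub>))
        = (\<Oplus>\<^bsub>R\<^esub>b\<in>B. coords R (direct_sum M N) B (f (fst b), \<zero>\<^bsub>N\<^esub>) b)"
      by (subst D.free_trace_eq[OF B b]) (auto simp: case_prod_beta)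
    also have "\<dots> = (\<Oplus>\<^bsub>R\<^esub>i\<in>I. \<phi> i (f (x i)))"
      using dual_basis_trace_unique[OF dual_basis_fst_direct_sum[OF module_axioms N b] x f] .
    finally show ?thesis .
  qed
  show ?thesis
    unfolding hs_trace_def
  proof (rule the_equality)
    show "\<exists>N :: ('a, nat \<Rightarrow> 'a) module. module R N \<and> (\<exists>B. finite_basis R (direct_sum M N) B) \<and>
        (\<Oplus>\<^bsub>R\<^esub>i\<in>I. \<phi> i (f (x i))) = free_trace R (direct_sum M N) (\<lambda>(m, n). (f m, \<zero>\<^bsub>N\<^esub>))"
    proof -
      obtain N :: "('a, nat \<Rightarrow> 'a) module" and B where N: "module R N" "finite_basis R (direct_sum M N) B"
        using exists_free_complement[OF nt x] by blast
      show ?thesis by (rule exI[of _ N]) (use N *[OF N] in auto)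
    qed
  next
    fix t
    assume "\<exists>N :: ('a, nat \<Rightarrow> 'a) module. module R N \<and> (\<exists>B. finite_basis R (direct_sum M N) B) \<and>
        t = free_trace R (direct_sum M N) (\<lambda>(m, n). (f m, \<zero>\<^bsub>N\<^esub>))"
    then obtain N :: "('a, nat \<Rightarrow> 'a) module" and B
      where "module R N" "finite_basis R (direct_sum M N) B"
        "t = free_trace R (direct_sum M N) (\<lambda>(m, n). (f m, \<zero>\<^bsub>N\<^esub>))"
      by blast
    then show "t = (\<Oplus>\<^bsub>R\<^esub>i\<in>I. \<phi> i (f (x i)))" using * by simp
  qed
qed

lemma (in Module.module) hs_rank_eq:
  assumes "\<one>\<^bsub>R\<^esub> \<noteq> \<zero>\<^bsub>R\<^esub>" and "dual_basis R M I x \<phi>"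
  shows "hs_rank R M = (\<Oplus>\<^bsub>R\<^esub>i\<in>I. \<phi> i (x i))"
  unfolding hs_rank_def
  by (rule hs_trace_eq[OF assms]) (auto simp: LinearCombinations.module_hom_def)

section \<open>Quotients and tensor products\<close>

lemma (in Module.module) submodule_subgroup:
  assumes "LinearCombinations.submodule R W M"
  shows "subgroup W (add_monoid M)"
proof -
  interpret W: LinearCombinations.submodule R W M by fact
  have "\<ominus>\<^bsub>M\<^esub> w \<in> W" if "w \<in> W" for w
  proof -
    have "(\<ominus>\<^bsub>R\<^esub> \<one>\<^bsub>R\<^esub>) \<odot>\<^bsub>M\<^esub> w \<in> W" using that by (intro W.smult_closed) auto
    then show ?thesis using that W.subset by (simp add: smult_minus_1 subsetD)
  qed
  then show ?thesis
    using W.subset by (intro M.add.subgroupI) (auto simp: a_inv_def[symmetric] intro: W.zero_closed)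
qed

lemma (in Module.module) quot_module_sel:
  assumes W: "LinearCombinations.submodule R W M"
  shows "carrier (quot_module M W) = (\<lambda>x. W +>\<^bsub>M\<^esub> x) ` carrier M"
    and "\<zero>\<^bsub>quot_module M W\<^esub> = W +>\<^bsub>M\<^esub> \<zero>\<^bsub>M\<^esub>"
    and "\<lbrakk>x \<in> carrier M; y \<in> carrier M\<rbrakk> \<Longrightarrow>
       (W +>\<^bsub>M\<^esub> x) \<oplus>\<^bsub>quot_module M W\<^esub> (W +>\<^bsub>M\<^esub> y) = W +>\<^bsub>M\<^esub> (x \<oplus>\<^bsub>M\<^esub> y)"
    and "\<lbrakk>a \<in> carrier R; x \<in> carrier M\<rbrakk> \<Longrightarrow>
       a \<odot>\<^bsub>quot_module M W\<^esub> (W +>\<^bsub>M\<^esub> x) = W +>\<^bsub>M\<^esub> (a \<odot>\<^bsub>M\<^esub> x)"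
proof -
  interpret W: LinearCombinations.submodule R W M by fact
  note sub = submodule_subgroup[OF W]
  interpret A: abelian_subgroup W M
    using sub M.a_comm_group by (intro abelian_subgroupI2)
  show "carrier (quot_module M W) = (\<lambda>x. W +>\<^bsub>M\<^esub> x) ` carrier M"
    by (auto simp: quot_module_def A_RCOSETS_def')
  show "\<zero>\<^bsub>quot_module M W\<^esub> = W +>\<^bsub>M\<^esub> \<zero>\<^bsub>M\<^esub>"
    using W.subset by (simp add: quot_module_def)
  show "(W +>\<^bsub>M\<^esub> x) \<oplus>\<^bsub>quot_module M W\<^esub> (W +>\<^bsub>M\<^esub> y) = W +>\<^bsub>M\<^esub> (x \<oplus>\<^bsub>M\<^esub> y)"
    if "x \<in> carrier M" "y \<in> carrier M"
    using A.a_rcos_sum[OF that] by (simp add: quot_module_def)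
  show "a \<odot>\<^bsub>quot_module M W\<^esub> (W +>\<^bsub>M\<^esub> x) = W +>\<^bsub>M\<^esub> (a \<odot>\<^bsub>M\<^esub> x)"
    if a: "a \<in> carrier R" and x: "x \<in> carrier M"
  proof -
    \<comment> \<open>Scalar multiplication of cosets is encoded as a union over representatives.
      All members of that union are the same coset, so the union is again a coset.\<close>
    have "W +>\<^bsub>M\<^esub> (a \<odot>\<^bsub>M\<^esub> y) = W +>\<^bsub>M\<^esub> (a \<odot>\<^bsub>M\<^esub> x)" if "y \<in> W +>\<^bsub>M\<^esub> x" for y
    proof -
      obtain w where w: "w \<in> W" "y = w \<oplus>\<^bsub>M\<^esub> x" using \<open>y \<in> W +>\<^bsub>M\<^esub> x\<close> by (auto simp: a_r_coset_def')
      then have "a \<odot>\<^bsub>M\<^esub> y = a \<odot>\<^bsub>M\<^esub> w \<oplus>\<^bsub>M\<^esub> a \<odot>\<^bsub>M\<^esub> x" using a x W.subset by (auto simp: smult_r_distr)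
      then have "a \<odot>\<^bsub>M\<^esub> y \<in> W +>\<^bsub>M\<^esub> (a \<odot>\<^bsub>M\<^esub> x)" using w a by (auto simp: a_r_coset_def')
      from M.a_repr_independence[OF this _ sub] a x show ?thesis by simp
    qed
    moreover have "x \<in> W +>\<^bsub>M\<^esub> x" using x by (rule A.a_rcos_self)
    ultimately have "(\<Union>y\<in>W +>\<^bsub>M\<^esub> x. W +>\<^bsub>M\<^esub> (a \<odot>\<^bsub>M\<^esub> y)) = W +>\<^bsub>M\<^esub> (a \<odot>\<^bsub>M\<^esub> x)"
      by blast
    then show ?thesis by (simp add: quot_module_def)
  qed
qed

lemma (in Module.module) quot_module_coset_eq:
  assumes W: "LinearCombinations.submodule R W M" and "x \<in> carrier M" "y \<in> carrier M"
    and "x \<ominus>\<^bsub>M\<^esub> y \<in> W"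
  shows "W +>\<^bsub>M\<^esub> x = W +>\<^bsub>M\<^esub> y"
proof -
  interpret W: LinearCombinations.submodule R W M by fact
  have "W +>\<^bsub>M\<^esub> (x \<oplus>\<^bsub>M\<^esub> \<ominus>\<^bsub>M\<^esub> y) = W"
    using assms M.a_coset_join2[OF _ submodule_subgroup[OF W], of "x \<ominus>\<^bsub>M\<^esub> y"]
    by (simp add: a_minus_def)
  then show ?thesis using assms(2,3) W.subset by (rule M.a_coset_add_inv1)
qed

text \<open>Maps out of a quotient are defined below by evaluating at a representative picked with
  \<open>SOME\<close>. Being constant on the coset frees the value from the choice.\<close>

lemma (in Module.module) quot_module_lift:
  assumes W: "LinearCombinations.submodule R W M" and x: "x \<in> carrier M"
    and T: "\<And>w. w \<in> W \<Longrightarrow> T (w \<oplus>\<^bsub>M\<^esub> x) = T x"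
  shows "T (SOME y. y \<in> W +>\<^bsub>M\<^esub> x) = T x"
proof -
  interpret W: LinearCombinations.submodule R W M by fact
  have "\<zero>\<^bsub>M\<^esub> \<oplus>\<^bsub>M\<^esub> x \<in> W +>\<^bsub>M\<^esub> x" using W.zero_closed by (auto simp: a_r_coset_def')
  then have "(SOME y. y \<in> W +>\<^bsub>M\<^esub> x) \<in> W +>\<^bsub>M\<^esub> x" by (rule someI)
  then show ?thesis using T by (auto simp: a_r_coset_def')
qed

lemma (in Module.module) module_quot_module:
  assumes W: "LinearCombinations.submodule R W M"
  shows "module R (quot_module M W)"
proof -
  note q = quot_module_sel[OF W]
  have "\<exists>q\<in>carrier (quot_module M W). (W +>\<^bsub>M\<^esub> x) \<oplus>\<^bsub>quot_module M W\<^esub> q = \<zero>\<^bsub>quot_module M W\<^esub>"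
    if "x \<in> carrier M" for x
    using that by (intro bexI[of _ "W +>\<^bsub>M\<^esub> (\<ominus>\<^bsub>M\<^esub> x)"]) (auto simp: q M.r_neg)
  moreover have "\<forall>v w. v \<in> carrier (quot_module M W) \<and> w \<in> carrier (quot_module M W) \<longrightarrow>
      v \<oplus>\<^bsub>quot_module M W\<^esub> w = w \<oplus>\<^bsub>quot_module M W\<^esub> v"
    by (auto simp: q M.a_comm)
  ultimately show ?thesis
    by (intro module_criteria)
      (auto simp: q M.a_assoc smult_l_distr smult_r_distr smult_assoc1 R.is_cring)
qed

lemma (in Module.module) quot_module_proj_hom:
  assumes W: "LinearCombinations.submodule R W M"
  shows "(\<lambda>x. W +>\<^bsub>M\<^esub> x) \<in> LinearCombinations.module_hom R M (quot_module M W)"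
  by (auto simp: LinearCombinations.module_hom_def quot_module_sel[OF W])

lemma (in Module.module) submodule_finsum_closed:
  assumes "LinearCombinations.submodule R W M" and "f \<in> I \<rightarrow> W"
  shows "(\<Oplus>\<^bsub>M\<^esub>i\<in>I. f i) \<in> W"
proof -
  interpret W: LinearCombinations.submodule R W M by fact
  show ?thesis using assms(2)
  proof (induction I rule: infinite_finite_induct)
    case (insert i I)
    then have "f i \<in> carrier M" "f \<in> I \<rightarrow> carrier M" using W.subset by auto
    then show ?case using insert by auto
  qed (auto intro: W.zero_closed)
qed

lemma (in Module.module) span_subset_submodule:
  assumes W: "LinearCombinations.submodule R W M" and "S \<subseteq> W"
  shows "span S \<subseteq> W"
proof
  interpret W: LinearCombinations.submodule R W M by fact
  fix m assume "m \<in> span S"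
  then obtain a A where "m = lincomb a A" "A \<subseteq> S" "a \<in> A \<rightarrow> carrier R" by (auto simp: span_def)
  then show "m \<in> W"
    using assms(2) unfolding lincomb_def by (auto intro!: submodule_finsum_closed[OF W])
qed

lemma module_hom_zero_on_span:
  assumes "module R M" "module R N" "T \<in> LinearCombinations.module_hom R M N"
    and "S \<subseteq> carrier M" "\<And>s. s \<in> S \<Longrightarrow> T s = \<zero>\<^bsub>N\<^esub>" and w: "w \<in> LinearCombinations.module.span R M S"
  shows "T w = \<zero>\<^bsub>N\<^esub>"
proof -
  interpret T: mod_hom R M N T using assms by (simp add: mod_hom_def mod_hom_axioms_def)
  have "LinearCombinations.module.span R M S \<subseteq> T.ker"
    using assms(4,5) by (intro T.M.span_subset_submodule T.ker_is_submodule) (auto simp: T.ker_def)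
  then show ?thesis using w by (auto simp: T.ker_def)
qed

text \<open>The linear extension of \<beta> from the free module on a set. It sums over the support
  of \<open>f\<close>, because the set of generators may be infinite: for a tensor product it
  consists of all pairs of elements.\<close>

definition free_extension ::
  "('r, 'x) ring_scheme \<Rightarrow> ('r, 'w, 'y) module_scheme \<Rightarrow> ('s \<Rightarrow> 'w) \<Rightarrow> ('s \<Rightarrow> 'r) \<Rightarrow> 'w" where
  "free_extension R M \<beta> f = (\<Oplus>\<^bsub>M\<^esub>s\<in>{s. f s \<noteq> \<zero>\<^bsub>R\<^esub>}. f s \<odot>\<^bsub>M\<^esub> \<beta> s)"

lemma (in cring) single_closed: "s \<in> S \<Longrightarrow> single R s \<in> carrier (free_module R S)"
  by (auto simp: free_module_carrier_iff single_def)

text \<open>The supports of f, g and f + g differ. Padding with zero terms lets the three sums share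
  one finite index set, which additivity requires.\<close>

lemma (in Module.module) free_extension_eq:
  assumes f: "f \<in> carrier (free_module R S)" and \<beta>: "\<beta> \<in> S \<rightarrow> carrier M"
    and A: "finite A" "{s. f s \<noteq> \<zero>\<^bsub>R\<^esub>} \<subseteq> A" "A \<subseteq> S"
  shows "free_extension R M \<beta> f = (\<Oplus>\<^bsub>M\<^esub>s\<in>A. f s \<odot>\<^bsub>M\<^esub> \<beta> s)"
proof -
  have \<beta>': "\<beta> s \<in> carrier M" if "s \<in> A" for s using that \<beta> A(3) by auto
  show ?thesis
    unfolding free_extension_def
  proof (rule M.add.finprod_mono_neutral_cong_left[OF A(1,2)])
    show "f i \<odot>\<^bsub>M\<^esub> \<beta> i = \<zero>\<^bsub>M\<^esub>" if "i \<in> A - {s. f s \<noteq> \<zero>\<^bsub>R\<^esub>}" for i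
      using that \<beta>' by auto
    show "(\<lambda>s. f s \<odot>\<^bsub>M\<^esub> \<beta> s) \<in> A \<rightarrow> carrier M"
      using f \<beta>' by (auto simp: free_module_carrier_iff)
  qed simp
qed

lemma (in Module.module) free_extension_hom:
  assumes \<beta>: "\<beta> \<in> S \<rightarrow> carrier M"
  shows "free_extension R M \<beta> \<in> LinearCombinations.module_hom R (free_module R S) M"
  unfolding LinearCombinations.module_hom_def
proof (intro CollectI conjI allI impI funcsetI)
  let ?F = "free_module R S"
  interpret F: Module.module R ?F by (rule R.module_free_module)
  have supp: "finite {s. f s \<noteq> \<zero>\<^bsub>R\<^esub>}" "{s. f s \<noteq> \<zero>\<^bsub>R\<^esub>} \<subseteq> S" "\<And>s. f s \<in> carrier R"
    if "f \<in> carrier ?F" for f using that by (auto simp: free_module_carrier_iff)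
  fix f assume f: "f \<in> carrier ?F"
  show "free_extension R M \<beta> f \<in> carrier M"
    unfolding free_extension_def using supp[OF f] \<beta> by (intro M.finsum_closed) (auto simp: Pi_iff)
next
  let ?F = "free_module R S"
  interpret F: Module.module R ?F by (rule R.module_free_module)
  have supp: "finite {s. f s \<noteq> \<zero>\<^bsub>R\<^esub>}" "{s. f s \<noteq> \<zero>\<^bsub>R\<^esub>} \<subseteq> S" "\<And>s. f s \<in> carrier R"
    if "f \<in> carrier ?F" for f using that by (auto simp: free_module_carrier_iff)
  fix f g assume "f \<in> carrier ?F \<and> g \<in> carrier ?F"
  then have f: "f \<in> carrier ?F" and g: "g \<in> carrier ?F" by auto
  let ?A = "{s. f s \<noteq> \<zero>\<^bsub>R\<^esub>} \<union> {s. g s \<noteq> \<zero>\<^bsub>R\<^esub>}"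
  have A: "finite ?A" "?A \<subseteq> S" using supp[OF f] supp[OF g] by auto
  have \<beta>A: "\<beta> s \<in> carrier M" if "s \<in> ?A" for s using that A(2) \<beta> by auto
  have "free_extension R M \<beta> (f \<oplus>\<^bsub>?F\<^esub> g) = (\<Oplus>\<^bsub>M\<^esub>s\<in>?A. (f \<oplus>\<^bsub>?F\<^esub> g) s \<odot>\<^bsub>M\<^esub> \<beta> s)"
    using F.M.a_closed[OF f g] \<beta> A by (intro free_extension_eq) auto
  also have "\<dots> = (\<Oplus>\<^bsub>M\<^esub>s\<in>?A. f s \<odot>\<^bsub>M\<^esub> \<beta> s \<oplus>\<^bsub>M\<^esub> g s \<odot>\<^bsub>M\<^esub> \<beta> s)"
    using supp(3)[OF f] supp(3)[OF g] \<beta>A by (intro M.finsum_cong') (auto simp: smult_l_distr)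
  also have "\<dots> = (\<Oplus>\<^bsub>M\<^esub>s\<in>?A. f s \<odot>\<^bsub>M\<^esub> \<beta> s) \<oplus>\<^bsub>M\<^esub> (\<Oplus>\<^bsub>M\<^esub>s\<in>?A. g s \<odot>\<^bsub>M\<^esub> \<beta> s)"
    using supp(3)[OF f] supp(3)[OF g] \<beta>A by (intro M.finsum_addf) auto
  also have "\<dots> = free_extension R M \<beta> f \<oplus>\<^bsub>M\<^esub> free_extension R M \<beta> g"
    using A f g \<beta> free_extension_eq[of f S \<beta> ?A] free_extension_eq[of g S \<beta> ?A] by auto
  finally show "free_extension R M \<beta> (f \<oplus>\<^bsub>?F\<^esub> g) = free_extension R M \<beta> f \<oplus>\<^bsub>M\<^esub> free_extension R M \<beta> g" .
next
  let ?F = "free_module R S"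
  interpret F: Module.module R ?F by (rule R.module_free_module)
  fix a f assume "a \<in> carrier R \<and> f \<in> carrier ?F"
  then have a: "a \<in> carrier R" and f: "f \<in> carrier ?F" by auto
  let ?A = "{s. f s \<noteq> \<zero>\<^bsub>R\<^esub>}"
  have A: "finite ?A" "?A \<subseteq> S" "\<And>s. f s \<in> carrier R" using f by (auto simp: free_module_carrier_iff)
  have \<beta>A: "\<beta> s \<in> carrier M" if "s \<in> ?A" for s using that A(2) \<beta> by auto
  have "free_extension R M \<beta> (a \<odot>\<^bsub>?F\<^esub> f) = (\<Oplus>\<^bsub>M\<^esub>s\<in>?A. (a \<odot>\<^bsub>?F\<^esub> f) s \<odot>\<^bsub>M\<^esub> \<beta> s)"
    using F.smult_closed[OF a f] \<beta> A a by (intro free_extension_eq) auto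
  also have "\<dots> = (\<Oplus>\<^bsub>M\<^esub>s\<in>?A. a \<odot>\<^bsub>M\<^esub> (f s \<odot>\<^bsub>M\<^esub> \<beta> s))"
    using a A \<beta>A by (intro M.finsum_cong') (auto simp: smult_assoc1)
  also have "\<dots> = a \<odot>\<^bsub>M\<^esub> free_extension R M \<beta> f"
    unfolding free_extension_def using a A \<beta>A by (intro finsum_smult[symmetric]) auto
  finally show "free_extension R M \<beta> (a \<odot>\<^bsub>?F\<^esub> f) = a \<odot>\<^bsub>M\<^esub> free_extension R M \<beta> f" .
qed

lemma (in Module.module) free_extension_single:
  assumes "\<beta> \<in> S \<rightarrow> carrier M" "s \<in> S"
  shows "free_extension R M \<beta> (single R s) = \<beta> s"
proof -
  have s: "\<beta> s \<in> carrier M" using assms by auto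
  have "free_extension R M \<beta> (single R s) = (\<Oplus>\<^bsub>M\<^esub>i\<in>{s}. single R s i \<odot>\<^bsub>M\<^esub> \<beta> i)"
    using assms R.single_closed[OF assms(2)] by (intro free_extension_eq) (auto simp: single_def)
  also have "\<dots> = \<beta> s" using s by (simp add: single_def)
  finally show ?thesis .
qed

lemma (in cring) free_module_decomp:
  assumes f: "f \<in> carrier (free_module R S)"
  shows "free_extension R (free_module R S) (single R) f = f"
proof
  fix j
  let ?A = "{s. f s \<noteq> \<zero>}"
  have A: "finite ?A" "?A \<subseteq> S" "\<And>s. f s \<in> carrier R" using f by (auto simp: free_module_carrier_iff)
  interpret F: Module.module R "free_module R S" by (rule module_free_module)
  have "free_extension R (free_module R S) (single R) f j
      = (\<Oplus>s\<in>?A. (f s \<odot>\<^bsub>free_module R S\<^esub> single R s) j)"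
    unfolding free_extension_def using A
    by (intro free_module_finsum_apply)
      (auto simp del: free_module_sel intro!: F.smult_closed single_closed)
  also have "\<dots> = (\<Oplus>s\<in>?A. if j = s then f s else \<zero>)"
    using A by (intro finsum_cong') (auto simp: single_def)
  also have "\<dots> = f j"
  proof (cases "j \<in> ?A")
    case True
    then show ?thesis using A by (intro finsum_singleton) auto
  next
    case False
    then have "(\<Oplus>s\<in>?A. if j = s then f s else \<zero>) = (\<Oplus>s\<in>?A. \<zero>)"
      using A by (intro finsum_cong') auto
    with False show ?thesis by simp
  qed
  finally show "free_extension R (free_module R S) (single R) f j = f j" .
qed

section \<open>The tensor product and its universal property\<close>

locale module_pair = M: Module.module R M + N: Module.module R N
  for R :: "('r, 'x) ring_scheme" and M :: "('r, 'p, 'y) module_scheme"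
    and N :: "('r, 'q, 'z) module_scheme"
begin

abbreviation F where "F \<equiv> free_module R (carrier M \<times> carrier N)"

abbreviation T where "T \<equiv> tensor_product R M N"

abbreviation K where "K \<equiv> LinearCombinations.module.span R F (tensor_relations R M N)"

definition pure_tensor :: "'p \<Rightarrow> 'q \<Rightarrow> ('p \<times> 'q \<Rightarrow> 'r) set" where
  "pure_tensor m n = K +>\<^bsub>F\<^esub> single R (m, n)"

sublocale F: Module.module R F by (rule M.R.module_free_module)

lemma tensor_relations_subset: "tensor_relations R M N \<subseteq> carrier F"
proof -
  have s: "single R (m, n) \<in> carrier F" if "m \<in> carrier M" "n \<in> carrier N" for m n
    using that by (intro M.R.single_closed) auto
  show ?thesis
    unfolding tensor_relations_def Let_def
    by (auto simp del: free_module_sel intro!: F.M.minus_closed F.M.a_closed F.smult_closed s)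
qed

lemma submodule_K: "LinearCombinations.submodule R K F"
  by (rule F.span_is_submodule[OF tensor_relations_subset])

lemma tensor_product_eq: "T = quot_module F K"
  by (simp add: tensor_product_def Let_def)

sublocale T: Module.module R T
  unfolding tensor_product_eq by (rule F.module_quot_module[OF submodule_K])

lemma single_mem: "\<lbrakk>m \<in> carrier M; n \<in> carrier N\<rbrakk> \<Longrightarrow> single R (m, n) \<in> carrier F"
  by (intro M.R.single_closed) auto

lemma relation_in_K: "r \<in> tensor_relations R M N \<Longrightarrow> r \<in> K"
  using F.in_own_span[OF tensor_relations_subset] by auto

lemma pure_tensor_closed [simp, intro]:
  "\<lbrakk>m \<in> carrier M; n \<in> carrier N\<rbrakk> \<Longrightarrow> pure_tensor m n \<in> carrier T"
  unfolding tensor_product_eq F.quot_module_sel[OF submodule_K] pure_tensor_def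
  using single_mem by auto

lemma pure_tensor_add_left:
  assumes "m \<in> carrier M" "m' \<in> carrier M" "n \<in> carrier N"
  shows "pure_tensor (m \<oplus>\<^bsub>M\<^esub> m') n = pure_tensor m n \<oplus>\<^bsub>T\<^esub> pure_tensor m' n"
proof -
  let ?d = "\<lambda>m n. single R (m, n)"
  have "?d (m \<oplus>\<^bsub>M\<^esub> m') n \<ominus>\<^bsub>F\<^esub> (?d m n \<oplus>\<^bsub>F\<^esub> ?d m' n) \<in> K"
    using assms by (intro relation_in_K) (unfold tensor_relations_def Let_def, blast)
  then have "pure_tensor (m \<oplus>\<^bsub>M\<^esub> m') n = K +>\<^bsub>F\<^esub> (?d m n \<oplus>\<^bsub>F\<^esub> ?d m' n)"
    unfolding pure_tensor_def using assms
    by (intro F.quot_module_coset_eq[OF submodule_K] single_mem F.M.a_closed) auto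
  then show ?thesis
    using assms F.quot_module_sel(3)[OF submodule_K single_mem single_mem]
    by (simp add: pure_tensor_def tensor_product_eq del: free_module_sel)
qed

lemma pure_tensor_add_right:
  assumes "m \<in> carrier M" "n \<in> carrier N" "n' \<in> carrier N"
  shows "pure_tensor m (n \<oplus>\<^bsub>N\<^esub> n') = pure_tensor m n \<oplus>\<^bsub>T\<^esub> pure_tensor m n'"
proof -
  let ?d = "\<lambda>m n. single R (m, n)"
  have "?d m (n \<oplus>\<^bsub>N\<^esub> n') \<ominus>\<^bsub>F\<^esub> (?d m n \<oplus>\<^bsub>F\<^esub> ?d m n') \<in> K"
    using assms by (intro relation_in_K) (unfold tensor_relations_def Let_def, blast)
  then have "pure_tensor m (n \<oplus>\<^bsub>N\<^esub> n') = K +>\<^bsub>F\<^esub> (?d m n \<oplus>\<^bsub>F\<^esub> ?d m n')"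
    unfolding pure_tensor_def using assms
    by (intro F.quot_module_coset_eq[OF submodule_K] single_mem F.M.a_closed) auto
  then show ?thesis
    using assms F.quot_module_sel(3)[OF submodule_K single_mem single_mem]
    by (simp add: pure_tensor_def tensor_product_eq del: free_module_sel)
qed

lemma pure_tensor_smult_left:
  assumes "a \<in> carrier R" "m \<in> carrier M" "n \<in> carrier N"
  shows "pure_tensor (a \<odot>\<^bsub>M\<^esub> m) n = a \<odot>\<^bsub>T\<^esub> pure_tensor m n"
proof -
  let ?d = "\<lambda>m n. single R (m, n)"
  have "?d (a \<odot>\<^bsub>M\<^esub> m) n \<ominus>\<^bsub>F\<^esub> a \<odot>\<^bsub>F\<^esub> ?d m n \<in> K"
    using assms by (intro relation_in_K) (unfold tensor_relations_def Let_def, blast)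
  then have "pure_tensor (a \<odot>\<^bsub>M\<^esub> m) n = K +>\<^bsub>F\<^esub> (a \<odot>\<^bsub>F\<^esub> ?d m n)"
    unfolding pure_tensor_def using assms
    by (intro F.quot_module_coset_eq[OF submodule_K] single_mem F.smult_closed) auto
  then show ?thesis
    using assms F.quot_module_sel(4)[OF submodule_K _ single_mem]
    by (simp add: pure_tensor_def tensor_product_eq del: free_module_sel)
qed

lemma pure_tensor_smult_right:
  assumes "a \<in> carrier R" "m \<in> carrier M" "n \<in> carrier N"
  shows "pure_tensor m (a \<odot>\<^bsub>N\<^esub> n) = a \<odot>\<^bsub>T\<^esub> pure_tensor m n"
proof -
  let ?d = "\<lambda>m n. single R (m, n)"
  have "?d m (a \<odot>\<^bsub>N\<^esub> n) \<ominus>\<^bsub>F\<^esub> a \<odot>\<^bsub>F\<^esub> ?d m n \<in> K"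
    using assms by (intro relation_in_K) (unfold tensor_relations_def Let_def, blast)
  then have "pure_tensor m (a \<odot>\<^bsub>N\<^esub> n) = K +>\<^bsub>F\<^esub> (a \<odot>\<^bsub>F\<^esub> ?d m n)"
    unfolding pure_tensor_def using assms
    by (intro F.quot_module_coset_eq[OF submodule_K] single_mem F.smult_closed) auto
  then show ?thesis
    using assms F.quot_module_sel(4)[OF submodule_K _ single_mem]
    by (simp add: pure_tensor_def tensor_product_eq del: free_module_sel)
qed

lemma pure_tensor_hom_left:
  "n \<in> carrier N \<Longrightarrow> (\<lambda>m. pure_tensor m n) \<in> LinearCombinations.module_hom R M T"
  by (auto simp: LinearCombinations.module_hom_def pure_tensor_add_left pure_tensor_smult_left)

lemma pure_tensor_hom_right:
  "m \<in> carrier M \<Longrightarrow> pure_tensor m \<in> LinearCombinations.module_hom R N T"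
  by (auto simp: LinearCombinations.module_hom_def pure_tensor_add_right pure_tensor_smult_right)

text \<open>The coefficient of each free generator is absorbed into the left factor. Plain sums of
  pure tensors thus exhaust the tensor product, and an additive map is determined by its values on
  pure tensors.\<close>

lemma tensor_sum_of_pure:
  assumes "z \<in> carrier T"
  obtains A g where "finite A" "g \<in> A \<rightarrow> carrier M \<times> carrier N"
    "z = (\<Oplus>\<^bsub>T\<^esub>p\<in>(A :: ('p \<times> 'q) set). pure_tensor (fst (g p)) (snd (g p)))"
proof -
  obtain f where f: "f \<in> carrier F" and z: "z = K +>\<^bsub>F\<^esub> f"
    using assms unfolding tensor_product_eq F.quot_module_sel[OF submodule_K] by blast
  let ?A = "{p. f p \<noteq> \<zero>\<^bsub>R\<^esub>}"
  have A: "finite ?A" "?A \<subseteq> carrier M \<times> carrier N" "\<And>s. f s \<in> carrier R"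
    using f by (auto simp: free_module_carrier_iff)
  have sA: "single R p \<in> carrier F" if "p \<in> ?A" for p
    using that A(2) by (intro M.R.single_closed) auto
  have "z = K +>\<^bsub>F\<^esub> (\<Oplus>\<^bsub>F\<^esub>p\<in>?A. f p \<odot>\<^bsub>F\<^esub> single R p)"
    using M.R.free_module_decomp[OF f] by (simp add: z free_extension_def)
  also have "\<dots> = (\<Oplus>\<^bsub>T\<^esub>p\<in>?A. K +>\<^bsub>F\<^esub> (f p \<odot>\<^bsub>F\<^esub> single R p))"
    unfolding tensor_product_eq using sA A(3)
    by (intro module_hom_finsum[OF F.module_axioms F.module_quot_module F.quot_module_proj_hom])
      (auto intro: submodule_K simp del: free_module_sel)
  also have "\<dots> = (\<Oplus>\<^bsub>T\<^esub>p\<in>?A. pure_tensor (f p \<odot>\<^bsub>M\<^esub> fst p) (snd p))"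
  proof (rule T.M.finsum_cong')
    fix p assume p: "p \<in> ?A"
    then have p': "fst p \<in> carrier M" "snd p \<in> carrier N" using A(2) by auto
    show "K +>\<^bsub>F\<^esub> (f p \<odot>\<^bsub>F\<^esub> single R p) = pure_tensor (f p \<odot>\<^bsub>M\<^esub> fst p) (snd p)"
      unfolding pure_tensor_smult_left[OF A(3) p']
      using F.quot_module_sel(4)[OF submodule_K A(3) sA[OF p]]
      by (simp add: pure_tensor_def tensor_product_eq)
  qed (use A in auto)
  finally show ?thesis
    using A by (intro that[of ?A "\<lambda>p. (f p \<odot>\<^bsub>M\<^esub> fst p, snd p)"]) auto
qed

text \<open>The linear extension of \<beta> to the free module kills the four kinds of relations
  because \<beta> is additive and homogeneous in each argument; hence it descends to the
  quotient.\<close>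

lemma tensor_lift:
  assumes P: "module R P"
    and \<beta>: "\<And>n. n \<in> carrier N \<Longrightarrow> (\<lambda>m. \<beta> m n) \<in> LinearCombinations.module_hom R M P"
      "\<And>m. m \<in> carrier M \<Longrightarrow> \<beta> m \<in> LinearCombinations.module_hom R N P"
  obtains L where "L \<in> LinearCombinations.module_hom R T P"
    "\<And>m n. \<lbrakk>m \<in> carrier M; n \<in> carrier N\<rbrakk> \<Longrightarrow> L (pure_tensor m n) = \<beta> m n"
proof -
  interpret P: Module.module R P by (rule P)
  define E where "E = free_extension R P (\<lambda>p. \<beta> (fst p) (snd p))"
  have b: "(\<lambda>p. \<beta> (fst p) (snd p)) \<in> carrier M \<times> carrier N \<rightarrow> carrier P"
    using LinearCombinations.module_hom_closed[OF \<beta>(2)] by (auto simp: Pi_iff)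
  have E: "E \<in> LinearCombinations.module_hom R F P"
    unfolding E_def by (rule P.free_extension_hom[OF b])
  interpret E: mod_hom R F P E
    using E P F.module_axioms by (simp add: mod_hom_def mod_hom_axioms_def)
  have Es: "E (single R (m, n)) = \<beta> m n" if "m \<in> carrier M" "n \<in> carrier N" for m n
    unfolding E_def using that by (subst P.free_extension_single[OF b]) auto
  have \<beta>c: "\<beta> m n \<in> carrier P" if "m \<in> carrier M" "n \<in> carrier N" for m n
    using Pi_mem[OF b, of "(m, n)"] that by simp
  note \<beta>ops = LinearCombinations.module_hom_add[OF \<beta>(1)] LinearCombinations.module_hom_add[OF \<beta>(2)]
    LinearCombinations.module_hom_smult[OF \<beta>(1)] LinearCombinations.module_hom_smult[OF \<beta>(2)]
  have "E r = \<zero>\<^bsub>P\<^esub>" if "r \<in> tensor_relations R M N" for r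
    using that unfolding tensor_relations_def Let_def
    by (auto simp: Es single_mem \<beta>ops \<beta>c simp del: free_module_sel)
  then have EK: "E w = \<zero>\<^bsub>P\<^esub>" if "w \<in> K" for w
    using module_hom_zero_on_span[OF F.module_axioms P E tensor_relations_subset _ that] by blast
  interpret K: LinearCombinations.submodule R K F by (rule submodule_K)
  define L where "L = (\<lambda>A. E (SOME y. y \<in> A))"
  have L: "L (K +>\<^bsub>F\<^esub> f) = E f" if f: "f \<in> carrier F" for f
    unfolding L_def using EK K.subset f
    by (intro F.quot_module_lift[OF submodule_K f]) (auto simp: subsetD simp del: free_module_sel)
  note q = F.quot_module_sel[OF submodule_K]
  have "L \<in> LinearCombinations.module_hom R T P"
    unfolding tensor_product_eq LinearCombinations.module_hom_def
    by (auto simp: q L simp del: free_module_sel)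
  moreover have "L (pure_tensor m n) = \<beta> m n" if "m \<in> carrier M" "n \<in> carrier N" for m n
    using that by (simp add: pure_tensor_def L single_mem Es)
  ultimately show ?thesis by (rule that)
qed

end

section \<open>The group ring and permutation modules\<close>

lemma finsum_pointwise:
  fixes M :: "('s \<Rightarrow> 'k :: comm_monoid_add, 'x) ring_scheme"
  assumes "abelian_monoid M" and add: "add M = (\<lambda>f g x. f x + g x)" and zero: "zero M = (\<lambda>x. 0)"
    and f: "f \<in> I \<rightarrow> carrier M"
  shows "(\<Oplus>\<^bsub>M\<^esub>i\<in>I. f i) x = (\<Sum>i\<in>I. f i x)"
proof -
  interpret abelian_monoid M by fact
  show ?thesis using f
    by (induction I rule: infinite_finite_induct) (auto simp: add zero Pi_iff)
qed

lemma group_ring_sel [simp]: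
  "\<zero>\<^bsub>group_ring G\<^esub> = (\<lambda>x. 0)"
  "\<one>\<^bsub>group_ring G\<^esub> = single class_ring \<one>\<^bsub>G\<^esub>"
  "a \<oplus>\<^bsub>group_ring G\<^esub> b = (\<lambda>x. a x + b x)"
  by (simp_all add: group_ring_def)

lemma group_ring_mult:
  "a \<otimes>\<^bsub>group_ring G\<^esub> b =
     (\<lambda>x. if x \<in> carrier G then \<Sum>y\<in>carrier G. a y * b (inv\<^bsub>G\<^esub> y \<otimes>\<^bsub>G\<^esub> x) else 0)"
  by (simp add: group_ring_def)

lemma perm_module_sel [simp]:
  "\<zero>\<^bsub>perm_module G S \<phi>\<^esub> = (\<lambda>x. 0)"
  "f \<oplus>\<^bsub>perm_module G S \<phi>\<^esub> h = (\<lambda>x. f x + h x)"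
  by (simp_all add: perm_module_def)

lemma perm_module_smult:
  "a \<odot>\<^bsub>perm_module G S \<phi>\<^esub> f =
     (\<lambda>x. if x \<in> S then \<Sum>g\<in>carrier G. a g * f (\<phi> (inv\<^bsub>G\<^esub> g) x) else 0)"
  by (simp add: perm_module_def)

lemma perm_module_carrier_iff:
  "finite S \<Longrightarrow> f \<in> carrier (perm_module G S \<phi>) \<longleftrightarrow> (\<forall>x. x \<notin> S \<longrightarrow> f x = 0)"
  by (auto simp: perm_module_def free_module_carrier_iff intro: finite_subset[rotated])

lemma single_class_ring: "single class_ring s = (\<lambda>x. if x = s then 1 else 0 :: complex)"
  by (auto simp: single_def)

locale finite_comm_group = comm_group G for G (structure) +
  assumes finite_carrier: "finite (carrier G)"
begin

lemma group_ring_carrier_iff: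
  "a \<in> carrier (group_ring G) \<longleftrightarrow> (\<forall>x. x \<notin> carrier G \<longrightarrow> a x = 0)"
  using finite_carrier
  by (auto simp: group_ring_def free_module_carrier_iff intro: finite_subset[rotated])

lemma sum_translate:
  fixes F :: "'a \<Rightarrow> complex"
  assumes "h \<in> carrier G"
  shows "(\<Sum>g\<in>carrier G. F (h \<otimes> g)) = (\<Sum>g\<in>carrier G. F g)"
  by (rule sum.reindex_bij_witness[of _ "\<lambda>g. inv h \<otimes> g" "\<lambda>g. h \<otimes> g"])
    (use assms in \<open>auto simp: m_assoc[symmetric]\<close>)

text \<open>The substitution w = y z. The function \<open>F\<close> is left free because the same
  identity yields associativity of the group ring, with F(w) = c(w^-1 x), and of its action on
  permutation modules, with F(w) = f(w^-1 x).\<close>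

lemma sum_convolution:
  fixes F :: "'a \<Rightarrow> complex"
  shows "(\<Sum>w\<in>carrier G. (\<Sum>y\<in>carrier G. a y * b (inv y \<otimes> w)) * F w)
    = (\<Sum>y\<in>carrier G. a y * (\<Sum>z\<in>carrier G. b z * F (y \<otimes> z)))"
proof -
  have "(\<Sum>w\<in>carrier G. (\<Sum>y\<in>carrier G. a y * b (inv y \<otimes> w)) * F w)
    = (\<Sum>y\<in>carrier G. a y * (\<Sum>w\<in>carrier G. b (inv y \<otimes> w) * F w))"
    unfolding sum_distrib_right sum_distrib_left by (subst sum.swap) (simp add: mult.assoc)
  also have "\<dots> = (\<Sum>y\<in>carrier G. a y * (\<Sum>z\<in>carrier G. b z * F (y \<otimes> z)))"
  proof (rule sum.cong[OF refl])
    fix y assume y: "y \<in> carrier G"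
    have "(\<Sum>z\<in>carrier G. b (inv y \<otimes> (y \<otimes> z)) * F (y \<otimes> z)) = (\<Sum>w\<in>carrier G. b (inv y \<otimes> w) * F w)"
      by (rule sum_translate[OF y])
    moreover have "(\<Sum>z\<in>carrier G. b (inv y \<otimes> (y \<otimes> z)) * F (y \<otimes> z)) = (\<Sum>z\<in>carrier G. b z * F (y \<otimes> z))"
      using y by (intro sum.cong) (auto simp: m_assoc[symmetric])
    ultimately show "a y * (\<Sum>w\<in>carrier G. b (inv y \<otimes> w) * F w)
        = a y * (\<Sum>z\<in>carrier G. b z * F (y \<otimes> z))" by simp
  qed
  finally show ?thesis .
qed

lemma single_group_ring_closed: "g \<in> carrier G \<Longrightarrow> single class_ring g \<in> carrier (group_ring G)"
  by (auto simp: group_ring_carrier_iff single_class_ring)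

lemma group_ring_assoc:
  "(a \<otimes>\<^bsub>group_ring G\<^esub> b) \<otimes>\<^bsub>group_ring G\<^esub> c = a \<otimes>\<^bsub>group_ring G\<^esub> (b \<otimes>\<^bsub>group_ring G\<^esub> c)"
proof
  fix x
  show "((a \<otimes>\<^bsub>group_ring G\<^esub> b) \<otimes>\<^bsub>group_ring G\<^esub> c) x = (a \<otimes>\<^bsub>group_ring G\<^esub> (b \<otimes>\<^bsub>group_ring G\<^esub> c)) x"
  proof (cases "x \<in> carrier G")
    case True
    have "((a \<otimes>\<^bsub>group_ring G\<^esub> b) \<otimes>\<^bsub>group_ring G\<^esub> c) x
        = (\<Sum>w\<in>carrier G. (\<Sum>y\<in>carrier G. a y * b (inv y \<otimes> w)) * c (inv w \<otimes> x))"
      using True by (simp add: group_ring_mult cong: sum.cong)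
    also have "\<dots> = (\<Sum>y\<in>carrier G. a y * (\<Sum>z\<in>carrier G. b z * c (inv (y \<otimes> z) \<otimes> x)))"
      by (rule sum_convolution)
    also have "\<dots> = (a \<otimes>\<^bsub>group_ring G\<^esub> (b \<otimes>\<^bsub>group_ring G\<^esub> c)) x"
      using True by (auto simp: group_ring_mult inv_mult_group m_assoc intro!: sum.cong)
    finally show ?thesis .
  qed (simp add: group_ring_mult)
qed

lemma group_ring_comm: "a \<otimes>\<^bsub>group_ring G\<^esub> b = b \<otimes>\<^bsub>group_ring G\<^esub> a"
proof
  fix x
  show "(a \<otimes>\<^bsub>group_ring G\<^esub> b) x = (b \<otimes>\<^bsub>group_ring G\<^esub> a) x"
  proof (cases "x \<in> carrier G")
    case True
    \<comment> \<open>By commutativity y \<mapsto> y^-1 x is an involution of the group, and this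
      substitution exchanges the two factors of the convolution.\<close>
    have *: "inv (inv y \<otimes> x) \<otimes> x = y" if "y \<in> carrier G" for y
      using that True by (simp add: inv_mult_group m_assoc m_comm[of y x])
         (simp add: m_assoc[symmetric])
    have "(\<Sum>y\<in>carrier G. a y * b (inv y \<otimes> x)) = (\<Sum>y\<in>carrier G. b y * a (inv y \<otimes> x))"
      by (rule sum.reindex_bij_witness[of _ "\<lambda>y. inv y \<otimes> x" "\<lambda>y. inv y \<otimes> x"])
        (use True * in auto)
    then show ?thesis using True by (simp add: group_ring_mult)
  qed (simp add: group_ring_mult)
qed

lemma group_ring_one:
  assumes "a \<in> carrier (group_ring G)"
  shows "single class_ring \<one> \<otimes>\<^bsub>group_ring G\<^esub> a = a"
proof
  fix x
  have "(\<Sum>y\<in>carrier G. single class_ring \<one> y * a (inv y \<otimes> x))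
      = (\<Sum>y\<in>carrier G. if y = \<one> then a (inv y \<otimes> x) else 0)"
    by (intro sum.cong) (auto simp: single_class_ring)
  also have "\<dots> = a (inv \<one> \<otimes> x)" using finite_carrier by (simp add: sum.delta)
  finally show "(single class_ring \<one> \<otimes>\<^bsub>group_ring G\<^esub> a) x = a x"
    using assms by (auto simp: group_ring_mult group_ring_carrier_iff)
qed

sublocale GR: cring "group_ring G"
proof (rule cringI)
  show "abelian_group (group_ring G)"
  proof (rule abelian_groupI)
    fix a assume "a \<in> carrier (group_ring G)"
    then show "\<exists>b\<in>carrier (group_ring G). b \<oplus>\<^bsub>group_ring G\<^esub> a = \<zero>\<^bsub>group_ring G\<^esub>"
      by (intro bexI[of _ "\<lambda>x. - a x"]) (auto simp: group_ring_carrier_iff)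
  qed (auto simp: group_ring_carrier_iff algebra_simps)
  show "comm_monoid (group_ring G)"
  proof (rule comm_monoidI)
    show "a \<otimes>\<^bsub>group_ring G\<^esub> b \<in> carrier (group_ring G)" for a b
      by (simp add: group_ring_carrier_iff group_ring_mult)
    show "\<one>\<^bsub>group_ring G\<^esub> \<in> carrier (group_ring G)" by (simp add: single_group_ring_closed)
    show "\<one>\<^bsub>group_ring G\<^esub> \<otimes>\<^bsub>group_ring G\<^esub> a = a" if "a \<in> carrier (group_ring G)" for a
      using that by (simp add: group_ring_one)
  qed (rule group_ring_assoc group_ring_comm)+
  show "(a \<oplus>\<^bsub>group_ring G\<^esub> b) \<otimes>\<^bsub>group_ring G\<^esub> c = a \<otimes>\<^bsub>group_ring G\<^esub> c \<oplus>\<^bsub>group_ring G\<^esub> b \<otimes>\<^bsub>group_ring G\<^esub> c"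
    for a b c by (auto simp: group_ring_mult distrib_right sum.distrib)
qed

lemma group_ring_nontrivial: "\<one>\<^bsub>group_ring G\<^esub> \<noteq> \<zero>\<^bsub>group_ring G\<^esub>"
  by (auto simp: single_class_ring fun_eq_iff)

lemma group_ring_finsum_apply:
  "f \<in> I \<rightarrow> carrier (group_ring G) \<Longrightarrow> (\<Oplus>\<^bsub>group_ring G\<^esub>i\<in>I. f i) x = (\<Sum>i\<in>I. f i x)"
  by (rule finsum_pointwise[OF GR.abelian_monoid_axioms]) (auto simp: group_ring_def)

lemma group_ring_minus:
  assumes "a \<in> carrier (group_ring G)" "b \<in> carrier (group_ring G)"
  shows "a \<ominus>\<^bsub>group_ring G\<^esub> b = (\<lambda>x. a x - b x)"
proof -
  have "\<ominus>\<^bsub>group_ring G\<^esub> b = (\<lambda>x. - b x)"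
    using assms by (intro GR.minus_equality) (auto simp: group_ring_carrier_iff)
  then show ?thesis by (simp add: a_minus_def)
qed

end

section \<open>Permutation modules and their ranks\<close>

locale finite_comm_group_action = finite_comm_group G + group_action G S \<phi>
  for G :: "('g, 'm) monoid_scheme" (structure) and S :: "'s set" and \<phi> +
  assumes finite_set: "finite S"
begin

abbreviation P where "P \<equiv> perm_module G S \<phi>"

lemma act_closed [simp, intro]: "\<lbrakk>g \<in> carrier G; x \<in> S\<rbrakk> \<Longrightarrow> \<phi> g x \<in> S"
  using element_image by blast

lemma act_one [simp]: "x \<in> S \<Longrightarrow> \<phi> \<one> x = x"
  using id_eq_one by (metis restrict_apply')

lemma act_inv [simp]:
  "\<lbrakk>g \<in> carrier G; x \<in> S\<rbrakk> \<Longrightarrow> \<phi> g (\<phi> (inv g) x) = x"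
  "\<lbrakk>g \<in> carrier G; x \<in> S\<rbrakk> \<Longrightarrow> \<phi> (inv g) (\<phi> g x) = x"
  using composition_rule[of x g "inv g"] composition_rule[of x "inv g" g] by simp_all

lemma perm_module_assoc:
  "(a \<otimes>\<^bsub>group_ring G\<^esub> b) \<odot>\<^bsub>P\<^esub> f = a \<odot>\<^bsub>P\<^esub> (b \<odot>\<^bsub>P\<^esub> f)"
proof
  fix x
  show "((a \<otimes>\<^bsub>group_ring G\<^esub> b) \<odot>\<^bsub>P\<^esub> f) x = (a \<odot>\<^bsub>P\<^esub> (b \<odot>\<^bsub>P\<^esub> f)) x"
  proof (cases "x \<in> S")
    case True
    have "((a \<otimes>\<^bsub>group_ring G\<^esub> b) \<odot>\<^bsub>P\<^esub> f) x
        = (\<Sum>w\<in>carrier G. (\<Sum>y\<in>carrier G. a y * b (inv y \<otimes> w)) * f (\<phi> (inv w) x))"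
      using True by (simp add: group_ring_mult perm_module_smult cong: sum.cong)
    also have "\<dots> = (\<Sum>y\<in>carrier G. a y * (\<Sum>z\<in>carrier G. b z * f (\<phi> (inv (y \<otimes> z)) x)))"
      by (rule sum_convolution)
    also have "\<dots> = (a \<odot>\<^bsub>P\<^esub> (b \<odot>\<^bsub>P\<^esub> f)) x"
      using True
      by (auto simp: perm_module_smult inv_mult_group composition_rule intro!: sum.cong)
    finally show ?thesis .
  qed (simp add: perm_module_smult)
qed

lemma perm_module_one:
  assumes "f \<in> carrier P"
  shows "single class_ring \<one> \<odot>\<^bsub>P\<^esub> f = f"
proof
  fix x
  have "(\<Sum>y\<in>carrier G. single class_ring \<one> y * f (\<phi> (inv y) x))
      = (\<Sum>y\<in>carrier G. if y = \<one> then f (\<phi> (inv y) x) else 0)"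
    by (intro sum.cong) (auto simp: single_class_ring)
  also have "\<dots> = f (\<phi> (inv \<one>) x)" using finite_carrier by (simp add: sum.delta)
  finally show "(single class_ring \<one> \<odot>\<^bsub>P\<^esub> f) x = f x"
    using assms finite_set by (auto simp: perm_module_smult perm_module_carrier_iff)
qed

sublocale P: Module.module "group_ring G" P
proof (rule module_criteria)
  show "\<forall>f\<in>carrier P. \<exists>h\<in>carrier P. f \<oplus>\<^bsub>P\<^esub> h = \<zero>\<^bsub>P\<^esub>"
  proof
    fix f assume "f \<in> carrier P"
    then show "\<exists>h\<in>carrier P. f \<oplus>\<^bsub>P\<^esub> h = \<zero>\<^bsub>P\<^esub>"
      using finite_set by (intro bexI[of _ "\<lambda>x. - f x"]) (auto simp: perm_module_carrier_iff)
  qed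
  show "\<forall>a b f. a \<in> carrier (group_ring G) \<and> b \<in> carrier (group_ring G) \<and> f \<in> carrier P \<longrightarrow>
      (a \<otimes>\<^bsub>group_ring G\<^esub> b) \<odot>\<^bsub>P\<^esub> f = a \<odot>\<^bsub>P\<^esub> (b \<odot>\<^bsub>P\<^esub> f)"
    by (simp add: perm_module_assoc)
  show "\<forall>f\<in>carrier P. \<one>\<^bsub>group_ring G\<^esub> \<odot>\<^bsub>P\<^esub> f = f"
    by (simp add: perm_module_one)
  show "cring (group_ring G)" by (rule GR.is_cring)
qed (use finite_set in \<open>auto simp: perm_module_carrier_iff perm_module_smult algebra_simps sum.distrib\<close>)

lemma perm_module_finsum_apply:
  "f \<in> I \<rightarrow> carrier P \<Longrightarrow> (\<Oplus>\<^bsub>P\<^esub>i\<in>I. f i) x = (\<Sum>i\<in>I. f i x)"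
  by (rule finsum_pointwise[OF P.M.abelian_monoid_axioms]) (auto simp: perm_module_def)

lemma single_perm_closed: "x \<in> S \<Longrightarrow> single class_ring x \<in> carrier P"
  using finite_set by (auto simp: perm_module_carrier_iff single_class_ring)

text \<open>The lift of the coordinate form f \<mapsto> f(x) to a form over the group ring, with the
  coordinate still visible at the identity. The divisor |G| counts the pairs (g, x) with g x = y,
  each of which contributes f(y) when f is reassembled at y.\<close>

definition orbit_form :: "'s \<Rightarrow> ('s \<Rightarrow> complex) \<Rightarrow> 'g \<Rightarrow> complex" where
  "orbit_form x f = (\<lambda>g. if g \<in> carrier G then f (\<phi> g x) / of_nat (card (carrier G)) else 0)"

lemma orbit_form_linear:
  assumes "x \<in> S"
  shows "orbit_form x \<in> linear_forms (group_ring G) P"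
proof -
  have "orbit_form x (a \<odot>\<^bsub>P\<^esub> f) = a \<otimes>\<^bsub>group_ring G\<^esub> orbit_form x f" for a f
    using assms
    by (auto simp: orbit_form_def group_ring_mult perm_module_smult composition_rule
        sum_divide_distrib intro!: ext sum.cong)
  then show ?thesis
    by (auto simp: linear_forms_def group_ring_carrier_iff orbit_form_def add_divide_distrib)
qed

lemma card_carrier_pos: "card (carrier G) > 0"
  using finite_carrier one_closed by (auto simp: card_gt_0_iff)

text \<open>A pair (x, g) reaches y only if x = g^-1 y. \<open>F\<close> is arbitrary so that the
  computation serves twice: for the coordinates of a permutation module and for the antisymmetrized
  coordinates on edges.\<close>

lemma sum_single_action:
  assumes y: "y \<in> S"
  shows "(\<Sum>x\<in>S. ((\<lambda>g. if g \<in> carrier G then F x (\<phi> g x) / of_nat (card (carrier G)) else 0)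
            \<odot>\<^bsub>P\<^esub> single class_ring x) y)
    = (\<Sum>g\<in>carrier G. F (\<phi> (inv g) y) y) / of_nat (card (carrier G))"
proof -
  have "(\<Sum>x\<in>S. ((\<lambda>g. if g \<in> carrier G then F x (\<phi> g x) / of_nat (card (carrier G)) else 0)
            \<odot>\<^bsub>P\<^esub> single class_ring x) y)
      = (\<Sum>x\<in>S. \<Sum>g\<in>carrier G. if x = \<phi> (inv g) y then F x (\<phi> g x) / of_nat (card (carrier G)) else 0)"
    using y by (auto simp: perm_module_smult single_class_ring intro!: sum.cong)
  also have "\<dots> = (\<Sum>g\<in>carrier G. F (\<phi> (inv g) y) y / of_nat (card (carrier G)))"
    using y finite_set by (subst sum.swap) (auto simp: sum.delta intro!: sum.cong)
  finally show ?thesis by (simp add: sum_divide_distrib)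
qed

lemma perm_module_dual_basis:
  "dual_basis (group_ring G) P S (single class_ring) orbit_form"
proof -
  have "(\<Oplus>\<^bsub>P\<^esub>x\<in>S. orbit_form x f \<odot>\<^bsub>P\<^esub> single class_ring x) = f" if f: "f \<in> carrier P" for f
  proof
    fix y
    have cl: "(\<lambda>x. orbit_form x f \<odot>\<^bsub>P\<^esub> single class_ring x) \<in> S \<rightarrow> carrier P"
      using linear_formsD(1)[OF orbit_form_linear _ ] f single_perm_closed by auto
    show "(\<Oplus>\<^bsub>P\<^esub>x\<in>S. orbit_form x f \<odot>\<^bsub>P\<^esub> single class_ring x) y = f y"
    proof (cases "y \<in> S")
      case True
      show ?thesis
        using perm_module_finsum_apply[OF cl] sum_single_action[OF True, of "\<lambda>_. f"] card_carrier_pos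
        by (simp add: orbit_form_def)
    next
      case False
      then show ?thesis
        using perm_module_finsum_apply[OF cl] f finite_set
        by (simp add: perm_module_smult perm_module_carrier_iff)
    qed
  qed
  then show ?thesis
    using finite_set single_perm_closed orbit_form_linear by (auto simp: dual_basis_def)
qed

lemma perm_module_rank:
  assumes "g \<in> carrier G"
  shows "hs_rank (group_ring G) P g = of_nat (card (invariants S \<phi> g)) / of_nat (card (carrier G))"
proof -
  have "hs_rank (group_ring G) P g = (\<Sum>x\<in>S. orbit_form x (single class_ring x) g)"
    unfolding P.hs_rank_eq[OF group_ring_nontrivial perm_module_dual_basis]
    by (intro group_ring_finsum_apply) (use dual_basisD(2,4)[OF perm_module_dual_basis] in auto)
  also have "\<dots> = (\<Sum>x\<in>S. if \<phi> g x = x then 1 / of_nat (card (carrier G)) else 0)"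
    using assms by (intro sum.cong) (auto simp: orbit_form_def single_class_ring)
  also have "\<dots> = of_nat (card (invariants S \<phi> g)) / of_nat (card (carrier G))"
    using finite_set by (simp add: invariants_def sum.If_cases Int_def)
  finally show ?thesis .
qed

end

section \<open>Edge chains: the quotient by symmetric functions\<close>

locale involutive_action = finite_comm_group_action G S \<phi>
  for G :: "('g, 'm) monoid_scheme" (structure) and S :: "'s set" and \<phi> +
  fixes \<iota> :: "'s \<Rightarrow> 's"
  assumes \<iota>_closed: "x \<in> S \<Longrightarrow> \<iota> x \<in> S"
    and \<iota>_\<iota>: "x \<in> S \<Longrightarrow> \<iota> (\<iota> x) = x"
    and \<iota>_equivariant: "\<lbrakk>g \<in> carrier G; x \<in> S\<rbrakk> \<Longrightarrow> \<phi> g (\<iota> x) = \<iota> (\<phi> g x)"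
    and not_inverted: "\<lbrakk>g \<in> carrier G; x \<in> S\<rbrakk> \<Longrightarrow> \<phi> g x \<noteq> \<iota> x"
begin

text \<open>A span over the complex numbers, to agree with \<open>chains1\<close>. Stability under
  the group ring becomes visible only through \<open>W_eq\<close>.\<close>

definition W :: "('s \<Rightarrow> complex) set" where
  "W = LinearCombinations.module.span class_ring (free_module class_ring S)
          {(\<lambda>x. single class_ring e x + single class_ring (\<iota> e) x) | e. e \<in> S}"

text \<open>Symmetry under \<iota> is a linear condition that the generators satisfy; conversely a
  symmetric f is the combination of the e + \<iota> e with coefficients f(e)/2. The pointwise
  description replaces the span in all membership proofs below.\<close>

lemma W_eq: "W = {f \<in> carrier P. \<forall>x\<in>S. f (\<iota> x) = f x}"
proof -
  interpret F: Module.module "class_ring :: complex ring" "free_module class_ring S"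
    by (rule class_cring.module_free_module)
  let ?F = "free_module (class_ring :: complex ring) S"
  let ?A = "{(\<lambda>x. single class_ring e x + single class_ring (\<iota> e) x :: complex) | e. e \<in> S}"
  have FP: "carrier ?F = carrier P" by (simp add: perm_module_def)
  have A: "?A \<subseteq> carrier ?F"
    unfolding FP using finite_set \<iota>_closed by (auto simp: perm_module_carrier_iff single_class_ring)
  note W_sub = F.span_is_submodule[OF A]
  show ?thesis
  proof (intro equalityI subsetI)
    fix f assume "f \<in> W"
    moreover have "LinearCombinations.submodule class_ring {f \<in> carrier ?F. \<forall>x\<in>S. f (\<iota> x) = f x} ?F"
      by (rule LinearCombinations.submodule.intro[OF F.module_axioms])
        (auto simp: FP perm_module_carrier_iff finite_set)
    moreover have "?A \<subseteq> {f \<in> carrier ?F. \<forall>x\<in>S. f (\<iota> x) = f x}"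
      using A \<iota>_\<iota> by (auto simp: single_class_ring) metis+
    ultimately show "f \<in> {f \<in> carrier P. \<forall>x\<in>S. f (\<iota> x) = f x}"
      unfolding W_def FP[symmetric] using F.span_subset_submodule by blast
  next
    fix f assume f: "f \<in> {f \<in> carrier P. \<forall>x\<in>S. f (\<iota> x) = f x}"
    \<comment> \<open>The point y is met twice in the sum, from e = y and from e = \<iota> y, whence
      the factor 1/2.\<close>
    let ?h = "\<lambda>e. (f e / 2) \<odot>\<^bsub>?F\<^esub> (\<lambda>x. single class_ring e x + single class_ring (\<iota> e) x)"
    have A': "(\<lambda>x. single class_ring e x + single class_ring (\<iota> e) x :: complex) \<in> F.span ?A" if "e \<in> S" for e
      using F.in_own_span[OF A] that by blast
    have mem: "?h \<in> S \<rightarrow> F.span ?A"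
      by (intro funcsetI LinearCombinations.submodule.smult_closed[OF W_sub] A') auto
    have memF: "?h \<in> S \<rightarrow> carrier ?F"
      using mem LinearCombinations.submodule.subset[OF W_sub] by blast
    have "(\<Oplus>\<^bsub>?F\<^esub>e\<in>S. ?h e) = f"
    proof
      fix y
      have "(\<Oplus>\<^bsub>?F\<^esub>e\<in>S. ?h e) y = (\<Sum>e\<in>S. ?h e y)"
        by (rule finsum_pointwise[OF F.M.abelian_monoid_axioms _ _ memF])
          (auto simp: free_module_def)
      also have "\<dots> = f y"
      proof (cases "y \<in> S")
        case True
        have "(\<Sum>e\<in>S. ?h e y) = (\<Sum>e\<in>S. (if e = y then f e / 2 else 0) + (if e = \<iota> y then f e / 2 else 0))"
          using True \<iota>_\<iota> by (intro sum.cong) (auto simp: single_class_ring)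
        also have "\<dots> = f y / 2 + f (\<iota> y) / 2"
          using True \<iota>_closed finite_set by (simp add: sum.distrib)
        also have "\<dots> = f y" using f True by simp
        finally show ?thesis .
      next
        case False
        then have "?h e y = 0" if "e \<in> S" for e
          using that \<iota>_closed[OF that] by (auto simp: single_class_ring)
        then show ?thesis using False f finite_set by (simp add: perm_module_carrier_iff)
      qed
      finally show "(\<Oplus>\<^bsub>?F\<^esub>e\<in>S. ?h e) y = f y" .
    qed
    moreover have "(\<Oplus>\<^bsub>?F\<^esub>e\<in>S. ?h e) \<in> F.span ?A"
      by (rule F.submodule_finsum_closed[OF W_sub mem])
    ultimately show "f \<in> W" by (simp add: W_def)
  qed
qed

lemma submodule_W: "LinearCombinations.submodule (group_ring G) W P"
proof (rule LinearCombinations.submodule.intro[OF P.module_axioms])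
  show "a \<odot>\<^bsub>P\<^esub> f \<in> W" if a: "a \<in> carrier (group_ring G)" and f: "f \<in> W" for a f
  proof -
    have "a \<odot>\<^bsub>P\<^esub> f \<in> carrier P" using a f by (intro P.smult_closed) (auto simp: W_eq)
    moreover have "(a \<odot>\<^bsub>P\<^esub> f) (\<iota> x) = (a \<odot>\<^bsub>P\<^esub> f) x" if "x \<in> S" for x
      using that f \<iota>_closed by (auto simp: perm_module_smult W_eq \<iota>_equivariant intro!: sum.cong)
    ultimately show ?thesis by (simp add: W_eq)
  qed
qed (auto simp: W_eq perm_module_carrier_iff finite_set)

text \<open>This is \<open>orbit_form\<close> applied to (f - f \<circ> \<iota>)/2, the projection
  of f to the antisymmetric functions. It kills \<open>W\<close>, so it descends to the quotient,
  and the projection differs from f by an element of \<open>W\<close>.\<close>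

definition alternating_form :: "'s \<Rightarrow> ('s \<Rightarrow> complex) \<Rightarrow> 'g \<Rightarrow> complex" where
  "alternating_form e f =
     (\<lambda>g. if g \<in> carrier G then (f (\<phi> g e) - f (\<iota> (\<phi> g e))) / 2 / of_nat (card (carrier G)) else 0)"

definition quotient_form :: "'s \<Rightarrow> ('s \<Rightarrow> complex) set \<Rightarrow> 'g \<Rightarrow> complex" where
  "quotient_form e A = alternating_form e (SOME f. f \<in> A)"

abbreviation Q where "Q \<equiv> quot_module P W"

sublocale Q: Module.module "group_ring G" Q
  by (rule P.module_quot_module[OF submodule_W])

lemma quotient_form_coset:
  assumes "e \<in> S" "f \<in> carrier P"
  shows "quotient_form e (W +>\<^bsub>P\<^esub> f) = alternating_form e f"
  unfolding quotient_form_def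
  by (rule P.quot_module_lift[OF submodule_W assms(2)])
    (use assms \<iota>_closed in \<open>auto simp: W_eq alternating_form_def\<close>)

lemma alternating_form_smult:
  assumes "e \<in> S"
  shows "alternating_form e (a \<odot>\<^bsub>P\<^esub> f) = a \<otimes>\<^bsub>group_ring G\<^esub> alternating_form e f"
proof
  fix g
  show "alternating_form e (a \<odot>\<^bsub>P\<^esub> f) g = (a \<otimes>\<^bsub>group_ring G\<^esub> alternating_form e f) g"
    using assms \<iota>_closed
    by (auto simp: alternating_form_def group_ring_mult perm_module_smult composition_rule
        \<iota>_equivariant sum_divide_distrib sum_subtractf[symmetric] algebra_simps diff_divide_distrib intro!: sum.cong)
qed

lemma quotient_form_linear:
  assumes "e \<in> S"
  shows "quotient_form e \<in> linear_forms (group_ring G) Q"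
proof -
  note q = P.quot_module_sel[OF submodule_W]
  have cl: "alternating_form e f \<in> carrier (group_ring G)" for f
    by (simp add: alternating_form_def group_ring_carrier_iff)
  have add: "alternating_form e (f \<oplus>\<^bsub>P\<^esub> h) = alternating_form e f \<oplus>\<^bsub>group_ring G\<^esub> alternating_form e h" for f h
    by (auto simp: alternating_form_def add_divide_distrib diff_divide_distrib)
  show ?thesis
    unfolding linear_forms_def
  proof (intro CollectI conjI ballI funcsetI)
    fix A assume "A \<in> carrier Q"
    then obtain f where f: "f \<in> carrier P" "A = W +>\<^bsub>P\<^esub> f" by (auto simp: q)
    then show "quotient_form e A \<in> carrier (group_ring G)"
      using assms cl by (simp add: quotient_form_coset)
    { fix B assume "B \<in> carrier Q"
      then obtain h where h: "h \<in> carrier P" "B = W +>\<^bsub>P\<^esub> h" by (auto simp: q)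
      show "quotient_form e (A \<oplus>\<^bsub>Q\<^esub> B) = quotient_form e A \<oplus>\<^bsub>group_ring G\<^esub> quotient_form e B"
        using assms f h P.M.a_closed[OF f(1) h(1)]
        by (simp add: q quotient_form_coset add del: perm_module_sel group_ring_sel) }
    { fix a assume "a \<in> carrier (group_ring G)"
      then show "quotient_form e (a \<odot>\<^bsub>Q\<^esub> A) = a \<otimes>\<^bsub>group_ring G\<^esub> quotient_form e A"
        using assms f by (simp add: q quotient_form_coset alternating_form_smult) }
  qed
qed

lemma perm_module_minus:
  assumes "f \<in> carrier P" "h \<in> carrier P"
  shows "f \<ominus>\<^bsub>P\<^esub> h = (\<lambda>x. f x - h x)"
proof -
  have "\<ominus>\<^bsub>P\<^esub> h = (\<lambda>x. - h x)"
    using assms finite_set by (intro P.M.minus_equality) (auto simp: perm_module_carrier_iff)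
  then show ?thesis by (simp add: a_minus_def)
qed

text \<open>Both e and \<iota> e serve as indices, so no orientation of the edges has to be chosen;
  the factor 1/2 in the forms compensates for the double count.\<close>

lemma quotient_dual_basis:
  "dual_basis (group_ring G) Q S (\<lambda>e. W +>\<^bsub>P\<^esub> single class_ring e) quotient_form"
proof -
  note q = P.quot_module_sel[OF submodule_W]
  have "(\<Oplus>\<^bsub>Q\<^esub>e\<in>S. quotient_form e A \<odot>\<^bsub>Q\<^esub> (W +>\<^bsub>P\<^esub> single class_ring e)) = A" if AQ: "A \<in> carrier Q" for A
  proof -
    obtain f where f: "f \<in> carrier P" and A: "A = W +>\<^bsub>P\<^esub> f" using AQ by (auto simp: q)
    let ?t = "\<lambda>e. alternating_form e f \<odot>\<^bsub>P\<^esub> single class_ring e"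
    have cl: "alternating_form e f \<in> carrier (group_ring G)" for e
      by (simp add: alternating_form_def group_ring_carrier_iff)
    have t: "?t \<in> S \<rightarrow> carrier P" using cl single_perm_closed by auto
    have "(\<Oplus>\<^bsub>Q\<^esub>e\<in>S. quotient_form e A \<odot>\<^bsub>Q\<^esub> (W +>\<^bsub>P\<^esub> single class_ring e)) = (\<Oplus>\<^bsub>Q\<^esub>e\<in>S. W +>\<^bsub>P\<^esub> ?t e)"
      using cl single_perm_closed f Pi_mem[OF t]
      by (intro Q.M.finsum_cong') (auto simp: q A quotient_form_coset)
    also have "\<dots> = W +>\<^bsub>P\<^esub> (\<Oplus>\<^bsub>P\<^esub>e\<in>S. ?t e)"
      using module_hom_finsum[OF P.module_axioms Q.module_axioms P.quot_module_proj_hom[OF submodule_W] t]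
      by simp
    also have "\<dots> = W +>\<^bsub>P\<^esub> f"
    proof (rule P.quot_module_coset_eq[OF submodule_W])
      show s: "(\<Oplus>\<^bsub>P\<^esub>e\<in>S. ?t e) \<in> carrier P" using t by (rule P.M.finsum_closed)
      have eq: "(\<Oplus>\<^bsub>P\<^esub>e\<in>S. ?t e) y = (f y - f (\<iota> y)) / 2" if y: "y \<in> S" for y
        using perm_module_finsum_apply[OF t] sum_single_action[OF y, of "\<lambda>_ z. (f z - f (\<iota> z)) / 2"] card_carrier_pos
        by (simp add: alternating_form_def)
      \<comment> \<open>The sum minus f equals -(f + f \<circ> \<iota>)/2 on \<open>S\<close>, which
        is symmetric and therefore lies in \<open>W\<close>.\<close>
      have "(\<Oplus>\<^bsub>P\<^esub>e\<in>S. ?t e) (\<iota> y) - f (\<iota> y) = (\<Oplus>\<^bsub>P\<^esub>e\<in>S. ?t e) y - f y" if "y \<in> S" for y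
        using that \<iota>_closed \<iota>_\<iota> by (simp add: eq field_simps)
      then show "(\<Oplus>\<^bsub>P\<^esub>e\<in>S. ?t e) \<ominus>\<^bsub>P\<^esub> f \<in> W"
        using P.M.minus_closed[OF s f] by (simp add: perm_module_minus[OF s f] W_eq)
    qed (rule f)
    finally show ?thesis by (simp add: A)
  qed
  then show ?thesis
    using finite_set single_perm_closed quotient_form_linear by (auto simp: dual_basis_def q)
qed

lemma quotient_rank:
  assumes "g \<in> carrier G"
  shows "hs_rank (group_ring G) Q g = of_nat (card (invariants S \<phi> g)) / 2 / of_nat (card (carrier G))"
proof -
  have "hs_rank (group_ring G) Q g = (\<Sum>e\<in>S. quotient_form e (W +>\<^bsub>P\<^esub> single class_ring e) g)"
    unfolding Q.hs_rank_eq[OF group_ring_nontrivial quotient_dual_basis]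
    by (intro group_ring_finsum_apply) (use dual_basisD(2,4)[OF quotient_dual_basis] in auto)
  also have "\<dots> = (\<Sum>e\<in>S. if \<phi> g e = e then 1 / 2 / of_nat (card (carrier G)) else 0)"
  proof (intro sum.cong refl)
    fix e assume e: "e \<in> S"
    \<comment> \<open>An element g carrying e to \<iota> e would contribute with a negative sign.
      Excluding this leaves a pure fixed point count.\<close>
    have "\<iota> (\<phi> g e) \<noteq> e"
      using not_inverted[OF assms \<iota>_closed[OF e]] e assms by (auto simp: \<iota>_equivariant \<iota>_\<iota>)
    then show "quotient_form e (W +>\<^bsub>P\<^esub> single class_ring e) g
        = (if \<phi> g e = e then 1 / 2 / of_nat (card (carrier G)) else 0)"
      using assms e single_perm_closed
      by (simp add: quotient_form_coset alternating_form_def single_class_ring)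
  qed
  also have "\<dots> = of_nat (card (invariants S \<phi> g)) / 2 / of_nat (card (carrier G))"
    using finite_set by (simp add: invariants_def sum.If_cases Int_def)
  finally show ?thesis .
qed

end

section \<open>Artin representations\<close>

lemma (in Module.module) coords_self:
  assumes B: "finite_basis R M B" and b: "b \<in> B"
  shows "coords R M B b b = \<one>\<^bsub>R\<^esub>"
proof -
  have fin: "finite B" and BM: "B \<subseteq> carrier M"
    using B by (auto simp: finite_basis_def)
  let ?c = "\<lambda>v\<in>B. if b = v then \<one>\<^bsub>R\<^esub> else \<zero>\<^bsub>R\<^esub>"
  have "lincomb ?c B = (\<Oplus>\<^bsub>M\<^esub>v\<in>B. if b = v then v else \<zero>\<^bsub>M\<^esub>)"
    unfolding lincomb_def using BM by (intro M.finsum_cong') auto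
  also have "\<dots> = b" using b fin BM by (intro M.finsum_singleton) auto
  finally have "coords R M B b = ?c"
    using b BM by (intro coords_works(3)[OF B]) auto
  then show ?thesis using b by simp
qed

text \<open>The dimension is the trace of the identity: each vector of a basis contributes 1, and
  every dual basis gives the same trace. The vectors of the dual basis span, which provides the
  finite basis to compare with.\<close>

lemma dim_eq_trace:
  fixes K :: "(complex, 'w, 'y) module_scheme"
  assumes "vectorspace class_ring K" and x: "dual_basis class_ring K I x \<phi>"
  shows "of_nat (vectorspace.dim class_ring K) = (\<Sum>i\<in>I. \<phi> i (x i))"
proof -
  interpret vectorspace class_ring K by fact
  note xD = dual_basisD[OF x]
  have XM: "x ` I \<subseteq> carrier K" using xD(2) by auto
  note sub = span_is_submodule[OF XM]
  have "m \<in> span (x ` I)" if m: "m \<in> carrier K" for m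
  proof -
    have "(\<Oplus>\<^bsub>K\<^esub>i\<in>I. \<phi> i m \<odot>\<^bsub>K\<^esub> x i) \<in> span (x ` I)"
      using in_own_span[OF XM]
      by (intro submodule_finsum_closed[OF sub] funcsetI LinearCombinations.submodule.smult_closed[OF sub])
        auto
    then show ?thesis using xD(5)[OF m] by simp
  qed
  then have "gen_set (x ` I)" using LinearCombinations.submodule.subset[OF sub] by auto
  then have "fin_dim" using xD(1) XM by (auto simp: fin_dim_def)
  then obtain B where B: "finite B" "basis B" using finite_basis_exists by auto
  then have fb: "finite_basis class_ring K B" by (auto simp: finite_basis_def basis_def)
  have "(\<lambda>m. m) \<in> LinearCombinations.module_hom class_ring K K"
    by (auto simp: LinearCombinations.module_hom_def)
  from dual_basis_trace_unique[OF x finite_basis_dual_basis[OF fb] this]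
  have "(\<Sum>i\<in>I. \<phi> i (x i)) = (\<Sum>b\<in>B. coords class_ring K B b b)"
    by (simp add: class_ring_simps)
  also have "\<dots> = (\<Sum>b\<in>B. 1)"
    using coords_self[OF fb] by (intro sum.cong) auto
  also have "\<dots> = of_nat (vectorspace.dim class_ring K)"
    using dim_basis[OF B] by simp
  finally show "of_nat (vectorspace.dim class_ring K) = (\<Sum>i\<in>I. \<phi> i (x i))" by simp
qed

text \<open>Restriction of scalars keeps the additive structure, and finite sums depend on nothing
  else.\<close>

lemma finsum_complex_space: "finsum (complex_space G M) = finsum M"
  by (simp add: complex_space_def finsum_def finprod_def fun_eq_iff)

context finite_comm_group
begin

abbreviation cscal :: "complex \<Rightarrow> 'a \<Rightarrow> complex" where
  "cscal z \<equiv> (\<lambda>g. z * single class_ring \<one> g)"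

lemma complex_space_sel [simp]:
  "carrier (complex_space G M) = carrier M"
  "\<zero>\<^bsub>complex_space G M\<^esub> = \<zero>\<^bsub>M\<^esub>"
  "m \<oplus>\<^bsub>complex_space G M\<^esub> m' = m \<oplus>\<^bsub>M\<^esub> m'"
  "z \<odot>\<^bsub>complex_space G M\<^esub> m = cscal z \<odot>\<^bsub>M\<^esub> m"
  by (simp_all add: complex_space_def)

lemma cscal_closed [simp]: "cscal z \<in> carrier (group_ring G)"
  by (auto simp: group_ring_carrier_iff single_class_ring)

lemma cscal_mult:
  assumes "a \<in> carrier (group_ring G)"
  shows "cscal z \<otimes>\<^bsub>group_ring G\<^esub> a = (\<lambda>x. z * a x)"
proof
  fix x
  have "(\<Sum>y\<in>carrier G. cscal z y * a (inv y \<otimes> x))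
      = (\<Sum>y\<in>carrier G. if y = \<one> then z * a (inv y \<otimes> x) else 0)"
    by (intro sum.cong) (auto simp: single_class_ring)
  also have "\<dots> = z * a (inv \<one> \<otimes> x)" using finite_carrier by (simp add: sum.delta)
  finally show "(cscal z \<otimes>\<^bsub>group_ring G\<^esub> a) x = z * a x"
    using assms by (auto simp: group_ring_mult group_ring_carrier_iff)
qed

lemma vectorspace_complex_space:
  assumes "module (group_ring G) M"
  shows "vectorspace class_ring (complex_space G M)"
proof -
  interpret M: Module.module "group_ring G" M by fact
  have add: "cscal (z + w) = cscal z \<oplus>\<^bsub>group_ring G\<^esub> cscal w" for z w
    by (simp add: distrib_right)
  have mult: "cscal (z * w) = cscal z \<otimes>\<^bsub>group_ring G\<^esub> cscal w" for z w
    unfolding cscal_mult[OF cscal_closed] by (simp add: mult.assoc)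
  have one: "cscal 1 = \<one>\<^bsub>group_ring G\<^esub>" by simp
  have "module class_ring (complex_space G M)"
  proof (rule module_criteria)
    show "\<forall>v\<in>carrier (complex_space G M). \<exists>w\<in>carrier (complex_space G M).
        v \<oplus>\<^bsub>complex_space G M\<^esub> w = \<zero>\<^bsub>complex_space G M\<^esub>"
      by (auto intro!: bexI[of _ "\<ominus>\<^bsub>M\<^esub> _"] simp: M.M.r_neg)
    show "\<forall>a b v. a \<in> carrier class_ring \<and> b \<in> carrier class_ring \<and> v \<in> carrier (complex_space G M) \<longrightarrow>
        (a \<otimes>\<^bsub>class_ring\<^esub> b) \<odot>\<^bsub>complex_space G M\<^esub> v
          = a \<odot>\<^bsub>complex_space G M\<^esub> (b \<odot>\<^bsub>complex_space G M\<^esub> v)"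
      by (simp add: mult M.smult_assoc1)
    show "\<forall>a b v. a \<in> carrier class_ring \<and> b \<in> carrier class_ring \<and> v \<in> carrier (complex_space G M) \<longrightarrow>
        (a \<oplus>\<^bsub>class_ring\<^esub> b) \<odot>\<^bsub>complex_space G M\<^esub> v
          = a \<odot>\<^bsub>complex_space G M\<^esub> v \<oplus>\<^bsub>complex_space G M\<^esub> b \<odot>\<^bsub>complex_space G M\<^esub> v"
      using M.smult_l_distr[OF cscal_closed cscal_closed] add by simp
    show "\<forall>v\<in>carrier (complex_space G M). \<one>\<^bsub>class_ring\<^esub> \<odot>\<^bsub>complex_space G M\<^esub> v = v"
      using M.smult_one one by (simp del: group_ring_sel)
    show "cring (class_ring :: complex ring)" by (rule class_cring.is_cring)
    show "\<forall>v w. v \<in> carrier (complex_space G M) \<and> w \<in> carrier (complex_space G M) \<longrightarrow>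
        v \<oplus>\<^bsub>complex_space G M\<^esub> w = w \<oplus>\<^bsub>complex_space G M\<^esub> v"
      by (simp add: M.M.a_comm)
  qed (auto simp: M.M.a_assoc M.smult_r_distr)
  then show ?thesis by (simp add: vectorspace_def class_field)
qed

lemma smult_hom:
  assumes "module (group_ring G) M" "a \<in> carrier (group_ring G)"
  shows "(\<lambda>m. a \<odot>\<^bsub>M\<^esub> m) \<in> LinearCombinations.module_hom (group_ring G) M M"
proof -
  interpret M: Module.module "group_ring G" M by fact
  show ?thesis using assms(2)
    by (auto simp: LinearCombinations.module_hom_def M.smult_r_distr M.smult_assoc1[symmetric] group_ring_comm[of a])
qed

lemma module_hom_complex_space:
  "T \<in> LinearCombinations.module_hom (group_ring G) M N \<Longrightarrow>
   T \<in> LinearCombinations.module_hom class_ring (complex_space G M) (complex_space G N)"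
  by (auto simp: LinearCombinations.module_hom_def)

lemma linear_form_complex_finsum:
  assumes "module (group_ring G) M" "\<xi> \<in> linear_forms class_ring (complex_space G M)"
    and "f \<in> I \<rightarrow> carrier M"
  shows "\<xi> (\<Oplus>\<^bsub>M\<^esub>i\<in>I. f i) = (\<Sum>i\<in>I. \<xi> (f i))"
proof -
  interpret vectorspace class_ring "complex_space G M" by (rule vectorspace_complex_space[OF assms(1)])
  show ?thesis
    using linear_form_finsum[OF assms(2), of f I] assms(3)
    by (simp add: finsum_complex_space class_ring_simps)
qed

text \<open>The expansion of a as \<Sum> a(g) g, with the complex coefficients entering through
  \<open>cscal\<close>. It reduces the action of the group ring to complex scalars and translates of
  m.\<close>

lemma group_ring_smult_decomp:
  assumes "module (group_ring G) M" and a: "a \<in> carrier (group_ring G)" and m: "m \<in> carrier M"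
  shows "a \<odot>\<^bsub>M\<^esub> m = (\<Oplus>\<^bsub>M\<^esub>g\<in>carrier G. cscal (a g) \<odot>\<^bsub>M\<^esub> (single class_ring g \<odot>\<^bsub>M\<^esub> m))"
proof -
  interpret M: Module.module "group_ring G" M by fact
  let ?t = "\<lambda>g. cscal (a g) \<otimes>\<^bsub>group_ring G\<^esub> single class_ring g"
  have t: "?t \<in> carrier G \<rightarrow> carrier (group_ring G)"
    by (intro funcsetI GR.m_closed cscal_closed single_group_ring_closed)
  have "(\<Oplus>\<^bsub>group_ring G\<^esub>g\<in>carrier G. ?t g) = a"
  proof
    fix x
    have "(\<Oplus>\<^bsub>group_ring G\<^esub>g\<in>carrier G. ?t g) x = (\<Sum>g\<in>carrier G. if g = x then a g else 0)"
      unfolding group_ring_finsum_apply[OF t]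
      by (intro sum.cong) (auto simp: cscal_mult single_group_ring_closed, auto simp: single_class_ring)
    then show "(\<Oplus>\<^bsub>group_ring G\<^esub>g\<in>carrier G. ?t g) x = a x"
      using a finite_carrier by (auto simp: sum.delta group_ring_carrier_iff)
  qed
  then have "a \<odot>\<^bsub>M\<^esub> m = (\<Oplus>\<^bsub>M\<^esub>g\<in>carrier G. ?t g \<odot>\<^bsub>M\<^esub> m)"
    using M.finsum_smult_r[OF m t] by simp
  also have "\<dots> = (\<Oplus>\<^bsub>M\<^esub>g\<in>carrier G. cscal (a g) \<odot>\<^bsub>M\<^esub> (single class_ring g \<odot>\<^bsub>M\<^esub> m))"
    using m by (intro M.M.finsum_cong')
      (auto simp: M.smult_assoc1[OF cscal_closed single_group_ring_closed] single_group_ring_closed)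
  finally show ?thesis .
qed

text \<open>If \<open>S\<close> generates V over the group ring, then the finitely many translates g
  s with s in \<open>S\<close> span V over the complex numbers.\<close>

lemma artin_finite_basis:
  assumes "artin_representation G V"
  shows "\<exists>B. finite_basis class_ring (complex_space G V) B"
proof -
  have V: "module (group_ring G) V" and fg: "finitely_generated (group_ring G) V"
    using assms by (auto simp: artin_representation_def)
  interpret V: Module.module "group_ring G" V by (rule V)
  interpret C: vectorspace class_ring "complex_space G V" by (rule vectorspace_complex_space[OF V])
  obtain S where S: "finite S" "S \<subseteq> carrier V" "V.span S = carrier V"
    using fg by (auto simp: finitely_generated_def)
  define A where "A = (\<lambda>(g, s). single class_ring g \<odot>\<^bsub>V\<^esub> s) ` (carrier G \<times> S)"
  have A: "finite A" "A \<subseteq> carrier (complex_space G V)"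
    unfolding A_def using S finite_carrier single_group_ring_closed by auto
  note sub = C.span_is_submodule[OF A(2)]
  have gs: "single class_ring g \<odot>\<^bsub>V\<^esub> s \<in> C.span A" if "g \<in> carrier G" "s \<in> S" for g s
    using C.in_own_span[OF A(2)] that by (auto simp: A_def)
  have as: "a \<odot>\<^bsub>V\<^esub> s \<in> C.span A" if a: "a \<in> carrier (group_ring G)" and s: "s \<in> S" for a s
  proof -
    have "(\<Oplus>\<^bsub>complex_space G V\<^esub>g\<in>carrier G. a g \<odot>\<^bsub>complex_space G V\<^esub> (single class_ring g \<odot>\<^bsub>V\<^esub> s)) \<in> C.span A"
      using s gs
      by (intro C.submodule_finsum_closed[OF sub] funcsetI LinearCombinations.submodule.smult_closed[OF sub]) auto
    then show ?thesis
      using group_ring_smult_decomp[OF V a] s S(2) by (auto simp: finsum_complex_space)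
  qed
  have "v \<in> C.span A" if v: "v \<in> carrier V" for v
  proof -
    obtain a where a: "a \<in> S \<rightarrow> carrier (group_ring G)" "v = V.lincomb a S"
      using v V.finite_span[OF S(1,2)] S(3) by auto
    have "(\<Oplus>\<^bsub>complex_space G V\<^esub>s\<in>S. a s \<odot>\<^bsub>V\<^esub> s) \<in> C.span A"
      using a as by (intro C.submodule_finsum_closed[OF sub]) auto
    then show ?thesis using a by (simp add: V.lincomb_def finsum_complex_space)
  qed
  then have "C.fin_dim"
    using A LinearCombinations.submodule.subset[OF sub] by (auto simp: C.fin_dim_def)
  then obtain B where "finite B" "C.basis B" using C.finite_basis_exists by auto
  then show ?thesis by (auto simp: finite_basis_def C.basis_def)
qed

lemma artin_character_eq:
  assumes V: "artin_representation G V" and v: "dual_basis class_ring (complex_space G V) K v \<xi>"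
    and a: "a \<in> carrier (group_ring G)"
  shows "artin_character G V a = (\<Sum>k\<in>K. \<xi> k (a \<odot>\<^bsub>V\<^esub> v k))"
proof -
  have M: "module (group_ring G) V" using V by (simp add: artin_representation_def)
  interpret C: vectorspace class_ring "complex_space G V" by (rule vectorspace_complex_space[OF M])
  obtain B where "finite_basis class_ring (complex_space G V) B" using artin_finite_basis[OF V] ..
  from C.free_trace_eq[OF this v module_hom_complex_space[OF smult_hom[OF M a]]]
  show ?thesis by (simp add: artin_character_def class_ring_simps)
qed

lemma artin_dual_basis:
  fixes V :: "('a \<Rightarrow> complex, 'w, 'y) module_scheme"
  assumes "artin_representation G V"
  obtains K and v :: "'w \<Rightarrow> 'w" and \<xi> where "dual_basis class_ring (complex_space G V) K v \<xi>"
proof -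
  have M: "module (group_ring G) V" using assms by (simp add: artin_representation_def)
  interpret C: vectorspace class_ring "complex_space G V" by (rule vectorspace_complex_space[OF M])
  show ?thesis using artin_finite_basis[OF assms] C.finite_basis_dual_basis that by metis
qed

text \<open>In a fixed dual basis each diagonal term \<xi>_k(a v_k) is additive in a. This is how
  the character passes through the sum that computes a rank.\<close>

lemma artin_character_finsum:
  fixes V :: "('a \<Rightarrow> complex, 'w, 'y) module_scheme"
  assumes V: "artin_representation G V" and a: "a \<in> I \<rightarrow> carrier (group_ring G)"
  shows "artin_character G V (\<Oplus>\<^bsub>group_ring G\<^esub>i\<in>I. a i) = (\<Sum>i\<in>I. artin_character G V (a i))"
proof -
  have M: "module (group_ring G) V" using V by (simp add: artin_representation_def)
  interpret V: Module.module "group_ring G" V by (rule M)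
  obtain K and v :: "'w \<Rightarrow> 'w" and \<xi> where v: "dual_basis class_ring (complex_space G V) K v \<xi>"
    using artin_dual_basis[OF V] .
  have vV: "v k \<in> carrier V" if "k \<in> K" for k using dual_basisD(2)[OF v that] by simp
  have "\<xi> k ((\<Oplus>\<^bsub>group_ring G\<^esub>i\<in>I. a i) \<odot>\<^bsub>V\<^esub> v k) = (\<Sum>i\<in>I. \<xi> k (a i \<odot>\<^bsub>V\<^esub> v k))" if "k \<in> K" for k
    unfolding V.finsum_smult_r[OF vV[OF that] a]
    using a vV[OF that] by (intro linear_form_complex_finsum[OF M dual_basisD(3)[OF v that]]) auto
  then show ?thesis
    using a by (simp add: artin_character_eq[OF V v] Pi_iff cong: sum.cong) (rule sum.swap)
qed

text \<open>Since the v_k \<otimes> x_i may be dependent, no basis of the tensor product is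
  extracted from them. All that has to be shown is that the expansion along them reproduces every
  tensor.\<close>

lemma complex_dim_tensor_product:
  fixes V :: "('a \<Rightarrow> complex, 'w, 'y) module_scheme" and M :: "('a \<Rightarrow> complex, 'q, 'z) module_scheme"
  assumes V: "artin_representation G V" and M: "module (group_ring G) M"
    and x: "dual_basis (group_ring G) M I x \<phi>"
  shows "of_nat (complex_dim G (tensor_product (group_ring G) V M))
    = artin_character G V (hs_rank (group_ring G) M)"
proof -
  have MV: "module (group_ring G) V" using V by (simp add: artin_representation_def)
  interpret module_pair "group_ring G" V M using M MV by (simp add: module_pair_def)
  obtain K and v :: "'w \<Rightarrow> 'w" and \<xi> where v: "dual_basis class_ring (complex_space G V) K v \<xi>"
    using artin_dual_basis[OF V] .
  note xD = dual_basisD[OF x] and vD = dual_basisD[OF v, simplified]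
  \<comment> \<open>Contraction with \<phi>_i, that is w \<otimes> m \<mapsto> \<phi>_i(m) w,
    obtained from the universal property.\<close>
  have "\<exists>L. L \<in> LinearCombinations.module_hom (group_ring G) T V \<and>
      (\<forall>w\<in>carrier V. \<forall>m\<in>carrier M. L (pure_tensor w m) = \<phi> i m \<odot>\<^bsub>V\<^esub> w)" if i: "i \<in> I" for i
  proof -
    note \<phi>i = linear_formsD[OF xD(3)[OF i]]
    show ?thesis
    proof (rule tensor_lift[OF MV, of "\<lambda>w m. \<phi> i m \<odot>\<^bsub>V\<^esub> w"])
      show "(\<lambda>w. \<phi> i m \<odot>\<^bsub>V\<^esub> w) \<in> LinearCombinations.module_hom (group_ring G) V V" if "m \<in> carrier M" for m
        using that \<phi>i(1) by (intro smult_hom[OF MV])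
      show "(\<lambda>m. \<phi> i m \<odot>\<^bsub>V\<^esub> w) \<in> LinearCombinations.module_hom (group_ring G) M V" if "w \<in> carrier V" for w
        using that \<phi>i
        by (auto simp: LinearCombinations.module_hom_def M.smult_l_distr M.smult_assoc1 simp del: group_ring_sel)
    qed blast
  qed
  then obtain L where L: "\<And>i. i \<in> I \<Longrightarrow> L i \<in> LinearCombinations.module_hom (group_ring G) T V"
    and Lp: "\<And>i w m. \<lbrakk>i \<in> I; w \<in> carrier V; m \<in> carrier M\<rbrakk> \<Longrightarrow> L i (pure_tensor w m) = \<phi> i m \<odot>\<^bsub>V\<^esub> w"
    by metis
  have Lc: "L i z \<in> carrier V" if "i \<in> I" "z \<in> carrier T" for i z
    using LinearCombinations.module_hom_closed[OF L[OF that(1)]] that(2) by auto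
  interpret CT: vectorspace class_ring "complex_space G T" by (rule vectorspace_complex_space[OF T.module_axioms])
  \<comment> \<open>\<open>E\<close> re-expands a tensor along the x_i. On w \<otimes> m the scalars
    \<phi>_i(m) move to the right factor, where the dual basis identity of M restores m.\<close>
  define E where "E = (\<lambda>z. \<Oplus>\<^bsub>T\<^esub>i\<in>I. pure_tensor (L i z) (x i))"
  have E_pure: "E (pure_tensor w m) = pure_tensor w m" if w: "w \<in> carrier V" and m: "m \<in> carrier M" for w m
  proof -
    have "E (pure_tensor w m) = (\<Oplus>\<^bsub>T\<^esub>i\<in>I. pure_tensor w (\<phi> i m \<odot>\<^bsub>M\<^esub> x i))"
      unfolding E_def using w m xD(2,4)
      by (intro T.M.finsum_cong') (auto simp: Lp pure_tensor_smult_left pure_tensor_smult_right)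
    also have "\<dots> = pure_tensor w (\<Oplus>\<^bsub>M\<^esub>i\<in>I. \<phi> i m \<odot>\<^bsub>M\<^esub> x i)"
      using w m xD(2,4)
      by (intro module_hom_finsum[symmetric, OF M T.module_axioms pure_tensor_hom_right]) auto
    also have "\<dots> = pure_tensor w m" using xD(5)[OF m] by simp
    finally show ?thesis .
  qed
  have E_id: "E z = z" if z: "z \<in> carrier T" for z
  proof -
    obtain A g where A: "finite A" "g \<in> A \<rightarrow> carrier V \<times> carrier M"
      and zA: "z = (\<Oplus>\<^bsub>T\<^esub>p\<in>(A :: ('w \<times> 'q) set). pure_tensor (fst (g p)) (snd (g p)))"
      using tensor_sum_of_pure[OF z] .
    have g: "fst (g p) \<in> carrier V" "snd (g p) \<in> carrier M" if "p \<in> A" for p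
      using Pi_mem[OF A(2) that] by (auto simp: mem_Times_iff)
    have "E \<in> LinearCombinations.module_hom (group_ring G) T T"
      unfolding LinearCombinations.module_hom_def
    proof (intro CollectI conjI allI impI funcsetI)
      fix y assume "y \<in> carrier T"
      then show "E y \<in> carrier T" unfolding E_def using Lc xD(2) by (intro T.M.finsum_closed) auto
    next
      fix y y' assume y: "y \<in> carrier T \<and> y' \<in> carrier T"
      have "E (y \<oplus>\<^bsub>T\<^esub> y') = (\<Oplus>\<^bsub>T\<^esub>i\<in>I. pure_tensor (L i y) (x i) \<oplus>\<^bsub>T\<^esub> pure_tensor (L i y') (x i))"
        unfolding E_def using y Lc xD(2)
        by (intro T.M.finsum_cong') (auto simp: LinearCombinations.module_hom_add[OF L] pure_tensor_add_left)
      also have "\<dots> = E y \<oplus>\<^bsub>T\<^esub> E y'"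
        unfolding E_def using y Lc xD(2) by (intro T.M.finsum_addf) auto
      finally show "E (y \<oplus>\<^bsub>T\<^esub> y') = E y \<oplus>\<^bsub>T\<^esub> E y'" .
    next
      fix a y assume y: "a \<in> carrier (group_ring G) \<and> y \<in> carrier T"
      have "E (a \<odot>\<^bsub>T\<^esub> y) = (\<Oplus>\<^bsub>T\<^esub>i\<in>I. a \<odot>\<^bsub>T\<^esub> pure_tensor (L i y) (x i))"
        unfolding E_def using y Lc xD(2)
        by (intro T.M.finsum_cong') (auto simp: LinearCombinations.module_hom_smult[OF L] pure_tensor_smult_left)
      also have "\<dots> = a \<odot>\<^bsub>T\<^esub> E y"
        unfolding E_def using y Lc xD(2) by (intro T.finsum_smult[symmetric]) auto
      finally show "E (a \<odot>\<^bsub>T\<^esub> y) = a \<odot>\<^bsub>T\<^esub> E y" .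
    qed
    then have "E z = (\<Oplus>\<^bsub>T\<^esub>p\<in>A. E (pure_tensor (fst (g p)) (snd (g p))))"
      unfolding zA using g by (intro module_hom_finsum[OF T.module_axioms T.module_axioms]) auto
    also have "\<dots> = z"
      unfolding zA using g by (intro T.M.finsum_cong') (auto simp: E_pure)
    finally show ?thesis .
  qed
  have db: "dual_basis class_ring (complex_space G T) (I \<times> K)
      (\<lambda>(i, k). pure_tensor (v k) (x i)) (\<lambda>(i, k) z. \<xi> k (L i z))"
    unfolding dual_basis_def
  proof (intro conjI ballI funcsetI)
    show "finite (I \<times> K)" using xD(1) vD(1) by simp
    fix p assume "p \<in> I \<times> K"
    then obtain i k where p: "p = (i, k)" "i \<in> I" "k \<in> K" by auto
    show "(case p of (i, k) \<Rightarrow> pure_tensor (v k) (x i)) \<in> carrier (complex_space G T)"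
      using p xD(2) vD(2) by simp
    show "(case p of (i, k) \<Rightarrow> (\<lambda>z. \<xi> k (L i z))) \<in> linear_forms class_ring (complex_space G T)"
      using p L Lc linear_formsD[OF vD(3)[OF p(3)]]
        LinearCombinations.module_hom_add[OF L] LinearCombinations.module_hom_smult[OF L]
      by (auto simp: linear_forms_def)
  next
    fix z assume "z \<in> carrier (complex_space G T)"
    then have z: "z \<in> carrier T" by simp
    let ?t = "\<lambda>i k. cscal (\<xi> k (L i z)) \<odot>\<^bsub>T\<^esub> pure_tensor (v k) (x i)"
    have t: "?t i k \<in> carrier T" if "i \<in> I" "k \<in> K" for i k using that xD(2) vD(2) by simp
    have "(\<Oplus>\<^bsub>T\<^esub>k\<in>K. ?t i k) = pure_tensor (L i z) (x i)" if i: "i \<in> I" for i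
    proof -
      have "(\<Oplus>\<^bsub>T\<^esub>k\<in>K. ?t i k) = (\<Oplus>\<^bsub>T\<^esub>k\<in>K. pure_tensor (cscal (\<xi> k (L i z)) \<odot>\<^bsub>V\<^esub> v k) (x i))"
        using i xD(2) vD(2) by (intro T.M.finsum_cong') (auto simp: pure_tensor_smult_left)
      also have "\<dots> = pure_tensor (\<Oplus>\<^bsub>V\<^esub>k\<in>K. cscal (\<xi> k (L i z)) \<odot>\<^bsub>V\<^esub> v k) (x i)"
        using i xD(2) vD(2)
        by (intro module_hom_finsum[symmetric, OF MV T.module_axioms pure_tensor_hom_left]) auto
      also have "(\<Oplus>\<^bsub>V\<^esub>k\<in>K. cscal (\<xi> k (L i z)) \<odot>\<^bsub>V\<^esub> v k) = L i z"
        using vD(5)[OF Lc[OF i z]] by (simp add: finsum_complex_space)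
      finally show ?thesis .
    qed
    then have "E z = (\<Oplus>\<^bsub>T\<^esub>i\<in>I. \<Oplus>\<^bsub>T\<^esub>k\<in>K. ?t i k)"
      unfolding E_def using Lc[OF _ z] xD(2) by (intro T.M.finsum_cong') auto
    also have "\<dots> = (\<Oplus>\<^bsub>T\<^esub>p\<in>I \<times> K. case p of (i, k) \<Rightarrow> ?t i k)"
      using t xD(1) vD(1) by (subst T.M.add.finprod_finprod) auto
    finally show "(\<Oplus>\<^bsub>complex_space G T\<^esub>p\<in>I \<times> K. (case p of (i, k) \<Rightarrow> \<lambda>z. \<xi> k (L i z)) z
        \<odot>\<^bsub>complex_space G T\<^esub> (case p of (i, k) \<Rightarrow> pure_tensor (v k) (x i))) = z"
      using E_id[OF z] by (simp add: finsum_complex_space case_prod_beta)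
  qed
  have "of_nat (complex_dim G T) = (\<Sum>(i, k)\<in>I \<times> K. \<xi> k (L i (pure_tensor (v k) (x i))))"
    unfolding complex_dim_def
    using dim_eq_trace[OF CT.vectorspace_axioms db] by (simp add: case_prod_beta)
  also have "\<dots> = (\<Sum>i\<in>I. \<Sum>k\<in>K. \<xi> k (L i (pure_tensor (v k) (x i))))"
    by (simp add: sum.cartesian_product)
  \<comment> \<open>As \<open>L i\<close> maps v_k \<otimes> x_i to \<phi>_i(x_i) v_k, the inner sum
    over k is the trace of the group ring element \<phi>_i(x_i) on V.\<close>
  also have "\<dots> = (\<Sum>i\<in>I. artin_character G V (\<phi> i (x i)))"
    using xD(2,4) vD(2) by (intro sum.cong) (auto simp: artin_character_eq[OF V v] Lp)
  also have "\<dots> = artin_character G V (hs_rank (group_ring G) M)"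
    unfolding N.hs_rank_eq[OF group_ring_nontrivial x]
    using xD(2,4) by (intro artin_character_finsum[symmetric, OF V]) auto
  finally show ?thesis .
qed

end

section \<open>Irreducible representations of a finite abelian group\<close>

lemma primitive_root_of_unity_exists:
  assumes "n > 0"
  shows "\<exists>\<omega> :: complex. \<omega> ^ n = 1 \<and> (\<forall>k. 0 < k \<and> k < n \<longrightarrow> \<omega> ^ k \<noteq> 1)"
proof (intro exI conjI allI impI)
  let ?\<omega> = "cis (2 * pi * real 1 / real n)"
  have pow: "?\<omega> ^ k = cis (2 * pi * real k / real n)" for k
    by (simp add: DeMoivre mult.commute)
  show "?\<omega> ^ n = 1" unfolding pow using assms by simp
  show "?\<omega> ^ k \<noteq> 1" if "0 < k \<and> k < n" for k
  proof
    assume "?\<omega> ^ k = 1"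
    then have "cis (2 * pi * real k / real n) = cis (2 * pi * real 0 / real n)" unfolding pow by simp
    moreover have inj: "inj_on (\<lambda>k. cis (2 * pi * real k / real n)) {..<n}"
      using bij_betw_roots_unity[OF assms] by (simp add: bij_betw_def)
    ultimately have "k = 0" using that assms inj_onD[OF inj, of k 0] by auto
    with that show False by simp
  qed
qed

context finite_comm_group
begin

lemma single_mult:
  assumes "g \<in> carrier G"
  shows "single class_ring g \<otimes>\<^bsub>group_ring G\<^esub> a = (\<lambda>x. if x \<in> carrier G then a (inv g \<otimes> x) else 0)"
proof
  fix x
  have "(\<Sum>y\<in>carrier G. single class_ring g y * a (inv y \<otimes> x))
      = (\<Sum>y\<in>carrier G. if y = g then a (inv y \<otimes> x) else 0)"
    by (intro sum.cong) (auto simp: single_class_ring)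
  also have "\<dots> = a (inv g \<otimes> x)" using finite_carrier assms by (simp add: sum.delta)
  finally show "(single class_ring g \<otimes>\<^bsub>group_ring G\<^esub> a) x = (if x \<in> carrier G then a (inv g \<otimes> x) else 0)"
    by (simp add: group_ring_mult)
qed

lemma single_mult_single:
  assumes "g \<in> carrier G" "h \<in> carrier G"
  shows "single class_ring g \<otimes>\<^bsub>group_ring G\<^esub> single class_ring h = single class_ring (g \<otimes> h)"
proof -
  have "inv g \<otimes> x = h \<longleftrightarrow> x = g \<otimes> h" if "x \<in> carrier G" for x
    using assms that inv_solve_left[of h g x] by auto
  then show ?thesis
    unfolding single_mult[OF assms(1)] using assms by (auto simp: fun_eq_iff single_class_ring)
qed

lemma cscal_smult_eq_zero:
  assumes "module (group_ring G) V" "v \<in> carrier V" "v \<noteq> \<zero>\<^bsub>V\<^esub>" "cscal z \<odot>\<^bsub>V\<^esub> v = \<zero>\<^bsub>V\<^esub>"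
  shows "z = 0"
proof (rule ccontr)
  assume z: "z \<noteq> 0"
  interpret C: vectorspace class_ring "complex_space G V" by (rule vectorspace_complex_space[OF assms(1)])
  have "v = (inverse z * z) \<odot>\<^bsub>complex_space G V\<^esub> v" using z C.smult_one[of v] assms(2) by simp
  also have "\<dots> = inverse z \<odot>\<^bsub>complex_space G V\<^esub> (z \<odot>\<^bsub>complex_space G V\<^esub> v)"
    using C.smult_assoc1[of "inverse z" z v] assms(2) by simp
  also have "\<dots> = \<zero>\<^bsub>V\<^esub>" using assms(4) C.smult_r_null[of "inverse z"] by simp
  finally show False using assms(3) by simp
qed

lemma cscal_smult_inj:
  assumes "module (group_ring G) V" "v \<in> carrier V" "v \<noteq> \<zero>\<^bsub>V\<^esub>"
    "cscal z \<odot>\<^bsub>V\<^esub> v = cscal z' \<odot>\<^bsub>V\<^esub> v"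
  shows "z = z'"
proof -
  interpret V: Module.module "group_ring G" V by fact
  interpret C: vectorspace class_ring "complex_space G V" by (rule vectorspace_complex_space[OF assms(1)])
  have "cscal (z - z') \<odot>\<^bsub>V\<^esub> v \<oplus>\<^bsub>V\<^esub> cscal z' \<odot>\<^bsub>V\<^esub> v = cscal z \<odot>\<^bsub>V\<^esub> v"
    using C.smult_l_distr[of "z - z'" z' v] assms(2) by simp
  then have "cscal (z - z') \<odot>\<^bsub>V\<^esub> v = \<zero>\<^bsub>V\<^esub>"
    using assms(2,4) V.smult_closed[OF cscal_closed] V.M.add.r_cancel_one' by metis
  then show ?thesis using cscal_smult_eq_zero[OF assms(1-3)] by force
qed

text \<open>With n = |G| and \<omega> a primitive n-th root of unity, the elements p_j = n^-1
  \<Sum>_k \<omega>^(jk) g^k sum to 1 and satisfy g p_j = \<omega>^(-j) p_j. Hence v is the sum of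
  the p_j v, and any nonzero one among them is an eigenvector. This explicit decomposition takes the
  place of a characteristic polynomial.\<close>

lemma exists_eigenvector:
  assumes M: "module (group_ring G) V" and g: "g \<in> carrier G" and v: "v \<in> carrier V" "v \<noteq> \<zero>\<^bsub>V\<^esub>"
  obtains c w where "w \<in> carrier V" "w \<noteq> \<zero>\<^bsub>V\<^esub>" "single class_ring g \<odot>\<^bsub>V\<^esub> w = cscal c \<odot>\<^bsub>V\<^esub> w"
proof -
  interpret V: Module.module "group_ring G" V by (rule M)
  define n where "n = card (carrier G)"
  have n: "n > 0" unfolding n_def using finite_carrier one_closed by (auto simp: card_gt_0_iff)
  have gn: "g [^] n = \<one>" unfolding n_def using power_order_eq_one[OF finite_carrier g] by simp
  obtain \<omega> :: complex where \<omega>n: "\<omega> ^ n = 1" and \<omega>k: "\<And>k. \<lbrakk>0 < k; k < n\<rbrakk> \<Longrightarrow> \<omega> ^ k \<noteq> 1"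
    using primitive_root_of_unity_exists[OF n] by auto
  have \<omega>0: "\<omega> \<noteq> 0" using \<omega>n n by (auto simp: power_0_left)
  have \<omega>pow: "(\<omega> ^ k) ^ n = 1" for k
    by (metis \<omega>n mult.commute power_mult power_one)
  \<comment> \<open>the spectral idempotents of the cyclic group generated by \<open>g\<close>\<close>
  define p where "p = (\<lambda>j x. (\<Sum>k<n. if x = g [^] k then (\<omega> ^ j) ^ k else 0) / of_nat n)"
  have p: "p j \<in> carrier (group_ring G)" for j
    using g by (auto simp: group_ring_carrier_iff p_def intro!: sum.neutral)
  have sum_p: "(\<Oplus>\<^bsub>group_ring G\<^esub>j\<in>{..<n}. p j) = single class_ring \<one>"
  proof
    fix x
    have "(\<Oplus>\<^bsub>group_ring G\<^esub>j\<in>{..<n}. p j) x = (\<Sum>j<n. p j x)"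
      using p by (intro group_ring_finsum_apply) auto
    also have "\<dots> = (\<Sum>k<n. if x = g [^] k then \<Sum>j<n. (\<omega> ^ k) ^ j else 0) / of_nat n"
      unfolding p_def sum_divide_distrib[symmetric]
      by (subst sum.swap)
        (auto simp: power_mult[symmetric] mult.commute intro!: sum.cong arg_cong2[of _ _ _ _ "(/)"])
    also have "(\<Sum>k<n. if x = g [^] k then \<Sum>j<n. (\<omega> ^ k) ^ j else 0)
        = (\<Sum>k<n. if k = 0 then (if x = \<one> then of_nat n else 0) else 0)"
    proof (intro sum.cong refl)
      fix k assume "k \<in> {..<n}"
      \<comment> \<open>Primitivity of \<omega> enters here: \<omega>^k is an n-th root of unity
        other than 1, so its geometric sum vanishes.\<close>
      then have "(\<Sum>j<n. (\<omega> ^ k) ^ j) = 0" if "k \<noteq> 0"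
        using that \<omega>k[of k] by (subst geometric_sum) (auto simp: \<omega>pow)
      then show "(if x = g [^] k then \<Sum>j<n. (\<omega> ^ k) ^ j else 0)
          = (if k = 0 then (if x = \<one> then of_nat n else 0) else 0)"
        by auto
    qed
    also have "\<dots> = (if x = \<one> then of_nat n else 0)" using n by (simp add: sum.delta)
    finally show "(\<Oplus>\<^bsub>group_ring G\<^esub>j\<in>{..<n}. p j) x = single class_ring \<one> x"
      using n by (auto simp: single_class_ring)
  qed
  have eig: "single class_ring g \<otimes>\<^bsub>group_ring G\<^esub> p j = cscal (inverse (\<omega> ^ j)) \<otimes>\<^bsub>group_ring G\<^esub> p j" for j
    unfolding cscal_mult[OF p] single_mult[OF g]
  proof
    fix x
    let ?u = "\<omega> ^ j"
    let ?F = "\<lambda>k. if x = g [^] k then ?u ^ k else 0"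
    have u: "?u \<noteq> 0" "?u ^ n = 1" using \<omega>0 \<omega>pow by auto
    show "(if x \<in> carrier G then p j (inv g \<otimes> x) else 0) = inverse ?u * p j x"
    proof (cases "x \<in> carrier G")
      case True
      have "inv g \<otimes> x = g [^] k \<longleftrightarrow> x = g [^] Suc k" for k
        using g True inv_solve_left[of "g [^] k" g x] by (auto simp: m_comm)
      then have "p j (inv g \<otimes> x) = (\<Sum>k<n. inverse ?u * ?F (Suc k)) / of_nat n"
        unfolding p_def using u(1) by (auto intro!: arg_cong2[of _ _ _ _ "(/)"] sum.cong)
      also have "(\<Sum>k<n. inverse ?u * ?F (Suc k)) = inverse ?u * (\<Sum>k<n. ?F (Suc k))"
        by (simp add: sum_distrib_left)
      \<comment> \<open>The shifted sum wraps around: the terms at n and at 0 agree because g^n = 1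
        and (\<omega>^j)^n = 1.\<close>
      also have "(\<Sum>k<n. ?F (Suc k)) = (\<Sum>k<n. ?F k)"
      proof -
        have "(\<Sum>k<n. ?F k) + ?F n = ?F 0 + (\<Sum>k<n. ?F (Suc k))"
          using sum.lessThan_Suc[of ?F n] sum.lessThan_Suc_shift[of ?F n] by metis
        moreover have "?F n = ?F 0" using gn u(2) by simp
        ultimately show ?thesis by simp
      qed
      finally show ?thesis using True by (simp add: p_def)
    next
      case False
      then show ?thesis using p[of j] by (simp add: group_ring_carrier_iff)
    qed
  qed
  have "\<exists>j<n. p j \<odot>\<^bsub>V\<^esub> v \<noteq> \<zero>\<^bsub>V\<^esub>"
  proof (rule ccontr)
    assume "\<not> (\<exists>j<n. p j \<odot>\<^bsub>V\<^esub> v \<noteq> \<zero>\<^bsub>V\<^esub>)"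
    then have "(\<Oplus>\<^bsub>V\<^esub>j\<in>{..<n}. p j \<odot>\<^bsub>V\<^esub> v) = (\<Oplus>\<^bsub>V\<^esub>j\<in>{..<n}. \<zero>\<^bsub>V\<^esub>)"
      by (intro V.M.finsum_cong') auto
    moreover have "(\<Oplus>\<^bsub>V\<^esub>j\<in>{..<n}. p j \<odot>\<^bsub>V\<^esub> v) = v"
      using V.finsum_smult_r[of v p "{..<n}"] p v(1) V.smult_one[OF v(1)] by (simp add: sum_p)
    ultimately show False using v(2) by simp
  qed
  then obtain j where j: "p j \<odot>\<^bsub>V\<^esub> v \<noteq> \<zero>\<^bsub>V\<^esub>" by auto
  have "single class_ring g \<odot>\<^bsub>V\<^esub> (p j \<odot>\<^bsub>V\<^esub> v) = cscal (inverse (\<omega> ^ j)) \<odot>\<^bsub>V\<^esub> (p j \<odot>\<^bsub>V\<^esub> v)"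
    using V.smult_assoc1[OF single_group_ring_closed[OF g] p v(1)] V.smult_assoc1[OF cscal_closed p v(1)]
    by (simp add: eig)
  then show ?thesis using j p v(1) by (intro that[of "p j \<odot>\<^bsub>V\<^esub> v"]) auto
qed

lemma smult_commute:
  assumes "module (group_ring G) V" "a \<in> carrier (group_ring G)" "b \<in> carrier (group_ring G)" "v \<in> carrier V"
  shows "a \<odot>\<^bsub>V\<^esub> (b \<odot>\<^bsub>V\<^esub> v) = b \<odot>\<^bsub>V\<^esub> (a \<odot>\<^bsub>V\<^esub> v)"
proof -
  interpret V: Module.module "group_ring G" V by fact
  show ?thesis
    using assms V.smult_assoc1[of a b v] V.smult_assoc1[of b a v] by (simp add: group_ring_comm)
qed

text \<open>Schur's argument: by commutativity of the group ring an eigenspace of g is a submodule,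
  and one that contains an eigenvector must be all of V.\<close>

lemma irreducible_scalar:
  assumes V: "irreducible_module (group_ring G) V" and g: "g \<in> carrier G"
  shows "\<exists>c. \<forall>v\<in>carrier V. single class_ring g \<odot>\<^bsub>V\<^esub> v = cscal c \<odot>\<^bsub>V\<^esub> v"
proof -
  have M: "module (group_ring G) V" and ne: "carrier V \<noteq> {\<zero>\<^bsub>V\<^esub>}"
    and irr: "\<And>N. LinearCombinations.submodule (group_ring G) N V \<Longrightarrow> N = {\<zero>\<^bsub>V\<^esub>} \<or> N = carrier V"
    using V by (auto simp: irreducible_module_def)
  interpret V: Module.module "group_ring G" V by (rule M)
  obtain v where v: "v \<in> carrier V" "v \<noteq> \<zero>\<^bsub>V\<^esub>" using ne V.M.zero_closed by blast
  obtain c w where w: "w \<in> carrier V" "w \<noteq> \<zero>\<^bsub>V\<^esub>" "single class_ring g \<odot>\<^bsub>V\<^esub> w = cscal c \<odot>\<^bsub>V\<^esub> w"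
    using exists_eigenvector[OF M g v] .
  let ?N = "{v \<in> carrier V. single class_ring g \<odot>\<^bsub>V\<^esub> v = cscal c \<odot>\<^bsub>V\<^esub> v}"
  note sg = single_group_ring_closed[OF g]
  have "LinearCombinations.submodule (group_ring G) ?N V"
  proof (rule LinearCombinations.submodule.intro[OF M])
    fix a v assume a: "a \<in> carrier (group_ring G)" and v: "v \<in> ?N"
    have "single class_ring g \<odot>\<^bsub>V\<^esub> (a \<odot>\<^bsub>V\<^esub> v) = a \<odot>\<^bsub>V\<^esub> (single class_ring g \<odot>\<^bsub>V\<^esub> v)"
      using a v sg by (intro smult_commute[OF M]) auto
    also have "\<dots> = a \<odot>\<^bsub>V\<^esub> (cscal c \<odot>\<^bsub>V\<^esub> v)" using v by simp
    also have "\<dots> = cscal c \<odot>\<^bsub>V\<^esub> (a \<odot>\<^bsub>V\<^esub> v)"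
      using a v by (intro smult_commute[OF M]) auto
    finally show "a \<odot>\<^bsub>V\<^esub> v \<in> ?N" using a v by simp
  qed (use sg in \<open>auto simp: V.smult_r_distr\<close>)
  from irr[OF this] have "?N = carrier V" using w by auto
  then show ?thesis by blast
qed

text \<open>All group elements act by scalars, so V is a line and the trace of a is the scalar by
  which a acts. Multiplicativity of \<open>c\<close> is read off from the action on one nonzero
  vector.\<close>

lemma irreducible_character:
  fixes V :: "('a \<Rightarrow> complex, 'w, 'y) module_scheme"
  assumes V: "irreducible_module (group_ring G) V" and A: "artin_representation G V"
  obtains c :: "'a \<Rightarrow> complex" where "\<And>g h. \<lbrakk>g \<in> carrier G; h \<in> carrier G\<rbrakk> \<Longrightarrow> c (g \<otimes> h) = c g * c h"
    "c \<one> = 1"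
    "\<And>a. a \<in> carrier (group_ring G) \<Longrightarrow> artin_character G V a = (\<Sum>g\<in>carrier G. a g * c g)"
proof -
  have M: "module (group_ring G) V" and ne: "carrier V \<noteq> {\<zero>\<^bsub>V\<^esub>}"
    and irr: "\<And>N. LinearCombinations.submodule (group_ring G) N V \<Longrightarrow> N = {\<zero>\<^bsub>V\<^esub>} \<or> N = carrier V"
    using V by (auto simp: irreducible_module_def)
  interpret V: Module.module "group_ring G" V by (rule M)
  interpret C: vectorspace class_ring "complex_space G V" by (rule vectorspace_complex_space[OF M])
  obtain v where v: "v \<in> carrier V" "v \<noteq> \<zero>\<^bsub>V\<^esub>" using ne V.M.zero_closed by blast
  obtain c where c: "\<And>g v. \<lbrakk>g \<in> carrier G; v \<in> carrier V\<rbrakk> \<Longrightarrow> single class_ring g \<odot>\<^bsub>V\<^esub> v = cscal (c g) \<odot>\<^bsub>V\<^esub> v"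
    using irreducible_scalar[OF V] by metis
  have mult: "cscal z \<odot>\<^bsub>V\<^esub> (cscal z' \<odot>\<^bsub>V\<^esub> w) = cscal (z * z') \<odot>\<^bsub>V\<^esub> w" if "w \<in> carrier V" for z z' w
    using C.smult_assoc1[of z z' w] that by simp
  have act: "a \<odot>\<^bsub>V\<^esub> w = cscal (\<Sum>g\<in>carrier G. a g * c g) \<odot>\<^bsub>V\<^esub> w"
    if a: "a \<in> carrier (group_ring G)" and w: "w \<in> carrier V" for a w
  proof -
    have "a \<odot>\<^bsub>V\<^esub> w = (\<Oplus>\<^bsub>V\<^esub>g\<in>carrier G. cscal (a g * c g) \<odot>\<^bsub>V\<^esub> w)"
      unfolding group_ring_smult_decomp[OF M a w]
      using w by (intro V.M.finsum_cong') (auto simp: c mult)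
    also have "\<dots> = (\<Sum>g\<in>carrier G. a g * c g) \<odot>\<^bsub>complex_space G V\<^esub> w"
      using C.finsum_smult_r[of w "\<lambda>g. a g * c g" "carrier G"] w
      by (simp add: finsum_complex_space class_ring_simps)
    finally show ?thesis by simp
  qed
  \<comment> \<open>The complex line through v. It is a submodule because the whole group ring acts
    by scalars, and being nonzero it equals V; \<open>\<xi>\<close> below is the coordinate along
    v.\<close>
  let ?N = "{cscal z \<odot>\<^bsub>V\<^esub> v | z. True}"
  have "LinearCombinations.submodule (group_ring G) ?N V"
  proof (rule LinearCombinations.submodule.intro[OF M])
    show "x \<oplus>\<^bsub>V\<^esub> y \<in> ?N" if xy: "x \<in> ?N" "y \<in> ?N" for x y
    proof -
      obtain z z' where "x = cscal z \<odot>\<^bsub>V\<^esub> v" "y = cscal z' \<odot>\<^bsub>V\<^esub> v" using xy by blast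
      then have "x \<oplus>\<^bsub>V\<^esub> y = cscal (z + z') \<odot>\<^bsub>V\<^esub> v" using C.smult_l_distr[of z z' v] v by simp
      then show ?thesis by blast
    qed
    show "a \<odot>\<^bsub>V\<^esub> x \<in> ?N" if ax: "a \<in> carrier (group_ring G)" "x \<in> ?N" for a x
    proof -
      obtain z where "x = cscal z \<odot>\<^bsub>V\<^esub> v" using ax by blast
      then have "a \<odot>\<^bsub>V\<^esub> x = cscal ((\<Sum>g\<in>carrier G. a g * c g) * z) \<odot>\<^bsub>V\<^esub> v"
        using ax v act[OF ax(1), of x] V.smult_closed[OF cscal_closed v(1)] by (simp add: mult)
      then show ?thesis by blast
    qed
    have "cscal 0 \<odot>\<^bsub>V\<^esub> v = \<zero>\<^bsub>V\<^esub>" using C.smult_l_null[of v] v by simp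
    then show "\<zero>\<^bsub>V\<^esub> \<in> ?N" by (intro CollectI exI[of _ 0]) simp
  qed (use v V.smult_closed[OF cscal_closed] in auto)
  moreover have "v \<in> ?N"
    using C.smult_one[of v] v by (intro CollectI exI[of _ 1]) simp
  ultimately have N: "?N = carrier V" using irr v(2) by blast
  define \<xi> where "\<xi> = (\<lambda>m. THE z. m = cscal z \<odot>\<^bsub>V\<^esub> v)"
  have \<xi>: "\<xi> (cscal z \<odot>\<^bsub>V\<^esub> v) = z" for z
    unfolding \<xi>_def using cscal_smult_inj[OF M v] by (intro the_equality) auto
  have rep: "\<exists>z. m = cscal z \<odot>\<^bsub>V\<^esub> v" if "m \<in> carrier V" for m using that N by blast
  have db: "dual_basis class_ring (complex_space G V) {v} (\<lambda>w. w) (\<lambda>_. \<xi>)"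
  proof -
    have 1: "\<xi> (m \<oplus>\<^bsub>V\<^esub> m') = \<xi> m + \<xi> m'" if mm: "m \<in> carrier V" "m' \<in> carrier V" for m m'
    proof -
      obtain z z' where "m = cscal z \<odot>\<^bsub>V\<^esub> v" "m' = cscal z' \<odot>\<^bsub>V\<^esub> v" using rep mm by metis
      moreover from this have "m \<oplus>\<^bsub>V\<^esub> m' = cscal (z + z') \<odot>\<^bsub>V\<^esub> v" using C.smult_l_distr[of z z' v] v by simp
      ultimately show ?thesis by (simp only: \<xi>)
    qed
    have 2: "\<xi> (cscal a \<odot>\<^bsub>V\<^esub> m) = a * \<xi> m" if m: "m \<in> carrier V" for a m
    proof -
      obtain z where "m = cscal z \<odot>\<^bsub>V\<^esub> v" using rep m by metis
      then show ?thesis using v by (simp only: mult \<xi>)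
    qed
    have 3: "cscal (\<xi> m) \<odot>\<^bsub>V\<^esub> v = m" if m: "m \<in> carrier V" for m
    proof -
      obtain z where "m = cscal z \<odot>\<^bsub>V\<^esub> v" using rep m by metis
      then show ?thesis by (simp only: \<xi>)
    qed
    show ?thesis
      unfolding dual_basis_def finsum_complex_space using v 1 2 3
      by (auto simp: linear_forms_def V.smult_closed[OF cscal_closed])
  qed
  have char: "artin_character G V a = (\<Sum>g\<in>carrier G. a g * c g)" if "a \<in> carrier (group_ring G)" for a
    using artin_character_eq[OF A db that] act[OF that v(1)] \<xi> by simp
  have one: "c \<one> = 1"
    using c[of \<one> v] v V.smult_one[OF v(1)] C.smult_one[of v] by (intro cscal_smult_inj[OF M v]) simp
  have hom: "c (g \<otimes> h) = c g * c h" if "g \<in> carrier G" "h \<in> carrier G" for g h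
  proof (rule cscal_smult_inj[OF M v])
    have "cscal (c (g \<otimes> h)) \<odot>\<^bsub>V\<^esub> v = single class_ring g \<odot>\<^bsub>V\<^esub> (single class_ring h \<odot>\<^bsub>V\<^esub> v)"
      using that v by (simp add: c[symmetric] single_mult_single[symmetric] V.smult_assoc1 single_group_ring_closed)
    also have "\<dots> = cscal (c g * c h) \<odot>\<^bsub>V\<^esub> v"
      using that v V.smult_closed[OF cscal_closed v(1)] by (simp add: c mult)
    finally show "cscal (c (g \<otimes> h)) \<odot>\<^bsub>V\<^esub> v = cscal (c g * c h) \<odot>\<^bsub>V\<^esub> v" .
  qed
  show ?thesis using hom one char by (rule that)
qed

lemma artin_character_minus:
  assumes V: "artin_representation G V" and a: "a \<in> carrier (group_ring G)" "b \<in> carrier (group_ring G)"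
  shows "artin_character G V (a \<ominus>\<^bsub>group_ring G\<^esub> b) = artin_character G V a - artin_character G V b"
proof -
  \<comment> \<open>Additivity is applied to a = (a - b) + b, with the two truth values as index
    set.\<close>
  let ?f = "\<lambda>i. if i then a \<ominus>\<^bsub>group_ring G\<^esub> b else b"
  have "(\<Oplus>\<^bsub>group_ring G\<^esub>i\<in>{True, False}. ?f i) = a"
    using a GR.minus_closed[OF a] by (simp add: group_ring_minus[OF a] del: insert_UNIV)
  then show ?thesis
    using artin_character_finsum[OF V, of ?f "{True, False}"] a by simp
qed

text \<open>Translating the sum by an h with c(h) different from 1 multiplies it by c(h), so it must
  vanish.\<close>

lemma subgroup_character_sum:
  fixes c :: "'a \<Rightarrow> complex"
  assumes H: "subgroup H G" and c: "\<And>g h. \<lbrakk>g \<in> carrier G; h \<in> carrier G\<rbrakk> \<Longrightarrow> c (g \<otimes> h) = c g * c h"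
  shows "(\<Sum>g\<in>H. c g) = (if \<forall>g\<in>H. c g = 1 then of_nat (card H) else 0)"
proof (cases "\<forall>g\<in>H. c g = 1")
  case False
  then obtain h where h: "h \<in> H" "c h \<noteq> 1" by blast
  interpret H: subgroup H G by (rule H)
  have "(\<Sum>g\<in>H. c g) = (\<Sum>g\<in>H. c (h \<otimes> g))"
    by (rule sum.reindex_bij_witness[of _ "\<lambda>g. h \<otimes> g" "\<lambda>g. inv h \<otimes> g"])
      (use h H.subset in \<open>auto simp: m_assoc[symmetric] subsetD\<close>)
  also have "\<dots> = c h * (\<Sum>g\<in>H. c g)"
    unfolding sum_distrib_left using h H.subset by (intro sum.cong) (auto simp: c)
  finally show ?thesis using h False by auto
qed simp

end

section \<open>Orbit counting and the theorem\<close>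

context finite_comm_group_action
begin

text \<open>Commutativity gives g h x = h g x, and h acts injectively. This makes
  \<open>orbit_stabilizer\<close> well defined.\<close>

lemma stabilizer_act:
  assumes "x \<in> S" "h \<in> carrier G"
  shows "stabilizer G \<phi> (\<phi> h x) = stabilizer G \<phi> x"
proof -
  have "\<phi> g (\<phi> h x) = \<phi> h (\<phi> g x)" if "g \<in> carrier G" for g
    using assms that composition_rule[of x g h] composition_rule[of x h g] by (simp add: m_comm)
  moreover have "\<phi> h y = \<phi> h x \<longleftrightarrow> y = x" if "y \<in> S" for y
    using inj_prop[OF assms(2)] assms(1) that by (auto dest: inj_onD)
  ultimately show ?thesis using assms by (auto simp: stabilizer_def)
qed

lemma orbit_stabilizer_eq:
  assumes "x \<in> S"
  shows "orbit_stabilizer G \<phi> (orbit G \<phi> x) = stabilizer G \<phi> x"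
proof -
  have "stabilizer G \<phi> ` orbit G \<phi> x = {stabilizer G \<phi> x}"
    using assms stabilizer_act orbit_refl[OF assms] by (auto simp: orbit_def)
  then show ?thesis by (simp add: orbit_stabilizer_def)
qed

lemma orbit_eq:
  assumes "x \<in> S" "y \<in> orbit G \<phi> x"
  shows "orbit G \<phi> y = orbit G \<phi> x"
proof -
  have y: "y \<in> S" using assms by (auto simp: orbit_def)
  have sub: "orbit G \<phi> z \<subseteq> S" if "z \<in> S" for z using that by (auto simp: orbit_def)
  show ?thesis
    using orbit_trans[of x y] orbit_trans[of y x] orbit_sym[OF assms(1) y assms(2)] assms y
      sub[OF y] sub[OF assms(1)] by blast
qed

lemma sum_over_orbits:
  fixes F :: "'s \<Rightarrow> complex"
  shows "(\<Sum>x\<in>S. F x) = (\<Sum>s\<in>orbits G S \<phi>. \<Sum>x\<in>s. F x)"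
proof -
  have U: "S = \<Union> (orbits G S \<phi>)"
  proof (intro equalityI subsetI)
    fix x assume "x \<in> S"
    then show "x \<in> \<Union> (orbits G S \<phi>)" using orbit_refl by (auto simp: orbits_def)
  qed (auto simp: orbits_def orbit_def)
  have "finite s" if "s \<in> orbits G S \<phi>" for s
    using that finite_set Union_upper[OF that] U finite_subset by metis
  moreover have "s \<inter> t = {}" if "s \<in> orbits G S \<phi>" "t \<in> orbits G S \<phi>" "s \<noteq> t" for s t
    using that orbit_eq unfolding orbits_def by blast
  ultimately have "sum F (\<Union> (orbits G S \<phi>)) = (sum \<circ> sum) F (orbits G S \<phi>)"
    by (intro sum.Union_disjoint) auto
  then show ?thesis using U by (simp add: comp_def)
qed

text \<open>Burnside's orbit count twisted by a character; c = 1 gives the classical form.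
  Exchanging the sums leaves character sums over stabilizers, and an orbit on whose stabilizer c is
  trivial contributes its length times the order of the stabilizer, which is |G|.\<close>

lemma character_sum_invariants:
  fixes c :: "'g \<Rightarrow> complex"
  assumes c: "\<And>g h. \<lbrakk>g \<in> carrier G; h \<in> carrier G\<rbrakk> \<Longrightarrow> c (g \<otimes> h) = c g * c h"
  shows "(\<Sum>g\<in>carrier G. of_nat (card (invariants S \<phi> g)) * c g) / of_nat (card (carrier G))
    = of_nat (card {s \<in> orbits G S \<phi>. \<forall>g\<in>orbit_stabilizer G \<phi> s. c g = 1})"
proof -
  let ?good = "\<lambda>H. \<forall>g\<in>H. c g = 1"
  have "(\<Sum>g\<in>carrier G. of_nat (card (invariants S \<phi> g)) * c g)
      = (\<Sum>g\<in>carrier G. \<Sum>x\<in>S. if \<phi> g x = x then c g else 0)"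
    using finite_set by (intro sum.cong refl) (simp add: invariants_def sum.If_cases Int_def)
  also have "\<dots> = (\<Sum>x\<in>S. \<Sum>g\<in>stabilizer G \<phi> x. c g)"
    using finite_carrier
    by (subst sum.swap) (simp add: stabilizer_def sum.If_cases Int_def)
  also have "\<dots> = (\<Sum>x\<in>S. if ?good (stabilizer G \<phi> x) then of_nat (card (stabilizer G \<phi> x)) else 0)"
    using stabilizer_subgroup subgroup_character_sum[OF _ c] by (intro sum.cong) auto
  also have "\<dots> = (\<Sum>s\<in>orbits G S \<phi>. if ?good (orbit_stabilizer G \<phi> s) then of_nat (card (carrier G)) else 0)"
    unfolding sum_over_orbits
  proof (intro sum.cong refl)
    fix s assume "s \<in> orbits G S \<phi>"
    then obtain x where x: "x \<in> S" and s: "s = orbit G \<phi> x" by (auto simp: orbits_def)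
    have st: "stabilizer G \<phi> y = stabilizer G \<phi> x" if "y \<in> s" for y
      using that x stabilizer_act by (auto simp: s orbit_def)
    have "(\<Sum>y\<in>s. if ?good (stabilizer G \<phi> y) then of_nat (card (stabilizer G \<phi> y)) else 0)
        = (\<Sum>y\<in>s. if ?good (stabilizer G \<phi> x) then of_nat (card (stabilizer G \<phi> x)) else 0 :: complex)"
      using st by (intro sum.cong) auto
    also have "\<dots> = (if ?good (stabilizer G \<phi> x) then of_nat (card s * card (stabilizer G \<phi> x)) else 0)"
      by simp
    also have "card s * card (stabilizer G \<phi> x) = card (carrier G)"
      using orbit_stabilizer_theorem[OF x] by (simp add: s Coset.order_def)
    finally show "(\<Sum>y\<in>s. if ?good (stabilizer G \<phi> y) then of_nat (card (stabilizer G \<phi> y)) else 0)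
        = (if ?good (orbit_stabilizer G \<phi> s) then of_nat (card (carrier G)) else 0 :: complex)"
      by (simp add: s orbit_stabilizer_eq[OF x])
  qed
  also have "\<dots> = of_nat (card {s \<in> orbits G S \<phi>. ?good (orbit_stabilizer G \<phi> s)}) * of_nat (card (carrier G))"
  proof -
    have "finite (orbits G S \<phi>)" using finite_set by (simp add: orbits_def)
    then show ?thesis by (simp add: sum.If_cases Int_def)
  qed
  finally show ?thesis using card_carrier_pos by simp
qed

end

section \<open>Counting edges of the quotient\<close>

lemma card_filter_split: "finite A \<Longrightarrow> card A = card {x \<in> A. p x} + card {x \<in> A. \<not> p x}"
  by (subst card_Un_disjoint[symmetric]) (auto intro: arg_cong[where f = card])

lemma card_involution_pairs:
  assumes "finite D" and j: "\<And>s. s \<in> D \<Longrightarrow> j s \<in> D" "\<And>s. s \<in> D \<Longrightarrow> j (j s) = s" "\<And>s. s \<in> D \<Longrightarrow> j s \<noteq> s"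
  shows "2 * card ((\<lambda>s. {s, j s}) ` D) = card D"
proof -
  have U: "\<Union> ((\<lambda>s. {s, j s}) ` D) = D" using j(1) by auto
  have "2 * card ((\<lambda>s. {s, j s}) ` D) = card (\<Union> ((\<lambda>s. {s, j s}) ` D))"
  proof (rule card_partition)
    show "card c = 2" if "c \<in> (\<lambda>s. {s, j s}) ` D" for c
      using that j(3) by (fastforce simp: card_2_iff)
    show "c1 \<inter> c2 = {}" if "c1 \<in> (\<lambda>s. {s, j s}) ` D" "c2 \<in> (\<lambda>s. {s, j s}) ` D" "c1 \<noteq> c2" for c1 c2
      using that j(2) by (auto, metis+)
  qed (use assms U in auto)
  then show ?thesis by (simp add: U)
qed

text \<open>The members of \<open>D\<close> with property \<open>p\<close> are those in
  \<open>Or\<close> together with their mirror images under \<open>j\<close>, without overlap. This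
  relates \<open>r1\<close>, counted on an orientation, to a count over all directed edges.\<close>

lemma card_half_of_involution:
  assumes "finite D" and j: "\<And>s. s \<in> D \<Longrightarrow> j s \<in> D" "\<And>s. s \<in> D \<Longrightarrow> j (j s) = s"
    and Or: "Or \<subseteq> D" "\<And>s. s \<in> D \<Longrightarrow> (s \<in> Or) \<noteq> (j s \<in> Or)"
    and p: "\<And>s. s \<in> D \<Longrightarrow> p (j s) = p s"
  shows "2 * card {s \<in> Or. p s} = card {s \<in> D. p s}"
proof -
  have D: "{s \<in> D. p s} = {s \<in> Or. p s} \<union> j ` {s \<in> Or. p s}"
  proof (intro equalityI subsetI)
    fix s assume "s \<in> {s \<in> D. p s}"
    then have s: "s \<in> D" "p s" by auto
    show "s \<in> {s \<in> Or. p s} \<union> j ` {s \<in> Or. p s}"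
    proof (cases "s \<in> Or")
      case False
      then have "j s \<in> {s \<in> Or. p s}" using s Or(2)[OF s(1)] p[OF s(1)] by simp
      then show ?thesis using j(2)[OF s(1)] by (metis UnI2 imageI)
    qed (use s in simp)
  next
    fix s assume "s \<in> {s \<in> Or. p s} \<union> j ` {s \<in> Or. p s}"
    then consider "s \<in> Or" "p s" | t where "t \<in> Or" "p t" "s = j t" by blast
    then show "s \<in> {s \<in> D. p s}"
      using Or(1) j(1) p by cases (simp_all add: subsetD)
  qed
  have "inj_on j {s \<in> Or. p s}"
    using Or(1) j(2) by (intro inj_on_inverseI[of _ j]) auto
  moreover have "{s \<in> Or. p s} \<inter> j ` {s \<in> Or. p s} = {}" using Or by auto
  moreover have "finite {s \<in> Or. p s}" using Or(1) assms(1) by (auto intro: finite_subset)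
  ultimately show ?thesis unfolding D by (subst card_Un_disjoint) (auto simp: card_image)
qed

theorem theorem5p2:
  fixes G :: "('g, 'm) monoid_scheme"
    and Y :: "('v, 'e) serre_graph"
    and av :: "'g \<Rightarrow> 'v \<Rightarrow> 'v"
    and ae :: "'g \<Rightarrow> 'e \<Rightarrow> 'e"
    and X :: "('v set, 'e set) serre_graph"
    and V :: "('g \<Rightarrow> complex, 'w) module"
  assumes "comm_group G" and "finite (carrier G)"
    and "finite_serre_graph Y"
    and "graph_action_without_inversion G Y av ae"
    and "X = quotient_graph G Y av ae"
    and "artin_representation G V"
  shows "of_int (chi_rep G Y av ae V) = artin_character G V (chi_group_ring G Y av ae) \<and>
    (\<forall>\<psi>. irreducible_module (group_ring G) V \<and>
          (\<forall>g\<in>carrier G. \<psi> g = artin_character G V (single class_ring g)) \<longrightarrow>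
       (\<forall>Or. is_orientation X Or \<longrightarrow>
          chi_rep G Y av ae V = euler_char X - int (r0 G Y av ae \<psi>) + int (r1 G ae Or \<psi>)) \<and>
       (acts_freely G (dedges Y) ae \<longrightarrow>
          chi_rep G Y av ae V = euler_char X - int (r0 G Y av ae \<psi>)))"
proof (intro conjI allI impI)
  interpret act: graph_action_without_inversion G Y av ae by fact
  interpret Y: finite_serre_graph Y by fact
  interpret G: finite_comm_group G
    using assms(1,2) by (simp add: finite_comm_group_def finite_comm_group_axioms_def)
  interpret V0: finite_comm_group_action G "verts Y" av
    by unfold_locales (rule Y.finite_verts)
  interpret E1: involutive_action G "dedges Y" ae "opp Y"
    by unfold_locales
      (auto simp: Y.finite_dedges act.opp_closed act.opp_opp act.opp_equivariant act.no_inversion)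
  note V = assms(6)
  have c0: "chains0 G Y av = V0.P" by (simp add: chains0_def)
  have c1: "chains1 G Y ae = E1.Q" by (simp add: chains1_def E1.W_def)
  let ?R0 = "hs_rank (group_ring G) V0.P" and ?R1 = "hs_rank (group_ring G) E1.Q"
  have R: "?R0 \<in> carrier (group_ring G)" "?R1 \<in> carrier (group_ring G)"
    unfolding V0.P.hs_rank_eq[OF G.group_ring_nontrivial V0.perm_module_dual_basis]
      E1.Q.hs_rank_eq[OF G.group_ring_nontrivial E1.quotient_dual_basis]
    using dual_basisD(2,4)[OF V0.perm_module_dual_basis] dual_basisD(2,4)[OF E1.quotient_dual_basis]
    by (auto intro!: G.GR.finsum_closed)
  have chi: "of_int (chi_rep G Y av ae V) = artin_character G V ?R0 - artin_character G V ?R1"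
    using G.complex_dim_tensor_product[OF V V0.P.module_axioms V0.perm_module_dual_basis]
      G.complex_dim_tensor_product[OF V E1.Q.module_axioms E1.quotient_dual_basis]
    by (simp add: chi_rep_def c0 c1)
  then show "of_int (chi_rep G Y av ae V) = artin_character G V (chi_group_ring G Y av ae)"
    by (simp add: chi_group_ring_def c0 c1 G.artin_character_minus[OF V R])
  fix \<psi>
  assume \<psi>: "irreducible_module (group_ring G) V \<and>
    (\<forall>g\<in>carrier G. \<psi> g = artin_character G V (single class_ring g))"
  obtain c where hom: "\<And>g h. \<lbrakk>g \<in> carrier G; h \<in> carrier G\<rbrakk> \<Longrightarrow> c (g \<otimes>\<^bsub>G\<^esub> h) = c g * c h"
    and c1': "c \<one>\<^bsub>G\<^esub> = 1"
    and char: "\<And>a. a \<in> carrier (group_ring G) \<Longrightarrow> artin_character G V a = (\<Sum>g\<in>carrier G. a g * c g)"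
    using G.irreducible_character[OF conjunct1[OF \<psi>] V] by blast
  have \<psi>c: "\<psi> g = c g" if "g \<in> carrier G" for g
  proof -
    have "\<psi> g = (\<Sum>h\<in>carrier G. single class_ring g h * c h)"
      using \<psi> that char[OF G.single_group_ring_closed[OF that]] by simp
    also have "\<dots> = (\<Sum>h\<in>carrier G. if h = g then c h else 0)"
      by (intro sum.cong) (auto simp: single_class_ring)
    finally show ?thesis using that assms(2) by (simp add: sum.delta)
  qed
  \<comment> \<open>The target \<open>units_of class_ring\<close> is the multiplicative group of the
    complex numbers, with identity 1. As \<psi> is prescribed only on G, the equivalence is
    restricted to subsets of the carrier.\<close>
  have ker: "H \<subseteq> kernel G (units_of class_ring) \<psi> \<longleftrightarrow> (\<forall>g\<in>H. c g = 1)" if "H \<subseteq> carrier G" for H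
    using that \<psi>c by (auto simp: kernel_def units_of_def)
  define VO where "VO = orbits G (verts Y) av"
  define EO where "EO = orbits G (dedges Y) ae"
  define good where "good = (\<lambda>H. H \<subseteq> kernel G (units_of class_ring) \<psi>)"
  let ?n0 = "card {s \<in> VO. good (orbit_stabilizer G av s)}"
  let ?n1 = "card {s \<in> EO. good (orbit_stabilizer G ae s)}"
  have finV: "finite VO" and finE: "finite EO"
    unfolding VO_def EO_def orbits_def using Y.finite_verts Y.finite_dedges by simp_all
  have goodV: "good (orbit_stabilizer G av s) \<longleftrightarrow> (\<forall>g\<in>orbit_stabilizer G av s. c g = 1)" if "s \<in> VO" for s
  proof -
    obtain x where "x \<in> verts Y" "s = orbit G av x" using \<open>s \<in> VO\<close> by (auto simp: VO_def orbits_def)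
    then show ?thesis
      using ker[OF act.verts_action.stabilizer_subset] by (simp add: good_def V0.orbit_stabilizer_eq)
  qed
  have goodE: "good (orbit_stabilizer G ae s) \<longleftrightarrow> (\<forall>g\<in>orbit_stabilizer G ae s. c g = 1)" if "s \<in> EO" for s
  proof -
    obtain x where "x \<in> dedges Y" "s = orbit G ae x" using \<open>s \<in> EO\<close> by (auto simp: EO_def orbits_def)
    then show ?thesis
      using ker[OF act.dedges_action.stabilizer_subset] by (simp add: good_def E1.orbit_stabilizer_eq)
  qed
  have "artin_character G V ?R0
      = (\<Sum>g\<in>carrier G. of_nat (card (invariants (verts Y) av g)) * c g) / of_nat (card (carrier G))"
    unfolding char[OF R(1)] sum_divide_distrib
    by (intro sum.cong) (auto simp: V0.perm_module_rank)
  also have "\<dots> = of_nat ?n0"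
  proof -
    have "{s \<in> VO. good (orbit_stabilizer G av s)} = {s \<in> VO. \<forall>g\<in>orbit_stabilizer G av s. c g = 1}"
      using goodV by blast
    then show ?thesis using V0.character_sum_invariants[of c] hom by (simp add: VO_def)
  qed
  finally have n0: "artin_character G V ?R0 = of_nat ?n0" .
  have "artin_character G V ?R1
      = (\<Sum>g\<in>carrier G. of_nat (card (invariants (dedges Y) ae g)) * c g) / of_nat (card (carrier G)) / 2"
    unfolding char[OF R(2)] sum_divide_distrib
    by (intro sum.cong) (auto simp: E1.quotient_rank)
  also have "\<dots> = of_nat ?n1 / 2"
  proof -
    have "{s \<in> EO. good (orbit_stabilizer G ae s)} = {s \<in> EO. \<forall>g\<in>orbit_stabilizer G ae s. c g = 1}"
      using goodE by blast
    then show ?thesis using E1.character_sum_invariants[of c] hom by (simp add: EO_def)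
  qed
  finally have n1: "artin_character G V ?R1 = of_nat ?n1 / 2" .
  \<comment> \<open>Doubling clears the half in the edge term, so that the identity can be pulled
    back from the complex numbers to the integers.\<close>
  have "(of_int (2 * chi_rep G Y av ae V) :: complex) = of_int (2 * int ?n0 - int ?n1)"
    using chi n0 n1 by (simp add: field_simps)
  then have chi2: "2 * chi_rep G Y av ae V = 2 * int ?n0 - int ?n1"
    by (simp only: of_int_eq_iff)
  have r0: "card VO = ?n0 + r0 G Y av ae \<psi>"
    using card_filter_split[OF finV, of "\<lambda>s. good (orbit_stabilizer G av s)"]
    by (simp add: r0_def quotient_graph_def VO_def good_def)
  have orb_opp: "opp Y ` orbit G ae e = orbit G ae (opp Y e)" if "e \<in> dedges Y" for e
    using that act.opp_equivariant by (force simp: orbit_def)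
  have j: "opp Y ` s \<in> EO" "opp Y ` opp Y ` s = s" "opp Y ` s \<noteq> s"
    "orbit_stabilizer G ae (opp Y ` s) = orbit_stabilizer G ae s" if s: "s \<in> EO" for s
  proof -
    obtain e where e: "e \<in> dedges Y" "s = orbit G ae e" using s by (auto simp: EO_def orbits_def)
    have e': "opp Y e \<in> dedges Y" by (rule act.opp_closed[OF e(1)])
    show "opp Y ` s \<in> EO" using e e' by (auto simp: EO_def orbits_def orb_opp)
    show "opp Y ` opp Y ` s = s" using e e' by (simp add: orb_opp act.opp_opp)
    \<comment> \<open>An orbit equal to its opposite would contain both e and opp e, that is, some g
      would invert e. This makes the involution on the quotient free of fixed points.\<close>
    show "opp Y ` s \<noteq> s"
    proof
      assume "opp Y ` s = s"
      then have "opp Y e \<in> orbit G ae e" using act.dedges_action.orbit_refl[OF e'] e by (simp add: orb_opp)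
      then obtain g where "g \<in> carrier G" "ae g e = opp Y e" by (auto simp: orbit_def)
      then show False using act.no_inversion e(1) by blast
    qed
    have "ae g (opp Y e) = opp Y e \<longleftrightarrow> ae g e = e" if "g \<in> carrier G" for g
      using act.opp_equivariant[OF that e(1)] act.opp_opp[OF e(1)]
        act.opp_opp[OF E1.act_closed[OF that e(1)]] by metis
    then have "stabilizer G ae (opp Y e) = stabilizer G ae e" by (auto simp: stabilizer_def)
    then show "orbit_stabilizer G ae (opp Y ` s) = orbit_stabilizer G ae s"
      using e e' by (simp add: orb_opp E1.orbit_stabilizer_eq)
  qed
  have EXX: "dedges X = EO" "opp X = image (opp Y)" "verts X = VO"
    by (simp_all add: assms(5) quotient_graph_def EO_def VO_def)
  have und: "2 * card (undirected_edges X) = card EO"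
    unfolding undirected_edges_def EXX using j by (intro card_involution_pairs[OF finE]) auto
  have euler: "euler_char X = int (card VO) - int (card (undirected_edges X))"
    by (simp add: euler_char_def EXX)
  show "chi_rep G Y av ae V = euler_char X - int (r0 G Y av ae \<psi>) + int (r1 G ae Or \<psi>)"
    if Or: "is_orientation X Or" for Or
  proof -
    have "2 * card {s \<in> Or. \<not> good (orbit_stabilizer G ae s)} = card {s \<in> EO. \<not> good (orbit_stabilizer G ae s)}"
    proof (rule card_half_of_involution[OF finE j(1,2)])
      show "Or \<subseteq> EO" "\<And>s. s \<in> EO \<Longrightarrow> (s \<in> Or) \<noteq> (opp Y ` s \<in> Or)"
        using Or by (simp_all add: is_orientation_def EXX)
    qed (simp_all add: j(4))
    then have "2 * r1 G ae Or \<psi> = card {s \<in> EO. \<not> good (orbit_stabilizer G ae s)}"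
      by (simp add: r1_def good_def)
    moreover have "card EO = ?n1 + card {s \<in> EO. \<not> good (orbit_stabilizer G ae s)}"
      by (rule card_filter_split[OF finE])
    \<comment> \<open>With n0 and n1 the numbers of good orbits: 2 chi = 2 n0 - n1, |V_X| = n0 + r0,
      and 2 |E_X| = n1 + 2 r1 because directed edge orbits come in pairs. Eliminating n0 and n1
      gives the formula.\<close>
    ultimately show ?thesis using chi2 r0 und euler by linarith
  qed
  show "chi_rep G Y av ae V = euler_char X - int (r0 G Y av ae \<psi>)" if free: "acts_freely G (dedges Y) ae"
  proof -
    \<comment> \<open>A trivial stabilizer lies in every kernel because c(1) = 1. So n1 counts all
      directed edge orbits, that is 2 |E_X|, and \<open>chi2\<close> yields the formula
      directly.\<close>
    have "good (orbit_stabilizer G ae s)" if "s \<in> EO" for s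
      using that free c1' goodE[OF that]
      by (auto simp: EO_def orbits_def E1.orbit_stabilizer_eq acts_freely_def)
    then have "{s \<in> EO. good (orbit_stabilizer G ae s)} = EO" by blast
    then show ?thesis using chi2 r0 und euler by simp
  qed
qed

end
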